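(* Let $T>0$, $a\in\mathbb{R}$, and $b\in C^1([0,T],\mathbb{R})$ with $b(0)\neq0$ be given. Let $A\in\mathcal{H}(E_1,E_0)$ and let $E_1$ be compactly embedded into $E_0$. Assume that there are $\gamma\in(0,1]$, $\theta\in(0,1]$, $\nu\in[0,1)$, $\ell>0$ and a constant $c_T>0$ such that $f:C_{\theta}((0,T],E_\theta)\to C_{\nu}((0,T],E_\gamma)$ is a Lipschitz mapping with $f(0)=0$ satisfying $$\|f(v)-f(w)\|_{C_{\nu}((0,T],E_\gamma)}\le c_T\,L^{\ell}\,\|v-w\|_{C_{\theta}((0,T],E_\theta)}$$ for all $L\in(0,1)$ and all $v,w\in C_{\theta}((0,T],E_\theta)$ with $$\|v\|_{C_{\theta}((0,T],E_\theta)}+\|w\|_{C_{\theta}((0,T],E_\theta)}\le L,\qquad \sup_{t\in(0,T]}\big(\|v(t)\|_0+\|w(t)\|_0\big)\le L .$$ Moreover, assume that the kernel of $$\Phi_T:=a\,e^{TA}+\int_0^Tb(t)\,e^{tA}\,\mathrm{d}t\in\mathcal{L}(E_0,E_1)$$ is trivial, that is, $\mathrm{ker}(\Phi_T)=\{0\}$. Then there is $m(T)>0$ such that, for each $M\in E_1$ with $\|M\|_1\le m(T)$, the problem $$u'=Au+f(u,t),\quad t\in(0,T],\qquad a\,u(T)+\int_0^Tb(t)\,u(t)\,\mathrm{d}t=M,$$ has a unique strong solution $$u\in C^1((0,T],E_0)\cap C((0,T],E_1)\cap C([0,T],E_0)\cap C_\theta((0,T],E_\theta).$$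
   Context: $E_0,E_1$ are Banach spaces with $E_1$ densely and continuously embedded in $E_0$; $\|\cdot\|_0,\|\cdot\|_1$ are their norms, and $\mathcal{L}(E,F)$ denotes bounded linear operators. $A\in\mathcal{H}(E_1,E_0)$ means that $A$ is the generator of an analytic semigroup $(e^{tA})_{t\ge0}$ on $E_0$ with domain $E_1$. For $\theta\in(0,1)$, $(\cdot,\cdot)_\theta$ is an arbitrary admissible interpolation functor of exponent $\theta$ (an interpolation functor of exponent $\theta$ for which $E_1$ is dense in $(E_0,E_1)_\theta$ whenever $E_1$ is dense in $E_0$; e.g. complex interpolation, or real interpolation with finite second parameter), and $E_\theta:=(E_0,E_1)_\theta$ with norm $\|\cdot\|_\theta$; for $\theta=0,1$ these are the given spaces. For $\mu\in\mathbb{R}$, $C_\mu((0,T],E_\theta)$ is the Banach space of all $u\in C((0,T],E_\theta)$ with $t^\mu u(t)\to0$ in $E_\theta$ as $t\to0^+$, with norm $\|u\|_{C_\mu((0,T],E_\theta)}:=\sup\{t^\mu\|u(t)\|_\theta: t\in(0,T]\}$. Notation: $f(u,t):=f(u)(t)$ for $t\in(0,T]$. A strong solution is a function with regularity $C^1((0,T],E_0)\cap C((0,T],E_1)\cap C([0,T],E_0)$ satisfying the differential equation pointwise on $(0,T]$ together with the stated time-average condition.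
   Formalization: Uniqueness is claimed only among strong solutions with small C_θ-norm and small sup of ‖u(t)‖_0; uniqueness in the whole class fails: for E_0=E_1=ℝ, A=0, T=a=1, b=-1/ln 2, M=0, f(u)=min(|u|,1)^2, both u=0 and u=1/(2-t) are solutions. *)

theory Defs
  imports "HOL-Analysis.Analysis"
begin

text \<open>
  Banach spaces are encoded as linear subspaces of an ambient vector space, equipped with
  their own norm, so that interpolation functors can be quantified over. The norm function
  is only relevant on the carrier.

  The scalar field is the real or the complex numbers: the parameter \<open>J\<close> is \<open>None\<close> for real
  spaces and \<open>Some i\<close> for complex ones, where \<open>i\<close> is multiplication by the imaginary unit.
\<close>

datatype 'a nspace = NSpace (car: "'a set") (nrm: "'a \<Rightarrow> real")

definition scalar_structure :: "('a::real_vector \<Rightarrow> 'a) option \<Rightarrow> bool" where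
  "scalar_structure J \<longleftrightarrow>
     (case J of None \<Rightarrow> True | Some i \<Rightarrow> linear i \<and> (\<forall>x. i (i x) = - x))"

definition cscale :: "('a::real_vector \<Rightarrow> 'a) \<Rightarrow> complex \<Rightarrow> 'a \<Rightarrow> 'a" where
  "cscale i c x = Re c *\<^sub>R x + Im c *\<^sub>R i x"

definition normed_on :: "('a::real_vector \<Rightarrow> 'a) option \<Rightarrow> 'a nspace \<Rightarrow> bool" where
  "normed_on J X \<longleftrightarrow>
     subspace (car X) \<and>
     (\<forall>x\<in>car X. 0 \<le> nrm X x \<and> (nrm X x = 0 \<longleftrightarrow> x = 0)) \<and>
     (\<forall>x\<in>car X. \<forall>y\<in>car X. nrm X (x + y) \<le> nrm X x + nrm X y) \<and>
     (\<forall>c. \<forall>x\<in>car X. nrm X (c *\<^sub>R x) = \<bar>c\<bar> * nrm X x) \<and>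
     (case J of None \<Rightarrow> True
      | Some i \<Rightarrow> (\<forall>x\<in>car X. i x \<in> car X) \<and>
                  (\<forall>c. \<forall>x\<in>car X. nrm X (cscale i c x) = cmod c * nrm X x))"

definition banach_on :: "('a::real_vector \<Rightarrow> 'a) option \<Rightarrow> 'a nspace \<Rightarrow> bool" where
  "banach_on J X \<longleftrightarrow>
     normed_on J X \<and>
     (\<forall>s::nat \<Rightarrow> 'a.
        (\<forall>k. s k \<in> car X) \<longrightarrow>
        (\<forall>\<epsilon>>0. \<exists>N. \<forall>m\<ge>N. \<forall>n\<ge>N. nrm X (s m - s n) < \<epsilon>) \<longrightarrow>
        (\<exists>x\<in>car X. (\<lambda>k. nrm X (s k - x)) \<longlonglongrightarrow> 0))"

definition cont_embedded :: "'a nspace \<Rightarrow> 'a nspace \<Rightarrow> bool" where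
  "cont_embedded X Y \<longleftrightarrow>
     car X \<subseteq> car Y \<and> (\<exists>c. \<forall>x\<in>car X. nrm Y x \<le> c * nrm X x)"

definition dense_in :: "'a::real_vector nspace \<Rightarrow> 'a nspace \<Rightarrow> bool" where
  "dense_in X Y \<longleftrightarrow>
     car X \<subseteq> car Y \<and> (\<forall>y\<in>car Y. \<forall>\<epsilon>>0. \<exists>x\<in>car X. nrm Y (x - y) < \<epsilon>)"

definition compactly_embedded :: "'a::real_normed_vector nspace \<Rightarrow> bool" where
  \<comment> \<open>compact embedding into the ambient normed space\<close>
  "compactly_embedded X \<longleftrightarrow>
     cont_embedded X (NSpace UNIV norm) \<and> compact (closure {x \<in> car X. nrm X x \<le> 1})"

definition lin_on :: "('a::real_vector \<Rightarrow> 'a) option \<Rightarrow> 'a set \<Rightarrow> ('a \<Rightarrow> 'a) \<Rightarrow> bool" where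
  "lin_on J C T \<longleftrightarrow>
     (\<forall>x\<in>C. \<forall>y\<in>C. T (x + y) = T x + T y) \<and>
     (\<forall>c. \<forall>x\<in>C. T (c *\<^sub>R x) = c *\<^sub>R T x) \<and>
     (case J of None \<Rightarrow> True | Some i \<Rightarrow> (\<forall>x\<in>C. T (i x) = i (T x)))"

definition op_bound :: "'a nspace \<Rightarrow> 'a nspace \<Rightarrow> ('a \<Rightarrow> 'a) \<Rightarrow> real \<Rightarrow> bool" where
  \<comment> \<open>for linear \<open>T\<close>: \<open>T\<close> maps \<open>X\<close> boundedly into \<open>Y\<close>, with operator norm at most \<open>B\<close>\<close>
  "op_bound X Y T B \<longleftrightarrow>
     0 \<le> B \<and> (\<forall>x\<in>car X. T x \<in> car Y \<and> nrm Y (T x) \<le> B * nrm X x)"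


section \<open>Interpolation functors\<close>

definition inter_space :: "'a nspace \<Rightarrow> 'a nspace \<Rightarrow> 'a nspace" where
  "inter_space X Y = NSpace (car X \<inter> car Y) (\<lambda>x. max (nrm X x) (nrm Y x))"

definition sum_space :: "'a::real_vector nspace \<Rightarrow> 'a nspace \<Rightarrow> 'a nspace" where
  "sum_space X Y =
     NSpace {x + y |x y. x \<in> car X \<and> y \<in> car Y}
            (\<lambda>z. Inf {nrm X x + nrm Y y |x y. x \<in> car X \<and> y \<in> car Y \<and> x + y = z})"

text \<open>
  An interpolation couple: both spaces embed continuously into a common Hausdorff
  topological vector space. One may always take the sum of the two spaces for it, so it
  can be required to be normed.
\<close>

definition banach_couple ::
    "('a::real_vector \<Rightarrow> 'a) option \<Rightarrow> 'a nspace \<Rightarrow> 'a nspace \<Rightarrow> bool" where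
  "banach_couple J X0 X1 \<longleftrightarrow>
     banach_on J X0 \<and> banach_on J X1 \<and>
     (\<exists>N. normed_on J N \<and> cont_embedded X0 N \<and> cont_embedded X1 N)"

text \<open>
  On morphisms the functor is restriction of operators, hence identities and composition
  are preserved automatically. The norm estimate is stated for all upper bounds of the two
  operator norms; its constant may depend on the two couples, which includes the
  convention of a single constant for the whole functor. The functor acts on couples of
  subspaces of the vector space underlying \<open>'a\<close>; an interpolation functor on all Banach
  couples restricts to one in this sense.
\<close>

definition interpolation_functor ::
    "('a::real_vector \<Rightarrow> 'a) option \<Rightarrow> real \<Rightarrow> ('a nspace \<Rightarrow> 'a nspace \<Rightarrow> 'a nspace) \<Rightarrow> bool"
  where
  "interpolation_functor J \<theta> F \<longleftrightarrow>
     (\<forall>X0 X1. banach_couple J X0 X1 \<longrightarrow>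
        banach_on J (F X0 X1) \<and>
        cont_embedded (inter_space X0 X1) (F X0 X1) \<and>
        cont_embedded (F X0 X1) (sum_space X0 X1)) \<and>
     (\<forall>X0 X1 Y0 Y1. banach_couple J X0 X1 \<longrightarrow> banach_couple J Y0 Y1 \<longrightarrow>
        (\<exists>c\<ge>0. \<forall>T B0 B1.
           lin_on J (car (sum_space X0 X1)) T \<longrightarrow>
           op_bound X0 Y0 T B0 \<longrightarrow> op_bound X1 Y1 T B1 \<longrightarrow>
           op_bound (F X0 X1) (F Y0 Y1) T (c * B0 powr (1 - \<theta>) * B1 powr \<theta>)))"

definition admissible_functor ::
    "('a::real_vector \<Rightarrow> 'a) option \<Rightarrow> real \<Rightarrow> ('a nspace \<Rightarrow> 'a nspace \<Rightarrow> 'a nspace) \<Rightarrow> bool"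
  where
  "admissible_functor J \<theta> F \<longleftrightarrow>
     interpolation_functor J \<theta> F \<and>
     (\<forall>X0 X1. banach_couple J X0 X1 \<longrightarrow> cont_embedded X1 X0 \<longrightarrow> dense_in X1 X0 \<longrightarrow>
        dense_in X1 (F X0 X1))"

definition interp_space ::
    "(real \<Rightarrow> 'a nspace \<Rightarrow> 'a nspace \<Rightarrow> 'a nspace) \<Rightarrow> 'a nspace \<Rightarrow> 'a nspace \<Rightarrow> real \<Rightarrow> 'a nspace"
  where
  "interp_space F E0 E1 \<theta> = (if \<theta> = 0 then E0 else if \<theta> = 1 then E1 else F \<theta> E0 E1)"


section \<open>Analytic semigroups\<close>

definition c0_semigroup ::
    "('a::banach \<Rightarrow> 'a) option \<Rightarrow> (real \<Rightarrow> 'a \<Rightarrow> 'a) \<Rightarrow> bool" where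
  "c0_semigroup J S \<longleftrightarrow>
     (\<forall>t\<ge>0. bounded_linear (S t) \<and> lin_on J UNIV (S t)) \<and>
     (\<forall>x. S 0 x = x) \<and>
     (\<forall>s\<ge>0. \<forall>t\<ge>0. \<forall>x. S (s + t) x = S s (S t x)) \<and>
     (\<forall>x. continuous_on {0..} (\<lambda>t. S t x))"

definition generates ::
    "'a::banach set \<Rightarrow> ('a \<Rightarrow> 'a) \<Rightarrow> (real \<Rightarrow> 'a \<Rightarrow> 'a) \<Rightarrow> bool" where
  \<comment> \<open>\<open>A\<close>, with domain \<open>D\<close>, is the infinitesimal generator of \<open>S\<close>\<close>
  "generates D A S \<longleftrightarrow>
     D = {x. \<exists>y. ((\<lambda>h. (1 / h) *\<^sub>R (S h x - x)) \<longlongrightarrow> y) (at_right 0)} \<and>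
     (\<forall>x\<in>D. ((\<lambda>h. (1 / h) *\<^sub>R (S h x - x)) \<longlongrightarrow> A x) (at_right 0))"

definition sector :: "real \<Rightarrow> complex set" where
  "sector \<delta> = {z. z \<noteq> 0 \<and> \<bar>Arg z\<bar> < \<delta>}"

definition has_sector_extension ::
    "('e::banach \<Rightarrow> 'e) \<Rightarrow> (real \<Rightarrow> 'e \<Rightarrow> 'e) \<Rightarrow> bool" where
  "has_sector_extension i S \<longleftrightarrow>
     (\<exists>\<delta> Z. 0 < \<delta> \<and> \<delta> \<le> pi / 2 \<and>
        (\<forall>t>0. Z (complex_of_real t) = S t) \<and>
        (\<forall>z\<in>sector \<delta>. bounded_linear (Z z) \<and> lin_on (Some i) UNIV (Z z)) \<and>
        (\<forall>z\<in>sector \<delta>. \<forall>w\<in>sector \<delta>. \<forall>x. Z (z + w) x = Z z (Z w x)) \<and>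
        (\<forall>x. \<forall>z\<in>sector \<delta>. \<exists>d. ((\<lambda>z. Z z x) has_derivative (\<lambda>h. cscale i h d)) (at z)) \<and>
        (\<forall>x. ((\<lambda>z. Z z x) \<longlongrightarrow> x) (at 0 within sector \<delta>)))"

text \<open>
  On a real space, analyticity refers to the canonical extension of the semigroup to the
  complexification \<open>E + i E\<close>, realised on \<open>E \<times> E\<close> (whose product norm is equivalent to the
  usual complexified norms).
\<close>

definition analytic_semigroup ::
    "('a::banach \<Rightarrow> 'a) option \<Rightarrow> (real \<Rightarrow> 'a \<Rightarrow> 'a) \<Rightarrow> bool" where
  "analytic_semigroup J S \<longleftrightarrow>
     c0_semigroup J S \<and>
     (case J of
        None \<Rightarrow> has_sector_extension (\<lambda>(x, y). (- y, x)) (\<lambda>t (x, y). (S t x, S t y))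
      | Some i \<Rightarrow> has_sector_extension i S)"

text \<open>\<open>A \<in> H(E1, E0)\<close> with \<open>S t = exp (t A)\<close>; here \<open>E0\<close> is the whole type \<open>'a\<close>.\<close>

definition analytic_generator ::
    "('a::banach \<Rightarrow> 'a) option \<Rightarrow> 'a nspace \<Rightarrow> ('a \<Rightarrow> 'a) \<Rightarrow> (real \<Rightarrow> 'a \<Rightarrow> 'a) \<Rightarrow> bool" where
  "analytic_generator J E1 A S \<longleftrightarrow> analytic_semigroup J S \<and> generates (car E1) A S"


section \<open>Function spaces and solutions\<close>

definition cont_into :: "real set \<Rightarrow> 'a::real_vector nspace \<Rightarrow> (real \<Rightarrow> 'a) \<Rightarrow> bool" where
  "cont_into I X u \<longleftrightarrow>
     (\<forall>t\<in>I. u t \<in> car X \<and> ((\<lambda>s. nrm X (u s - u t)) \<longlongrightarrow> 0) (at t within I))"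

definition Cmu :: "real \<Rightarrow> real \<Rightarrow> 'a::real_vector nspace \<Rightarrow> (real \<Rightarrow> 'a) set" where
  "Cmu \<mu> T X =
     {u. cont_into {0<..T} X u \<and>
         ((\<lambda>t. t powr \<mu> * nrm X (u t)) \<longlongrightarrow> 0) (at 0 within {0<..T})}"

definition Cmu_norm :: "real \<Rightarrow> real \<Rightarrow> 'a nspace \<Rightarrow> (real \<Rightarrow> 'a) \<Rightarrow> real" where
  "Cmu_norm \<mu> T X u = (SUP t\<in>{0<..T}. t powr \<mu> * nrm X (u t))"

definition C1_on :: "real set \<Rightarrow> (real \<Rightarrow> 'a::real_normed_vector) \<Rightarrow> bool" where
  "C1_on I u \<longleftrightarrow>
     (\<exists>u'. continuous_on I u' \<and> (\<forall>t\<in>I. (u has_vector_derivative u' t) (at t within I)))"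

text \<open>
  Strong solutions of \<open>u' = A u + f(u, t)\<close> on \<open>(0, T]\<close> with time-average condition
  \<open>a u(T) + \<integral>\<^sub>0\<^sup>T b(t) u(t) dt = M\<close>.
\<close>

definition strong_solution ::
    "real \<Rightarrow> real \<Rightarrow> (real \<Rightarrow> real) \<Rightarrow> 'a::banach nspace \<Rightarrow> ('a \<Rightarrow> 'a) \<Rightarrow>
     ((real \<Rightarrow> 'a) \<Rightarrow> real \<Rightarrow> 'a) \<Rightarrow> 'a \<Rightarrow> (real \<Rightarrow> 'a) \<Rightarrow> bool" where
  "strong_solution T a b E1 A f M u \<longleftrightarrow>
     C1_on {0<..T} u \<and> cont_into {0<..T} E1 u \<and> continuous_on {0..T} u \<and>
     (\<forall>t\<in>{0<..T}. (u has_vector_derivative (A (u t) + f u t)) (at t within {0<..T})) \<and>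
     a *\<^sub>R u T + integral {0..T} (\<lambda>t. b t *\<^sub>R u t) = M"

text \<open>
  Uniqueness of solutions can only be expected among small ones: for \<open>E0 = E1 = \<real>\<close>, \<open>A = 0\<close>,
  \<open>T = 1\<close>, \<open>a = 1\<close>, \<open>b = - 1 / ln 2\<close>, \<open>M = 0\<close> and \<open>f u t = (min \<bar>u t\<bar> 1)\<^sup>2\<close>, both \<open>u = 0\<close> and
  \<open>u t = 1 / (2 - t)\<close> are strong solutions. The set below is the ball in which
  solutions are compared.
\<close>

definition small_ball ::
    "real \<Rightarrow> real \<Rightarrow> 'a::real_normed_vector nspace \<Rightarrow> real \<Rightarrow> (real \<Rightarrow> 'a) set" where
  "small_ball \<mu> T X r = {u. Cmu_norm \<mu> T X u \<le> r \<and> (\<forall>t\<in>{0..T}. norm (u t) \<le> r)}"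

end

theory Submission
  imports Defs
begin

text \<open>
  The problem is solved in two stages: a linear one, in which the time-average condition is
  turned into an initial condition, and a contraction argument on a small ball.
  
  Let \<open>R\<close> be the resolvent \<open>(\<lambda> - A)\<^sup>-\<^sup>1\<close> for some large \<open>\<lambda>\<close>. It is a bijection from \<open>E0\<close> onto \<open>E1\<close>,
  and by the closed graph theorem the norm of \<open>R y\<close> in \<open>E1\<close> is equivalent to the norm of \<open>y\<close> in
  \<open>E0\<close>. So every statement about \<open>E1\<close> can be made in \<open>E0\<close>, for the preimages under \<open>R\<close>: the
  semigroup factors as \<open>S t = R (D t)\<close> for \<open>t > 0\<close>, and analyticity enters only through the bound
  \<open>\<parallel>D t\<parallel> \<le> C / t\<close> (\<open>analytic_semigroup_derivative\<close>, a Cauchy estimate on discs inside the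
  sector, for a real space after complexification).
  
  Linear stage. A solution of \<open>u' = A u + g\<close> is \<open>u t = S t x\<close> plus the Duhamel integral of \<open>g\<close>.
  Inserting this into the time-average condition gives an equation \<open>\<Phi> x = M - \<dots>\<close> for the initial
  value, where \<open>\<Phi> x = a S(T) x + \<integral> b(t) S(t) x dt\<close>. Integration by parts shows that
  \<open>R\<^sup>-\<^sup>1 \<Phi> = b(0) + K\<close>, and \<open>K\<close> is compact because it is a norm limit of operators that factor
  through the compact embedding \<open>R\<close> (\<open>average_eq\<close>, \<open>remainder_compact\<close>). As \<open>b(0) \<noteq> 0\<close> and \<open>\<Phi>\<close>
  is injective, Riesz theory (\<open>fredholm_injective_imp_surjective\<close>) makes \<open>\<Phi>\<close> an isomorphism of
  \<open>E0\<close> onto \<open>E1\<close>. Hence for all \<open>M\<close> and \<open>g\<close> the linear problem has exactly one solution \<open>sol\<close>, which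
  depends linearly and boundedly on the data.
  
  Nonlinear stage. A forcing \<open>g\<close> of weight \<open>\<nu>\<close> in \<open>E\<^sub>\<gamma>\<close> satisfies
  \<open>\<parallel>D(t - s) g(s)\<parallel> \<le> c (t - s)\<^bsup>\<gamma> - 1\<^esup> s\<^bsup>- \<nu>\<^esup>\<close>, so its Duhamel integral is \<open>O(t\<^bsup>\<gamma> - \<nu>\<^esup>)\<close> in \<open>E1\<close>
  and \<open>O(t\<^bsup>1 - \<nu>\<^esup>)\<close> in \<open>E0\<close>. The inequality
  \<open>\<parallel>x\<parallel>\<^sub>\<theta> \<le> c (t\<^bsup>- \<theta>\<^esup> \<parallel>x\<parallel>\<^sub>0 + t\<^bsup>1 - \<theta>\<^esup> \<parallel>x\<parallel>\<^sub>1)\<close> (\<open>interpolation_inequality\<close>)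
  combines the two bounds to \<open>t\<^bsup>\<theta>\<^esup> \<parallel>\<cdot>\<parallel>\<^sub>\<theta> \<rightarrow> 0\<close>. On a ball of radius \<open>r\<close> the Lipschitz constant of \<open>f\<close> is
  at most \<open>cT (2 r)\<^bsup>l\<^esup>\<close>, so for small \<open>r\<close> the map \<open>v \<mapsto> sol m (f v)\<close> is a contraction of the ball when
  \<open>M = R m\<close> is small. By variation of constants the strong solutions in the ball are exactly its
  fixed points.
\<close>

section \<open>Integrals with endpoint singularities\<close>

text \<open>
  A locally defined antiderivative of \<open>g\<close> inherits the modulus of continuity of \<open>H\<close>. It therefore
  extends continuously to the closed interval, and the fundamental theorem of calculus then makes
  \<open>g\<close> integrable up to the singular endpoints.
\<close>

lemma dominated_integral:
  fixes g :: "real \<Rightarrow> 'a::banach" and h H :: "real \<Rightarrow> real"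
  assumes ab: "a < b" and g: "continuous_on {a<..<b} g"
    and gh: "\<And>s. a < s \<Longrightarrow> s < b \<Longrightarrow> norm (g s) \<le> h s"
    and H: "continuous_on {a..b} H"
    and Hh: "\<And>s. a < s \<Longrightarrow> s < b \<Longrightarrow> (H has_real_derivative h s) (at s)"
  shows "g integrable_on {a..b}" "norm (integral {a..b} g) \<le> H b - H a"
proof -
  define c where "c = (a + b) / 2"
  have c: "a < c" "c < b" using ab by (auto simp: c_def)
  \<comment> \<open>an antiderivative of \<open>g\<close> on the open interval, normalised at the midpoint \<open>c\<close>\<close>
  define G where "G t = (if c \<le> t then integral {c..t} g else - integral {t..c} g)" for t
  have gint: "g integrable_on {s..t}" if "a < s" "t < b" for s t
    by (rule integrable_continuous_interval, rule continuous_on_subset[OF g]) (use that in auto)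
  have Gdiff: "G t - G s = integral {s..t} g" if "a < s" "s \<le> t" "t < b" for s t
  proof -
    have A: "integral {x..y} g + integral {y..z} g = integral {x..z} g" if "a < x" "x \<le> y" "y \<le> z" "z < b" for x y z
      by (rule Henstock_Kurzweil_Integration.integral_combine) (use that gint in auto)
    show ?thesis
      using that c A[of s c t] A[of c s t] A[of s t c] unfolding G_def
      by (cases "c \<le> s"; cases "c \<le> t") (auto simp: algebra_simps)
  qed
  have hint: "(h has_integral H t - H s) {s..t}" if "a < s" "s \<le> t" "t < b" for s t
  proof (rule fundamental_theorem_of_calculus)
    show "(H has_vector_derivative h x) (at x within {s..t})" if "x \<in> {s..t}" for x
    proof -
      have "a < x" "x < b" using that \<open>a < s\<close> \<open>t < b\<close> by auto
      from Hh[OF this] show ?thesis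
        by (rule has_vector_derivative_at_within[OF has_real_derivative_iff_has_vector_derivative[THEN iffD1]])
    qed
  qed (use that in auto)
  have Gn: "norm (G t - G s) \<le> H t - H s" if "a < s" "s \<le> t" "t < b" for s t
  proof -
    have "norm (integral {s..t} g) \<le> integral {s..t} h"
      using that hint[OF that] gint gh
      by (intro Henstock_Kurzweil_Integration.integral_norm_bound_integral) auto
    then show ?thesis using Gdiff[OF that] hint[OF that] by (simp add: integral_unique)
  qed
  have Gn': "dist (G s) (G t) \<le> dist (H s) (H t)" if "a < s" "s < b" "a < t" "t < b" for s t
    using Gn[of s t] Gn[of t s] that by (cases "s \<le> t") (auto simp: dist_norm norm_minus_commute)
  have uH: "uniformly_continuous_on {a..b} H"
    by (rule compact_uniformly_continuous[OF H]) simp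
  have "uniformly_continuous_on {a<..<b} G"
    unfolding uniformly_continuous_on_def
  proof (intro allI impI)
    fix e :: real assume "e > 0"
    then obtain d where "d > 0" "\<And>x y. x \<in> {a..b} \<Longrightarrow> y \<in> {a..b} \<Longrightarrow> dist y x < d \<Longrightarrow> dist (H y) (H x) < e"
      using uH unfolding uniformly_continuous_on_def by metis
    then show "\<exists>d>0. \<forall>x\<in>{a<..<b}. \<forall>x'\<in>{a<..<b}. dist x' x < d \<longrightarrow> dist (G x') (G x) < e"
      by (intro exI[of _ d]) (auto intro: le_less_trans[OF Gn'])
  qed
  then obtain G' where G': "uniformly_continuous_on (closure {a<..<b}) G'" "\<And>x. x \<in> {a<..<b} \<Longrightarrow> G x = G' x"
    using uniformly_continuous_on_extension_on_closure by metis
  have cG': "continuous_on {a..b} G'"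
    using uniformly_continuous_imp_continuous[OF G'(1)] ab by simp
  have dG': "(G' has_vector_derivative g x) (at x)" if x: "x \<in> {a<..<b}" for x
  proof -
    obtain p q where pq: "a < p" "p < x" "x < q" "q < b" using x dense by (metis greaterThanLessThan_iff)
    have "((\<lambda>u. integral {p..u} g) has_vector_derivative g x) (at x within {p..q})"
      by (rule integral_has_vector_derivative, rule continuous_on_subset[OF g]) (use pq in auto)
    then have "((\<lambda>u. G p + integral {p..u} g) has_vector_derivative g x) (at x within {p..q})"
      by (auto intro!: derivative_eq_intros)
    then have "((\<lambda>u. G p + integral {p..u} g) has_vector_derivative g x) (at x within {p<..<q})"
      by (rule has_vector_derivative_within_subset) auto
    then have "(G' has_vector_derivative g x) (at x within {p<..<q})"
    proof (rule has_vector_derivative_transform[rotated 2])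
      show "x \<in> {p<..<q}" using pq by auto
      fix u assume "u \<in> {p<..<q}"
      then show "G' u = G p + integral {p..u} g"
        using Gdiff[of p u] G'(2)[of u] pq by (auto simp: algebra_simps)
    qed
    then show ?thesis using pq at_within_open[of x "{p<..<q}"] by simp
  qed
  have "(g has_integral G' b - G' a) {a..b}"
    by (rule fundamental_theorem_of_calculus_interior) (use ab cG' dG' in auto)
  then show gi: "g integrable_on {a..b}" by blast
  have hi: "(h has_integral H b - H a) {a..b}"
    by (rule fundamental_theorem_of_calculus_interior)
      (use ab H Hh in \<open>auto intro: has_real_derivative_iff_has_vector_derivative[THEN iffD1]\<close>)
  have "norm (integral {a<..<b} g) \<le> integral {a<..<b} h"
    using gi hi gh by (intro Henstock_Kurzweil_Integration.integral_norm_bound_integral)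
      (auto simp: integrable_on_open_interval_real)
  then show "norm (integral {a..b} g) \<le> H b - H a"
    using integral_unique[OF hi] by (simp add: integral_open_interval_real)
qed

lemma power_reflected_derivative:
  fixes t s r :: real
  assumes "s < t"
  shows "((\<lambda>s. (t - s) powr r) has_real_derivative - (r * (t - s) powr (r - 1))) (at s)"
proof -
  have "((\<lambda>s. t - s) has_real_derivative - 1) (at s)"
    by (auto intro!: derivative_eq_intros)
  from DERIV_chain2[OF has_real_derivative_powr[of "t - s" r] this] assms show ?thesis
    by simp
qed

text \<open>
  At every point at least one of the two factors is no larger than its value at \<open>m\<close>. With
  \<open>x = t - s\<close>, \<open>y = s\<close> and \<open>m = t / 2\<close> this separates the two singularities of a Beta integrand.
\<close>

lemma singular_product_split:
  fixes x y m :: real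
  assumes "0 < m" "0 < x" "0 < y" "m \<le> x \<or> m \<le> y" "p \<le> 0" "q \<le> 0"
  shows "x powr p * y powr q \<le> m powr p * y powr q + m powr q * x powr p"
proof (cases "m \<le> x")
  case True
  then have "x powr p \<le> m powr p" using assms by (intro powr_mono2') auto
  then show ?thesis by (simp add: add_increasing2 mult_right_mono)
next
  case False
  then have "y powr q \<le> m powr q" using assms by (intro powr_mono2') auto
  then have "x powr p * y powr q \<le> m powr q * x powr p"
    by (subst mult.commute) (rule mult_right_mono, auto)
  then show ?thesis by (simp add: add_increasing)
qed

lemma weakly_singular_integral:
  fixes g :: "real \<Rightarrow> 'a::banach"
  assumes t: "0 < t" and g: "continuous_on {0<..<t} g"
    and p: "0 < p" "p \<le> 1" "0 \<le> \<nu>" "\<nu> < 1" and q: "0 \<le> q"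
    and bd: "\<And>s. 0 < s \<Longrightarrow> s < t \<Longrightarrow> norm (g s) \<le> q * ((t - s) powr (p - 1) * s powr (- \<nu>))"
  shows "g integrable_on {0..t}"
    "norm (integral {0..t} g) \<le> q * ((2 / (1 - \<nu>) + 2 / p) * t powr (p - \<nu>))"
proof -
  define h where "h s = q * ((t/2) powr (p - 1) * s powr (-\<nu>) + (t/2) powr (-\<nu>) * (t - s) powr (p - 1))" for s
  define H where "H s = q * ((t/2) powr (p - 1) * (s powr (1 - \<nu>) / (1 - \<nu>)) - (t/2) powr (-\<nu>) * ((t - s) powr p / p))" for s
  have 1: "norm (g s) \<le> h s" if "0 < s" "s < t" for s
  proof -
    have "(t - s) powr (p - 1) * s powr (- \<nu>) \<le> (t/2) powr (p - 1) * s powr (-\<nu>) + (t/2) powr (-\<nu>) * (t - s) powr (p - 1)"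
      by (rule singular_product_split) (use that p in auto)
    from order_trans[OF bd[OF that] mult_left_mono[OF this q]] show ?thesis unfolding h_def .
  qed
  have 2: "continuous_on {0..t} H"
    unfolding H_def using p by (intro continuous_on_mult_left continuous_on_diff continuous_on_divide continuous_on_powr' continuous_on_id continuous_on_const) auto
  have 3: "(H has_real_derivative h s) (at s)" if "0 < s" "s < t" for s
  proof -
    have "((\<lambda>s. s powr (1 - \<nu>) / (1 - \<nu>)) has_real_derivative s powr (-\<nu>)) (at s)"
      using DERIV_cdivide[OF has_real_derivative_powr[of s "1 - \<nu>"], of "1 - \<nu>"] that p by simp
    moreover have "((\<lambda>s. (t - s) powr p / p) has_real_derivative - ((t - s) powr (p - 1))) (at s)"
      using DERIV_cdivide[OF power_reflected_derivative[of s t p], of p] that p by simp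
    ultimately show ?thesis unfolding H_def h_def
      by (rule DERIV_cong[OF DERIV_cmult[OF DERIV_diff[OF DERIV_cmult DERIV_cmult]]]) simp
  qed
  note D = dominated_integral[OF t g 1 2 3]
  show "g integrable_on {0..t}" by (rule D)
  have "H t - H 0 = q * ((t/2) powr (p - 1) * t powr (1 - \<nu>) / (1 - \<nu>) + (t/2) powr (-\<nu>) * t powr p / p)"
    unfolding H_def using p by (simp add: algebra_simps)
  also have "(t/2) powr (p - 1) * t powr (1 - \<nu>) = 2 powr (1 - p) * t powr (p - \<nu>)"
    using powr_minus_divide[of 2 "p - 1"] powr_add[of t "p - 1" "1 - \<nu>"] t by (simp add: powr_divide)
  also have "(t/2) powr (-\<nu>) * t powr p = 2 powr \<nu> * t powr (p - \<nu>)"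
    using powr_minus_divide[of 2 "- \<nu>"] powr_add[of t "- \<nu>" p] t by (simp add: powr_divide)
  also have "q * (2 powr (1 - p) * t powr (p - \<nu>) / (1 - \<nu>) + 2 powr \<nu> * t powr (p - \<nu>) / p)
      \<le> q * (2 * t powr (p - \<nu>) / (1 - \<nu>) + 2 * t powr (p - \<nu>) / p)"
  proof -
    have "2 powr (1 - p) \<le> (2::real) powr 1" "2 powr \<nu> \<le> (2::real) powr 1"
      using p by (intro powr_mono; simp)+
    then show ?thesis using p q
      by (intro mult_left_mono add_mono divide_right_mono mult_right_mono) auto
  qed
  finally show "norm (integral {0..t} g) \<le> q * ((2 / (1 - \<nu>) + 2 / p) * t powr (p - \<nu>))"
    using D(2) by (simp add: algebra_simps)
qed

lemma power_singular_integral_tail: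
  fixes g :: "real \<Rightarrow> 'a::banach"
  assumes r: "r < t" and g: "continuous_on {r<..<t} g" and p: "0 < p"
    and bd: "\<And>s. r < s \<Longrightarrow> s < t \<Longrightarrow> norm (g s) \<le> q * (t - s) powr (p - 1)"
  shows "norm (integral {r..t} g) \<le> q * ((t - r) powr p / p)"
proof -
  define H where "H s = - q * ((t - s) powr p / p)" for s
  have "continuous_on {r..t} H"
    unfolding H_def using p r by (intro continuous_on_mult_left continuous_on_diff continuous_on_divide continuous_on_powr' continuous_on_id continuous_on_const) auto
  moreover have "(H has_real_derivative q * (t - s) powr (p - 1)) (at s)" if "r < s" "s < t" for s
    unfolding H_def using DERIV_cmult[OF DERIV_cdivide[OF power_reflected_derivative[of s t p], of p], of "- q"] that p
    by simp
  ultimately have "norm (integral {r..t} g) \<le> H t - H r"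
    using dominated_integral(2)[OF r g bd] by blast
  then show ?thesis using p by (simp add: H_def)
qed

section \<open>Baire category in Banach spaces carried by a subspace\<close>

lemma banach_on_normed_on: "banach_on J X \<Longrightarrow> normed_on J X"
  by (simp add: banach_on_def)

lemma
  assumes "normed_on J X"
  shows normed_on_zero: "0 \<in> car X"
    and normed_on_add: "x \<in> car X \<Longrightarrow> y \<in> car X \<Longrightarrow> x + y \<in> car X"
    and normed_on_diff: "x \<in> car X \<Longrightarrow> y \<in> car X \<Longrightarrow> x - y \<in> car X"
    and normed_on_scale: "x \<in> car X \<Longrightarrow> c *\<^sub>R x \<in> car X"
    and normed_on_sum: "(\<And>k. k \<in> K \<Longrightarrow> s k \<in> car X) \<Longrightarrow> sum s K \<in> car X"
    and nrm_nonneg: "x \<in> car X \<Longrightarrow> 0 \<le> nrm X x"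
    and nrm_eq_0: "x \<in> car X \<Longrightarrow> nrm X x = 0 \<longleftrightarrow> x = 0"
    and nrm_zero: "nrm X 0 = 0"
    and nrm_triangle: "x \<in> car X \<Longrightarrow> y \<in> car X \<Longrightarrow> nrm X (x + y) \<le> nrm X x + nrm X y"
    and nrm_scale: "x \<in> car X \<Longrightarrow> nrm X (c *\<^sub>R x) = \<bar>c\<bar> * nrm X x"
    and nrm_minus_commute: "x \<in> car X \<Longrightarrow> y \<in> car X \<Longrightarrow> nrm X (x - y) = nrm X (y - x)"
    and nrm_triangle_diff: "x \<in> car X \<Longrightarrow> y \<in> car X \<Longrightarrow> nrm X (x - y) \<le> nrm X x + nrm X y"
    and nrm_triangle_dist: "x \<in> car X \<Longrightarrow> y \<in> car X \<Longrightarrow> z \<in> car X \<Longrightarrow> nrm X (x - z) \<le> nrm X (x - y) + nrm X (y - z)"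
proof -
  have sub: "subspace (car X)" using assms by (simp add: normed_on_def)
  show "0 \<in> car X" by (rule subspace_0[OF sub])
  show 1: "x \<in> car X \<Longrightarrow> y \<in> car X \<Longrightarrow> x + y \<in> car X" for x y by (rule subspace_add[OF sub])
  show 2: "x \<in> car X \<Longrightarrow> y \<in> car X \<Longrightarrow> x - y \<in> car X" for x y by (rule subspace_diff[OF sub])
  show 3: "x \<in> car X \<Longrightarrow> c *\<^sub>R x \<in> car X" for x c by (rule subspace_scale[OF sub])
  show "(\<And>k. k \<in> K \<Longrightarrow> s k \<in> car X) \<Longrightarrow> sum s K \<in> car X" for s :: "'b \<Rightarrow> 'a" and K
    by (rule subspace_sum[OF sub])
  show "x \<in> car X \<Longrightarrow> 0 \<le> nrm X x" for x using assms by (simp add: normed_on_def)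
  show z: "x \<in> car X \<Longrightarrow> nrm X x = 0 \<longleftrightarrow> x = 0" for x using assms by (simp add: normed_on_def)
  show "nrm X 0 = 0" using z[OF subspace_0[OF sub]] by simp
  show 4: "x \<in> car X \<Longrightarrow> y \<in> car X \<Longrightarrow> nrm X (x + y) \<le> nrm X x + nrm X y" for x y
    using assms by (simp add: normed_on_def)
  show 5: "x \<in> car X \<Longrightarrow> nrm X (c *\<^sub>R x) = \<bar>c\<bar> * nrm X x" for x c
    using assms by (simp add: normed_on_def)
  show 6: "nrm X (x - y) = nrm X (y - x)" if "x \<in> car X" "y \<in> car X" for x y
    using 5[OF 2[OF that], of "-1"] by simp
  show "nrm X (x - y) \<le> nrm X x + nrm X y" if "x \<in> car X" "y \<in> car X" for x y
    using 4[OF that(1) 3[OF that(2), of "-1"]] 5[OF that(2), of "-1"] by simp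
  show "nrm X (x - z) \<le> nrm X (x - y) + nrm X (y - z)" if "x \<in> car X" "y \<in> car X" "z \<in> car X" for x y z
    using 4[OF 2[OF that(1,2)] 2[OF that(2,3)]] by simp
qed

lemma banach_on_complete:
  assumes "banach_on J X" "\<And>k::nat. s k \<in> car X"
    and "\<And>e. 0 < e \<Longrightarrow> \<exists>N. \<forall>m\<ge>N. \<forall>n\<ge>N. nrm X (s m - s n) < e"
  obtains x where "x \<in> car X" "(\<lambda>k. nrm X (s k - x)) \<longlonglongrightarrow> 0"
proof -
  have "(\<forall>k. s k \<in> car X) \<longrightarrow> (\<forall>e>0. \<exists>N. \<forall>m\<ge>N. \<forall>n\<ge>N. nrm X (s m - s n) < e) \<longrightarrow>
        (\<exists>x\<in>car X. (\<lambda>k. nrm X (s k - x)) \<longlonglongrightarrow> 0)"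
    using assms(1) unfolding banach_on_def by (elim conjE) (erule allE)
  then show thesis using assms(2,3) that by blast
qed

lemma tendsto_0_bound:
  fixes f g :: "nat \<Rightarrow> real"
  assumes "\<And>k. 0 \<le> f k" "\<And>k. f k \<le> g k" "g \<longlonglongrightarrow> 0"
  shows "f \<longlonglongrightarrow> 0"
  by (rule tendsto_sandwich[OF _ _ tendsto_const assms(3)]) (use assms(1,2) in auto)

text \<open>
  The form of completeness used for all successive approximations below; the explicit rate replaces
  an argument with Cauchy sequences at each use.
\<close>

lemma banach_on_geometric_limit:
  assumes X: "banach_on J X" and a: "\<And>k. a k \<in> car X"
    and step: "\<And>k. nrm X (a (Suc k) - a k) \<le> c / 2 ^ k"
  shows "\<exists>x\<in>car X. \<forall>k. nrm X (a k - x) \<le> 2 * c / 2 ^ k"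
proof -
  note N = banach_on_normed_on[OF X]
  have c0: "0 \<le> c" using step[of 0] nrm_nonneg[OF N normed_on_diff[OF N a a], of "Suc 0" 0] by simp
  have tail: "nrm X (a (k + j) - a k) \<le> 2 * c / 2 ^ k - 2 * c / 2 ^ (k + j)" for k j
  proof (induction j)
    case 0
    then show ?case using nrm_zero[OF N] by simp
  next
    case (Suc j)
    have "nrm X (a (k + Suc j) - a k) \<le> nrm X (a (Suc (k + j)) - a (k + j)) + nrm X (a (k + j) - a k)"
      using nrm_triangle_dist[OF N a a a] by simp
    also have "\<dots> \<le> c / 2 ^ (k + j) + (2 * c / 2 ^ k - 2 * c / 2 ^ (k + j))"
      by (intro add_mono step Suc)
    also have "\<dots> = 2 * c / 2 ^ k - 2 * c / 2 ^ (k + Suc j)" by simp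
    finally show ?case .
  qed
  have tail': "nrm X (a (k + j) - a k) \<le> 2 * c / 2 ^ k" for k j
    by (rule order_trans[OF tail]) (use c0 in simp)
  have lim0: "(\<lambda>k. 2 * C / 2 ^ k) \<longlonglongrightarrow> (0::real)" for C
    using tendsto_mult_right_zero[OF LIMSEQ_realpow_zero[of "1/2::real"], of "2 * C"]
    by (simp add: power_divide)
  have "\<exists>N. \<forall>m\<ge>N. \<forall>n\<ge>N. nrm X (a m - a n) < e" if "e > 0" for e :: real
  proof -
    obtain n0 where n0: "2 * (2 * c) / 2 ^ n0 < e"
      using order_tendstoD(2)[OF lim0[of "2*c"] \<open>e > 0\<close>] unfolding eventually_sequentially by auto
    have "nrm X (a m - a n) < e" if "m \<ge> n0" "n \<ge> n0" for m n
    proof -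
      have "nrm X (a m - a n) \<le> nrm X (a m - a n0) + nrm X (a n0 - a n)"
        by (rule nrm_triangle_dist[OF N a a a])
      also have "\<dots> \<le> 2 * c / 2 ^ n0 + 2 * c / 2 ^ n0"
        using tail'[of n0 "m - n0"] tail'[of n0 "n - n0"] that nrm_minus_commute[OF N a a, of n0 n]
        by (intro add_mono) auto
      finally show ?thesis using n0 by simp
    qed
    then show ?thesis by blast
  qed
  from banach_on_complete[of J X a, OF X a this]
  obtain x where x: "x \<in> car X" "(\<lambda>k. nrm X (a k - x)) \<longlonglongrightarrow> 0"
    by blast
  have "nrm X (a k - x) \<le> 2 * c / 2 ^ k" for k
  proof (rule tendsto_lowerbound)
    show "(\<lambda>j. 2 * c / 2 ^ k + nrm X (a (k + j) - x)) \<longlonglongrightarrow> 2 * c / 2 ^ k"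
      using tendsto_add[OF tendsto_const LIMSEQ_ignore_initial_segment[OF x(2), of k], of "2 * c / 2 ^ k"]
      by (simp add: add.commute)
    have "nrm X (a k - x) \<le> 2 * c / 2 ^ k + nrm X (a (k + j) - x)" for j
      using nrm_triangle_dist[OF N a[of k] a[of "k + j"] x(1)] nrm_minus_commute[OF N a a, of k "k + j"] tail'[of k j]
      by linarith
    then show "\<forall>\<^sub>F j in sequentially. nrm X (a k - x) \<le> 2 * c / 2 ^ k + nrm X (a (k + j) - x)"
      by simp
  qed simp
  with x(1) show ?thesis by blast
qed

lemma nspace_baire:
  assumes X: "banach_on J X" and A: "\<And>n. A n \<subseteq> car X" "car X \<subseteq> (\<Union>n::nat. A n)"
  obtains n x0 r where "x0 \<in> car X" "0 < r"
    "\<And>x e. x \<in> car X \<Longrightarrow> nrm X (x - x0) < r \<Longrightarrow> 0 < e \<Longrightarrow> \<exists>y\<in>A n. nrm X (x - y) < e"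
proof -
  note N = banach_on_normed_on[OF X]
  \<comment> \<open>a metric space needs a distance that is symmetric and nonnegative off the carrier as well\<close>
  define d where "d x y = (if x \<in> car X \<and> y \<in> car X then nrm X (x - y) else 0)" for x y
  interpret M: Metric_space "car X" d
  proof
    fix x y
    show "0 \<le> d x y" unfolding d_def by (simp add: nrm_nonneg[OF N normed_on_diff[OF N]])
    show "d x y = d y x"
    proof (cases "x \<in> car X \<and> y \<in> car X")
      case True
      then show ?thesis using nrm_minus_commute[OF N, of x y] by (simp add: d_def)
    qed (auto simp: d_def)
    show "d x y = 0 \<longleftrightarrow> x = y" if "x \<in> car X" "y \<in> car X"
      using nrm_eq_0[OF N normed_on_diff[OF N that]] that by (simp add: d_def)
    show "d x z \<le> d x y + d y z" if "x \<in> car X" "y \<in> car X" "z \<in> car X" for z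
      using nrm_triangle_dist[OF N that] that by (simp add: d_def)
  qed
  have mc: "M.mcomplete"
    unfolding M.mcomplete_def
  proof (intro allI impI)
    fix s assume "M.MCauchy s"
    then have s: "\<And>k. s k \<in> car X" and "\<And>e. e > 0 \<Longrightarrow> \<exists>N. \<forall>m\<ge>N. \<forall>n\<ge>N. nrm X (s m - s n) < e"
      unfolding M.MCauchy_def d_def by (auto simp: image_subset_iff)
    from banach_on_complete[of J X s, OF X this]
    obtain x where x: "x \<in> car X" "(\<lambda>k. nrm X (s k - x)) \<longlonglongrightarrow> 0"
      by blast
    have "\<exists>N. \<forall>n\<ge>N. s n \<in> car X \<and> d (s n) x < e" if "e > 0" for e
      using order_tendstoD(2)[OF x(2) that] s x(1) by (auto simp: eventually_sequentially d_def)
    then show "\<exists>x. limitin M.mtopology s x sequentially"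
      using x(1) by (auto simp: M.limit_metric_sequentially)
  qed
  define G where "G = range (\<lambda>n. M.mtopology closure_of A n)"
  have "\<exists>n. M.mtopology interior_of (M.mtopology closure_of A n) \<noteq> {}"
  proof (rule ccontr)
    assume "\<not> ?thesis"
    then have "M.mtopology interior_of \<Union>G = {}"
      by (intro M.metric_Baire_category_alt mc) (auto simp: G_def)
    moreover have "\<Union>G = car X"
    proof
      show "\<Union>G \<subseteq> car X"
        unfolding G_def using closure_of_subset_topspace[of M.mtopology] M.topspace_mtopology by fastforce
      show "car X \<subseteq> \<Union>G"
      proof
        fix x assume "x \<in> car X"
        then obtain n where "x \<in> A n" using A(2) by blast
        then have "x \<in> M.mtopology closure_of A n"
          using closure_of_subset[of "A n" M.mtopology] A(1)[of n] M.topspace_mtopology by blast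
        then show "x \<in> \<Union>G" unfolding G_def by blast
      qed
    qed
    ultimately have "car X = {}" using interior_of_topspace[of M.mtopology] by simp
    then show False using normed_on_zero[OF N] by simp
  qed
  then obtain n x0 where "x0 \<in> M.mtopology interior_of (M.mtopology closure_of A n)" by blast
  then obtain r where x0: "x0 \<in> car X" and r: "r > 0" "M.mball x0 r \<subseteq> M.mtopology closure_of A n"
    using openin_interior_of[of M.mtopology "M.mtopology closure_of A n"] interior_of_subset[of "M.mtopology" "M.mtopology closure_of A n"]
    unfolding M.openin_mtopology by blast
  show thesis
  proof (rule that[OF x0 r(1)])
    fix x e :: real and y
    fix x :: 'a assume x: "x \<in> car X" "nrm X (x - x0) < r" and e: "0 < e"
    then have "x \<in> M.mball x0 r" using x0 nrm_minus_commute[OF N x0 x(1)] by (simp add: M.in_mball d_def)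
    with r(2) have "x \<in> M.mtopology closure_of A n" by blast
    then obtain y where "y \<in> A n" "y \<in> M.mball x e"
      using e by (auto simp: M.metric_closure_of)
    then show "\<exists>y\<in>A n. nrm X (x - y) < e"
      by (intro bexI[of _ y]) (auto simp: M.in_mball d_def)
  qed
qed

text \<open>
  Zabreiko's lemma. By Baire, a sublevel set of \<open>p\<close> is dense in some ball, hence by symmetry and
  convexity in a ball around \<open>0\<close>. Every small \<open>x\<close> is then a series of terms whose \<open>p\<close>-values
  decay geometrically, and countable subadditivity bounds \<open>p x\<close>. Asking for subadditivity along
  geometrically bounded series is enough for this. The closed graph theorem and the uniform
  boundedness principle are the two instances needed.
\<close>

lemma zabreiko:
  fixes p :: "'a::real_vector \<Rightarrow> real"
  assumes X: "banach_on J X"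
    and p0: "\<And>x. x \<in> car X \<Longrightarrow> 0 \<le> p x"
    and padd: "\<And>x y. x \<in> car X \<Longrightarrow> y \<in> car X \<Longrightarrow> p (x + y) \<le> p x + p y"
    and pscale: "\<And>c x. x \<in> car X \<Longrightarrow> p (c *\<^sub>R x) = \<bar>c\<bar> * p x"
    and csub: "\<And>s x c. (\<And>k. s k \<in> car X) \<Longrightarrow> x \<in> car X \<Longrightarrow>
       (\<lambda>m. nrm X ((\<Sum>k<m. s k) - x)) \<longlonglongrightarrow> 0 \<Longrightarrow> (\<And>k. p (s k) \<le> c / 2 ^ k) \<Longrightarrow> p x \<le> 2 * c"
  shows "\<exists>C\<ge>0. \<forall>x\<in>car X. p x \<le> C * nrm X x"
proof -
  note N = banach_on_normed_on[OF X]
  define A where "A n = {x \<in> car X. p x \<le> real n}" for n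
  obtain n x0 r where x0: "x0 \<in> car X" "0 < r"
    and dense: "\<And>x e. x \<in> car X \<Longrightarrow> nrm X (x - x0) < r \<Longrightarrow> 0 < e \<Longrightarrow> \<exists>y\<in>A n. nrm X (x - y) < e"
  proof (rule nspace_baire[OF X, of A])
    show "A n \<subseteq> car X" for n by (auto simp: A_def)
    show "car X \<subseteq> (\<Union>n. A n)" using real_arch_simple by (auto simp: A_def)
  qed blast
  have approx0: "\<exists>a\<in>car X. p a \<le> n \<and> nrm X (x - a) < e" if x: "x \<in> car X" "nrm X x < r" and e: "0 < e" for x e
  proof -
    \<comment> \<open>half the difference of approximations of \<open>x0 + x\<close> and \<open>x0 - x\<close> approximates \<open>x\<close>\<close>
    have m: "x0 + x \<in> car X" "x0 - x \<in> car X" using x0 x normed_on_add[OF N] normed_on_diff[OF N] by auto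
    obtain y where y: "y \<in> A n" "nrm X (x0 + x - y) < e" using dense[OF m(1) _ e] x by auto
    obtain z where z: "z \<in> A n" "nrm X (x0 - x - z) < e"
      using dense[OF m(2) _ e] x nrm_minus_commute[OF N m(2) x0(1)] by auto
    have yz: "y \<in> car X" "p y \<le> n" "z \<in> car X" "p z \<le> n" using y z by (auto simp: A_def)
    define a where "a = (1/2) *\<^sub>R (y - z)"
    have "p (y - z) \<le> p y + p z"
      using padd[OF yz(1) normed_on_scale[OF N yz(3), of "-1"]] pscale[OF yz(3), of "-1"] by simp
    then have "p a \<le> n" using pscale[OF normed_on_diff[OF N yz(1,3)], of "1/2"] yz by (simp add: a_def)
    moreover have "x - a = (1/2) *\<^sub>R ((x0 + x - y) - (x0 - x - z))"
      by (simp add: a_def algebra_simps flip: scaleR_add_left)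
    then have "nrm X (x - a) = 1/2 * nrm X ((x0 + x - y) - (x0 - x - z))"
      using nrm_scale[OF N normed_on_diff[OF N normed_on_diff[OF N m(1) yz(1)] normed_on_diff[OF N m(2) yz(3)]], of "1/2"]
      by simp
    then have "nrm X (x - a) < e"
      using nrm_triangle_diff[OF N normed_on_diff[OF N m(1) yz(1)] normed_on_diff[OF N m(2) yz(3)]] y z by linarith
    moreover have "a \<in> car X" unfolding a_def by (intro normed_on_scale[OF N] normed_on_diff[OF N] yz)
    ultimately show ?thesis by blast
  qed
  have approx: "\<exists>a. a \<in> car X \<and> p a \<le> n / 2 ^ k \<and> nrm X (x - a) < r / 2 ^ Suc k"
    if x: "x \<in> car X" "nrm X x < r / 2 ^ k" for x k
  proof -
    have "nrm X (2 ^ k *\<^sub>R x) < r" using nrm_scale[OF N x(1), of "2 ^ k"] x(2) by (simp add: field_simps)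
    then obtain a where a: "a \<in> car X" "p a \<le> n" "nrm X (2 ^ k *\<^sub>R x - a) < r / 2"
      using approx0[OF normed_on_scale[OF N x(1)], of "2^k" "r/2"] x0 by auto
    have e: "x - (1 / 2 ^ k) *\<^sub>R a = (1 / 2 ^ k) *\<^sub>R (2 ^ k *\<^sub>R x - a)"
      by (simp add: scaleR_diff_right)
    show ?thesis
    proof (intro exI[of _ "(1 / 2 ^ k) *\<^sub>R a"] conjI)
      show "p ((1 / 2 ^ k) *\<^sub>R a) \<le> n / 2 ^ k" using pscale[OF a(1), of "1 / 2 ^ k"] a(2) by (simp add: divide_right_mono)
      show "nrm X (x - (1 / 2 ^ k) *\<^sub>R a) < r / 2 ^ Suc k"
        unfolding e nrm_scale[OF N normed_on_diff[OF N normed_on_scale[OF N x(1)] a(1)]] using a(3)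
        by (simp add: field_simps)
    qed (rule normed_on_scale[OF N a(1)])
  qed
  have small: "p x \<le> 2 * real n" if x: "x \<in> car X" "nrm X x < r" for x
  proof -
    obtain pick where pick: "\<And>k y. y \<in> car X \<Longrightarrow> nrm X y < r / 2 ^ k \<Longrightarrow>
        pick k y \<in> car X \<and> p (pick k y) \<le> n / 2 ^ k \<and> nrm X (y - pick k y) < r / 2 ^ Suc k"
    proof -
      have "\<forall>k y. \<exists>a. y \<in> car X \<longrightarrow> nrm X y < r / 2 ^ k \<longrightarrow>
          a \<in> car X \<and> p a \<le> n / 2 ^ k \<and> nrm X (y - a) < r / 2 ^ Suc k"
        using approx by blast
      then show thesis using that unfolding choice_iff by blast
    qed
    \<comment> \<open>\<open>y k\<close> is what remains of \<open>x\<close> after \<open>k\<close> approximation steps\<close>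
    define y where "y = rec_nat x (\<lambda>k z. z - pick k z)"
    have y0: "y 0 = x" and ySuc: "y (Suc k) = y k - pick k (y k)" for k by (simp_all add: y_def)
    have y: "y k \<in> car X \<and> nrm X (y k) < r / 2 ^ k" for k
    proof (induction k)
      case 0 then show ?case using x y0 by simp
    next
      case (Suc k)
      then show ?case unfolding ySuc using pick[of "y k" k] normed_on_diff[OF N, of "y k"] by blast
    qed
    have sum: "(\<Sum>k<m. pick k (y k)) = x - y m" for m
      by (induction m) (auto simp: y0 ySuc)
    show ?thesis
    proof (rule csub)
      show "pick k (y k) \<in> car X" "p (pick k (y k)) \<le> n / 2 ^ k" for k using pick y by blast+
      have lim: "(\<lambda>m. r / 2 ^ m) \<longlonglongrightarrow> 0"
        using tendsto_mult_right_zero[OF LIMSEQ_realpow_zero[of "1/2::real"], of r] by (simp add: power_divide)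
      have e: "nrm X ((\<Sum>k<m. pick k (y k)) - x) = nrm X (y m)" for m
        using nrm_scale[OF N, of "y m" "-1"] y[of m] unfolding sum by simp
      show "(\<lambda>m. nrm X ((\<Sum>k<m. pick k (y k)) - x)) \<longlonglongrightarrow> 0"
        unfolding e by (rule tendsto_0_bound[OF _ _ lim]) (use nrm_nonneg[OF N] y less_imp_le in blast)+
    qed (use x in auto)
  qed
  have "p x \<le> (4 * real n / r) * nrm X x" if x: "x \<in> car X" for x
  proof (cases "x = 0")
    case True
    then show ?thesis using pscale[OF x, of 0] nrm_zero[OF N] by simp
  next
    case False
    then have nx: "nrm X x > 0" using nrm_nonneg[OF N x] nrm_eq_0[OF N x] by linarith
    define c where "c = r / (2 * nrm X x)"
    have c: "c > 0" using x0 nx by (simp add: c_def)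
    have "nrm X (c *\<^sub>R x) < r" using nrm_scale[OF N x, of c] c nx x0 by (simp add: c_def)
    from small[OF normed_on_scale[OF N x] this] have "c * p x \<le> 2 * n" using pscale[OF x, of c] c by simp
    then show ?thesis using nx x0 by (simp add: c_def field_simps)
  qed
  moreover have "4 * real n / r \<ge> 0" using x0 by simp
  ultimately show ?thesis by (intro exI[of _ "4 * real n / r"] conjI ballI)
qed

lemma closed_graph:
  fixes X :: "'a::real_vector nspace" and Y :: "'b::real_vector nspace"
  assumes X: "banach_on J X" and Y: "banach_on K Y"
    and L: "\<And>x. x \<in> car X \<Longrightarrow> L x \<in> car Y"
      "\<And>x y. x \<in> car X \<Longrightarrow> y \<in> car X \<Longrightarrow> L (x + y) = L x + L y"
      "\<And>c x. x \<in> car X \<Longrightarrow> L (c *\<^sub>R x) = c *\<^sub>R L x"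
    and closed: "\<And>s x y. (\<And>k. s k \<in> car X) \<Longrightarrow> x \<in> car X \<Longrightarrow> y \<in> car Y \<Longrightarrow>
       (\<lambda>k. nrm X (s k - x)) \<longlonglongrightarrow> 0 \<Longrightarrow> (\<lambda>k. nrm Y (L (s k) - y)) \<longlonglongrightarrow> 0 \<Longrightarrow> y = L x"
  shows "\<exists>C\<ge>0. \<forall>x\<in>car X. nrm Y (L x) \<le> C * nrm X x"
proof (rule zabreiko[OF X])
  note NX = banach_on_normed_on[OF X]
  note NY = banach_on_normed_on[OF Y]
  show "0 \<le> nrm Y (L x)" if "x \<in> car X" for x using nrm_nonneg[OF NY L(1)[OF that]] .
  show "nrm Y (L (x + y)) \<le> nrm Y (L x) + nrm Y (L y)" if "x \<in> car X" "y \<in> car X" for x y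
    using nrm_triangle[OF NY] L that by simp
  show "nrm Y (L (c *\<^sub>R x)) = \<bar>c\<bar> * nrm Y (L x)" if "x \<in> car X" for x c
    using nrm_scale[OF NY] L that by simp
  fix s x c
  assume s: "\<And>k. s k \<in> car X" and x: "x \<in> car X" and lim: "(\<lambda>m. nrm X ((\<Sum>k<m. s k) - x)) \<longlonglongrightarrow> 0"
    and bd: "\<And>k. nrm Y (L (s k)) \<le> c / 2 ^ k"
  define a where "a m = (\<Sum>k<m. s k)" for m
  have a: "a m \<in> car X" for m unfolding a_def by (intro normed_on_sum[OF NX] s)
  have L0: "L 0 = 0" using L(3)[OF normed_on_zero[OF NX], of 0] by simp
  have "nrm Y (L (a (Suc k)) - L (a k)) \<le> c / 2 ^ k" for k
    using L(2)[OF a[of k] s[of k]] bd[of k] by (simp add: a_def)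
  from banach_on_geometric_limit[OF Y L(1)[OF a] this]
  obtain y where y: "y \<in> car Y" "\<And>k. nrm Y (L (a k) - y) \<le> 2 * c / 2 ^ k" by blast
  have "(\<lambda>k. 2 * c / 2 ^ k) \<longlonglongrightarrow> 0"
    using tendsto_mult_right_zero[OF LIMSEQ_realpow_zero[of "1/2::real"], of "2 * c"] by (simp add: power_divide)
  then have "(\<lambda>k. nrm Y (L (a k) - y)) \<longlonglongrightarrow> 0"
    by (rule tendsto_0_bound[rotated 2]) (rule nrm_nonneg[OF NY normed_on_diff[OF NY L(1)[OF a] y(1)]], rule y)
  then have "y = L x" by (rule closed[OF a x y(1) lim[folded a_def]])
  then show "nrm Y (L x) \<le> 2 * c"
    using y(2)[of 0] nrm_scale[OF NY y(1), of "-1"] L0 by (simp add: a_def)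
qed

lemma banach_on_UNIV: "banach_on None (NSpace (UNIV::'e::banach set) norm)"
proof -
  have "\<exists>x. (\<lambda>k. norm (s k - x)) \<longlonglongrightarrow> 0" if "\<forall>e>0. \<exists>N. \<forall>m\<ge>N. \<forall>n\<ge>N. norm (s m - s n) < e" for s :: "nat \<Rightarrow> 'e"
  proof -
    have "Cauchy s" using that unfolding Cauchy_def dist_norm .
    then obtain x where "s \<longlonglongrightarrow> x" using Cauchy_convergent_iff convergent_def by blast
    then have "(\<lambda>k. norm (s k - x)) \<longlonglongrightarrow> 0" by (simp add: LIM_zero tendsto_norm_zero)
    then show ?thesis ..
  qed
  then show ?thesis by (simp add: banach_on_def normed_on_def norm_triangle_ineq subspace_UNIV)
qed

lemma uniform_boundedness:
  fixes T :: "'i \<Rightarrow> 'e::banach \<Rightarrow> 'f::real_normed_vector"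
  assumes lin: "\<And>i. i \<in> I \<Longrightarrow> bounded_linear (T i)"
    and bd: "\<And>x. \<exists>B. \<forall>i\<in>I. norm (T i x) \<le> B"
  shows "\<exists>C\<ge>0. \<forall>i\<in>I. \<forall>x. norm (T i x) \<le> C * norm x"
proof (cases "I = {}")
  case True then show ?thesis by auto
next
  case ne: False
  define p where "p x = (SUP i\<in>I. norm (T i x))" for x
  have bdd: "bdd_above ((\<lambda>i. norm (T i x)) ` I)" for x using bd[of x] by (auto simp: bdd_above_def)
  have le_p: "norm (T i x) \<le> p x" if "i \<in> I" for i x
    unfolding p_def by (rule cSUP_upper[OF that bdd])
  have p_le: "p x \<le> B" if "\<And>i. i \<in> I \<Longrightarrow> norm (T i x) \<le> B" for x B
    unfolding p_def by (rule cSUP_least[OF ne]) (rule that)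
  have scale_le: "p (c *\<^sub>R x) \<le> \<bar>c\<bar> * p x" for c x
    by (rule p_le) (simp add: linear_simps(5)[OF lin] le_p mult_left_mono)
  have "\<exists>C\<ge>0. \<forall>x\<in>car (NSpace UNIV norm). p x \<le> C * nrm (NSpace UNIV norm) x"
  proof (rule zabreiko[OF banach_on_UNIV])
    fix x y :: 'e and c :: real
    show "0 \<le> p x" using ne le_p norm_ge_zero by (meson all_not_in_conv order_trans)
    show "p (x + y) \<le> p x + p y"
      by (rule p_le) (simp add: linear_simps(1)[OF lin], meson add_mono le_p norm_triangle_ineq order_trans)
    show "p (c *\<^sub>R x) = \<bar>c\<bar> * p x"
    proof (cases "c = 0")
      case True
      then show ?thesis using scale_le[of 0 x] \<open>0 \<le> p x\<close> le_p ne norm_ge_zero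
        by (metis abs_zero all_not_in_conv dual_order.antisym mult_zero_left order_trans)
    next
      case False
      have "p x \<le> \<bar>1/c\<bar> * p (c *\<^sub>R x)" using scale_le[of "1/c" "c *\<^sub>R x"] False by simp
      then show ?thesis using scale_le[of c x] False by (simp add: field_simps)
    qed
  next
    fix s and x :: 'e and c
    assume lim: "(\<lambda>m. nrm (NSpace UNIV norm) ((\<Sum>k<m. s k) - x)) \<longlonglongrightarrow> 0" and bd: "\<And>k. p (s k) \<le> c / 2 ^ k"
    from lim have lim': "(\<lambda>m. \<Sum>k<m. s k) \<longlonglongrightarrow> x" by (simp add: LIM_zero_iff tendsto_norm_zero_iff)
    have c0: "0 \<le> c" using bd[of 0] ne le_p[of _ "s 0"] norm_ge_zero by (metis all_not_in_conv div_by_1 order_trans power_0)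
    show "p x \<le> 2 * c"
    proof (rule p_le)
      fix i assume i: "i \<in> I"
      interpret bounded_linear "T i" by (rule lin[OF i])
      have "(\<lambda>m. norm (T i (\<Sum>k<m. s k))) \<longlonglongrightarrow> norm (T i x)"
        by (intro tendsto_norm tendsto lim')
      moreover have "norm (T i (\<Sum>k<m. s k)) \<le> 2 * c - 2 * c / 2 ^ m" for m
      proof (induction m)
        case (Suc m)
        have "norm (T i (\<Sum>k<Suc m. s k)) \<le> norm (T i (\<Sum>k<m. s k)) + norm (T i (s m))"
          by (simp add: add norm_triangle_ineq)
        also have "\<dots> \<le> (2 * c - 2 * c / 2 ^ m) + c / 2 ^ m"
          by (intro add_mono Suc order_trans[OF le_p[OF i] bd])
        finally show ?case by simp
      qed (simp add: zero)
      then have "norm (T i (\<Sum>k<m. s k)) \<le> 2 * c" for m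
        by (rule order_trans) (use c0 in simp)
      ultimately show "norm (T i x) \<le> 2 * c" by (intro LIMSEQ_le_const2) auto
    qed
  qed
  then show ?thesis by (auto intro: order_trans[OF le_p])
qed

section \<open>Injective compact perturbations of the identity\<close>

lemma compact_closure_approximation:
  fixes A :: "'a::banach set"
  assumes "\<And>e. 0 < e \<Longrightarrow> \<exists>B. compact (closure B) \<and> (\<forall>x\<in>A. \<exists>b\<in>B. dist x b < e)"
  shows "compact (closure A)"
  unfolding compact_eq_totally_bounded
proof (intro conjI allI impI)
  show "complete (closure A)" by (simp add: complete_eq_closed)
  fix e :: real assume "e > 0"
  then have e3: "e / 3 > 0" by simp
  obtain B where B: "compact (closure B)" "\<And>x. x \<in> A \<Longrightarrow> \<exists>b\<in>B. dist x b < e / 3"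
    using assms[OF e3] by blast
  obtain k where k: "finite k" "closure B \<subseteq> (\<Union>x\<in>k. ball x (e / 3))"
    using B(1) e3 unfolding compact_eq_totally_bounded by blast
  have "closure A \<subseteq> (\<Union>x\<in>k. ball x e)"
  proof
    fix x assume "x \<in> closure A"
    then obtain a where a: "a \<in> A" "dist a x < e / 3" using closure_approachable e3 by blast
    obtain b where b: "b \<in> B" "dist a b < e / 3" using B(2)[OF a(1)] by blast
    have "b \<in> closure B" using b(1) closure_subset by blast
    then obtain z where "z \<in> k" "b \<in> ball z (e / 3)" using k(2) by blast
    then have z: "z \<in> k" "dist z b < e / 3" by auto
    have "dist z x \<le> dist z b + dist a b + dist a x"
      using dist_triangle[of z x a] dist_triangle[of z a b] by (simp add: dist_commute)
    then show "x \<in> (\<Union>x\<in>k. ball x e)" using a b z by (auto intro!: bexI[of _ z])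
  qed
  with k(1) show "\<exists>k. finite k \<and> closure A \<subseteq> (\<Union>x\<in>k. ball x e)" by blast
qed

lemma riesz_almost_orthogonal:
  fixes Y :: "'a::real_normed_vector set"
  assumes Y: "subspace Y" "closed Y" and X: "subspace X" "Y \<subseteq> X" and x: "x \<in> X" "x \<notin> Y"
  shows "\<exists>u\<in>X. norm u = 1 \<and> (\<forall>z\<in>Y. 1 / 2 \<le> norm (u - z))"
proof -
  have ne: "Y \<noteq> {}" using subspace_0[OF Y(1)] by blast
  define d where "d = infdist x Y"
  have "d \<noteq> 0" using in_closed_iff_infdist_zero[OF Y(2) ne] x(2) by (auto simp: d_def)
  then have d: "d > 0" using infdist_nonneg[of x Y] by (simp add: d_def)
  have "\<exists>y\<in>Y. dist x y < 2 * d"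
  proof (rule ccontr)
    assume "\<not> ?thesis"
    then have "2 * d \<le> infdist x Y"
      unfolding infdist_notempty[OF ne] by (intro cINF_greatest[OF ne]) (simp add: not_less)
    then show False using d by (simp add: d_def)
  qed
  then obtain y where y: "y \<in> Y" "dist x y < 2 * d" by blast
  define r where "r = norm (x - y)"
  have r: "0 < r" "r < 2 * d" using x y by (auto simp: r_def dist_norm)
  define u where "u = (1 / r) *\<^sub>R (x - y)"
  have "u \<in> X" unfolding u_def using x y X by (intro subspace_scale subspace_diff) auto
  moreover have "norm u = 1" using r by (simp add: u_def flip: r_def)
  moreover have "1 / 2 \<le> norm (u - z)" if z: "z \<in> Y" for z
  proof -
    have "u - z = (1 / r) *\<^sub>R (x - (y + r *\<^sub>R z))"
      using r by (simp add: u_def scaleR_diff_right scaleR_add_right)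
    then have "norm (u - z) = (1 / r) * norm (x - (y + r *\<^sub>R z))" using r by simp
    moreover have "d \<le> norm (x - (y + r *\<^sub>R z))"
      unfolding d_def using infdist_le[of "y + r *\<^sub>R z" Y x] subspace_add[OF Y(1) y(1) subspace_scale[OF Y(1) z]]
      by (simp add: dist_norm)
    ultimately have "r * (1 / 2) \<le> r * norm (u - z)" using r by simp
    then show ?thesis using r(1) by (simp only: mult_le_cancel_left_pos)
  qed
  ultimately show ?thesis by blast
qed

text \<open>
  Riesz theory for \<open>I - K\<close>. Compactness and injectivity bound \<open>I - K\<close> from below, so the ranges of
  its powers are closed. If \<open>I - K\<close> were not onto, these ranges would decrease strictly, and almost
  orthogonal unit vectors from consecutive ranges would have images under \<open>K\<close> at mutual distance at
  least \<open>1 / 2\<close>.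
\<close>

lemma fredholm_injective_imp_surjective:
  fixes K :: "'a::banach \<Rightarrow> 'a"
  assumes K: "bounded_linear K" and comp: "compact (closure (K ` cball 0 1))"
    and inj: "\<And>x. x - K x = 0 \<Longrightarrow> x = 0"
  shows "\<exists>B\<ge>0. \<forall>y. \<exists>x. x - K x = y \<and> norm x \<le> B * norm y"
proof -
  define T where "T x = x - K x" for x
  have T: "bounded_linear T" unfolding T_def by (intro bounded_linear_sub bounded_linear_ident K)
  interpret K: bounded_linear K by (rule K)
  interpret T: bounded_linear T by (rule T)
  have subseq: "\<exists>r l. strict_mono r \<and> (\<lambda>n. K (u (r n))) \<longlonglongrightarrow> l" if u: "\<And>n. norm (u n) = 1" for u :: "nat \<Rightarrow> 'a"
  proof -
    have "K (u n) \<in> closure (K ` cball 0 1)" for n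
      using u[of n] closure_subset[of "K ` cball 0 1"] by auto
    then obtain l r where "strict_mono r" "((\<lambda>n. K (u n)) \<circ> r) \<longlonglongrightarrow> l"
      using comp unfolding compact_def by metis
    then show ?thesis by (auto simp: comp_def)
  qed
  have "\<exists>c>0. \<forall>x. c * norm x \<le> norm (T x)"
  proof (rule ccontr)
    assume "\<not> ?thesis"
    then have "\<exists>x. norm (T x) < (1 / real (Suc n)) * norm x" for n
      by (metis not_le of_nat_0_less_iff zero_less_Suc zero_less_divide_1_iff)
    then obtain x where x: "\<And>n. norm (T (x n)) < (1 / real (Suc n)) * norm (x n)" by metis
    define u where "u n = (1 / norm (x n)) *\<^sub>R x n" for n
    have nx: "norm (x n) > 0" for n using x[of n] T.zero by (cases "x n = 0") auto
    have u: "norm (u n) = 1" for n using nx[of n] by (simp add: u_def)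
    have Tu: "norm (T (u n)) \<le> 1 / real (Suc n)" for n
    proof -
      have "norm (T (u n)) = norm (T (x n)) / norm (x n)" using nx[of n] by (simp add: u_def T.scaleR)
      also have "\<dots> \<le> 1 / real (Suc n)" using x[of n] nx[of n] by (simp add: pos_divide_le_eq)
      finally show ?thesis .
    qed
    obtain r l where r: "strict_mono r" "(\<lambda>n. K (u (r n))) \<longlonglongrightarrow> l" using subseq[of u, OF u] by blast
    have "(\<lambda>n. norm (T (u n))) \<longlonglongrightarrow> 0"
    proof (rule tendsto_sandwich[OF _ _ tendsto_const])
      show "(\<lambda>n. 1 / real (Suc n)) \<longlonglongrightarrow> 0" using LIMSEQ_inverse_real_of_nat by (simp add: inverse_eq_divide)
    qed (use Tu in auto)
    then have "(\<lambda>n. T (u n)) \<longlonglongrightarrow> 0" by (rule tendsto_norm_zero_cancel)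
    from LIMSEQ_subseq_LIMSEQ[OF this r(1)] have "(\<lambda>n. T (u (r n))) \<longlonglongrightarrow> 0" by (simp add: comp_def)
    from tendsto_add[OF this r(2)] have ul: "(\<lambda>n. u (r n)) \<longlonglongrightarrow> l" by (simp add: T_def)
    have "K l = l" using LIMSEQ_unique[OF K.tendsto[OF ul] r(2)] .
    then have "l = 0" using inj[of l] by simp
    moreover have "norm l = 1" using LIMSEQ_unique[OF tendsto_norm[OF ul]] u by simp
    ultimately show False by simp
  qed
  then obtain c where c: "c > 0" "\<And>x. c * norm x \<le> norm (T x)" by blast
  define R where "R n = (T ^^ n) ` UNIV" for n
  have RSuc: "R (Suc n) = T ` R n" for n by (auto simp: R_def image_image)
  have Rc: "subspace (R n) \<and> complete (R n)" for n
  proof (induction n)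
    case 0 show ?case by (simp add: R_def complete_UNIV subspace_UNIV)
  next
    case (Suc n)
    have "complete (T ` R n)"
      by (rule complete_isometric_image[OF c(1) _ T]) (use Suc c in auto)
    then show ?case unfolding RSuc using Suc T.linear_axioms by (auto intro: linear_subspace_image)
  qed
  have Rdec: "R (Suc n) \<subseteq> R n" for n
    unfolding R_def by (auto simp: funpow_swap1)
  then have Ranti: "R n \<subseteq> R m" if "m \<le> n" for m n using lift_Suc_antimono_le[of R] that by blast
  have "surj T"
  proof (rule ccontr)
    assume "\<not> surj T"
    then obtain y0 where y0: "y0 \<notin> range T" by blast
    have injT: "inj T"
    proof (rule injI)
      fix x y assume "T x = T y"
      then have "(x - y) - K (x - y) = 0" using T.diff[of x y] unfolding T_def by simp
      then show "x = y" using inj[of "x - y"] by simp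
    qed
    have "\<exists>u\<in>R n. norm u = 1 \<and> (\<forall>z\<in>R (Suc n). 1 / 2 \<le> norm (u - z))" for n
    proof (rule riesz_almost_orthogonal)
      show "(T ^^ n) y0 \<in> R n" by (simp add: R_def)
      show "(T ^^ n) y0 \<notin> R (Suc n)"
      proof
        assume "(T ^^ n) y0 \<in> R (Suc n)"
        then obtain w where "(T ^^ n) y0 = (T ^^ n) (T w)" by (auto simp: R_def funpow_swap1)
        then have "y0 = T w" using inj_fn[OF injT] by (blast dest: injD)
        with y0 show False by blast
      qed
    qed (use Rc Rdec complete_imp_closed in auto)
    then obtain u where u: "\<And>n. u n \<in> R n" "\<And>n. norm (u n) = 1" "\<And>n z. z \<in> R (Suc n) \<Longrightarrow> 1 / 2 \<le> norm (u n - z)"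
      by metis
    have sep: "1 / 2 \<le> norm (K (u m) - K (u n))" if mn: "m < n" for m n
    proof -
      have 1: "u n \<in> R (Suc m)" using Ranti[of "Suc m" n] mn u(1)[of n] by auto
      have 2: "T (u m) \<in> R (Suc m)" "T (u n) \<in> R (Suc m)"
        using u(1)[of m] u(1)[of n] Ranti[of "Suc m" "Suc n"] mn unfolding RSuc by auto
      have "T (u m) + u n - T (u n) \<in> R (Suc m)"
        using Rc[of "Suc m"] 1 2 by (intro subspace_add subspace_diff) auto
      from u(3)[OF this] show ?thesis by (simp add: T_def algebra_simps)
    qed
    obtain r l where r: "strict_mono r" "(\<lambda>n. K (u (r n))) \<longlonglongrightarrow> l" using subseq[of u, OF u(2)] by blast
    have "Cauchy (\<lambda>n. K (u (r n)))" using r(2) LIMSEQ_imp_Cauchy by blast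
    then obtain M where M: "\<And>m n. m \<ge> M \<Longrightarrow> n \<ge> M \<Longrightarrow> dist (K (u (r m))) (K (u (r n))) < 1 / 2"
      unfolding Cauchy_def by (metis half_gt_zero_iff zero_less_one)
    from M[of M "Suc M"] sep[of "r M" "r (Suc M)"] r(1) show False
      by (simp add: dist_norm strict_mono_Suc_iff)
  qed
  have "\<exists>x. x - K x = y \<and> norm x \<le> (1 / c) * norm y" for y
  proof -
    obtain x where x: "y = T x" using \<open>surj T\<close> by blast
    show ?thesis unfolding x using c(2)[of x] c(1)
      by (intro exI[of _ x]) (simp add: T_def[symmetric] pos_le_divide_eq mult.commute)
  qed
  then show ?thesis using c(1) by (intro exI[of _ "1 / c"]) auto
qed

section \<open>A Cauchy estimate for vector-valued functions\<close>

lemma cscale_mult: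
  assumes "linear i" "\<And>x. i (i x) = - x"
  shows "cscale i (c * d) x = cscale i c (cscale i d x)"
  using assms by (simp add: cscale_def linear_add linear_cmul algebra_simps)

lemma cscale_one: "cscale i 1 x = x" and cscale_of_real: "cscale i (of_real r) x = r *\<^sub>R x"
  by (simp_all add: cscale_def)

lemma bounded_linear_cscale_right:
  assumes "bounded_linear i" shows "bounded_linear (cscale i c)"
  unfolding cscale_def
  by (intro bounded_linear_add bounded_linear_const_scaleR bounded_linear_ident assms)

lemma bounded_bilinear_cscale:
  assumes i: "bounded_linear i" shows "bounded_bilinear (cscale i)"
proof -
  obtain K where K: "\<And>x. norm (i x) \<le> norm x * K" "K > 0" using bounded_linear.pos_bounded[OF i] by blast
  interpret i: bounded_linear i by (rule i)
  show ?thesis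
  proof
    show "\<exists>K. \<forall>a b. norm (cscale i a b) \<le> norm a * norm b * K"
    proof (intro exI[of _ "1 + K"] allI)
      fix a b
      have "norm (cscale i a b) \<le> \<bar>Re a\<bar> * norm b + \<bar>Im a\<bar> * norm (i b)"
        unfolding cscale_def by (rule order_trans[OF norm_triangle_ineq]) simp
      also have "\<dots> \<le> cmod a * norm b + cmod a * (norm b * K)"
        by (intro add_mono mult_mono K abs_Re_le_cmod abs_Im_le_cmod) auto
      finally show "norm (cscale i a b) \<le> cmod a * norm b * (1 + K)" by (simp add: algebra_simps)
    qed
  qed (simp_all add: cscale_def algebra_simps i.add i.scaleR)
qed

text \<open>
  The space carries its complex structure as an operator \<open>i\<close>, so the Cauchy integral is handled by
  real calculus in polar coordinates. For the circle means \<open>h \<rho> = \<integral> e\<^bsup>-i\<phi>\<^esup> f(c + \<rho> e\<^bsup>i\<phi>\<^esup>) d\<phi>\<close> and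
  \<open>k \<rho> = \<integral> f'(c + \<rho> e\<^bsup>i\<phi>\<^esup>) d\<phi>\<close>, differentiation in \<open>\<rho>\<close> gives \<open>h' = k\<close> and integration by parts in
  \<open>\<phi>\<close> gives \<open>h = \<rho> k\<close>. Hence \<open>h / \<rho>\<close>, which is \<open>k\<close>, is constant, and
  \<open>2 \<pi> f'(c) = k 0 = k r = h r / r\<close>.
\<close>

lemma vector_cauchy_estimate:
  fixes f f1 :: "complex \<Rightarrow> 'e::banach"
  assumes i: "bounded_linear i" "\<And>x. i (i x) = - x"
    and K: "0 \<le> K" "\<And>c x. cmod c = 1 \<Longrightarrow> norm (cscale i c x) \<le> K * norm x"
    and r: "0 < r"
    and der: "\<And>z. z \<in> cball c r \<Longrightarrow> (f has_derivative (\<lambda>h. cscale i h (f1 z))) (at z)"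
    and cont: "continuous_on (cball c r) f1"
    and bd: "\<And>z. z \<in> cball c r \<Longrightarrow> norm (f z) \<le> B"
  shows "norm (f1 c) \<le> K * B / r"
proof -
  note lin = bounded_linear.linear[OF i(1)]
  interpret cs: bounded_bilinear "cscale i" by (rule bounded_bilinear_cscale[OF i(1)])
  note mult = cscale_mult[OF lin i(2)]
  define p where "p \<rho> \<phi> = c + of_real \<rho> * cis \<phi>" for \<rho> \<phi>
  have p_in: "p \<rho> \<phi> \<in> cball c r" if "\<rho> \<in> {0..r}" for \<rho> \<phi>
    using that by (simp add: p_def dist_norm norm_mult)
  have p_cont: "continuous_on S (\<lambda>(\<rho>, \<phi>). p \<rho> \<phi>)" for S
    unfolding p_def split_beta by (intro continuous_intros)
  have cont_f: "continuous_on (cball c r) f"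
    using der by (auto intro!: continuous_at_imp_continuous_on has_derivative_continuous)
  define h where "h \<rho> = integral {0..2*pi} (\<lambda>\<phi>. cscale i (cis (-\<phi>)) (f (p \<rho> \<phi>)))" for \<rho>
  define k where "k \<rho> = integral {0..2*pi} (\<lambda>\<phi>. f1 (p \<rho> \<phi>))" for \<rho>
  have cont2: "continuous_on ({0..r} \<times> S) (\<lambda>(\<rho>, \<phi>). f1 (p \<rho> \<phi>))" for S
  proof -
    have "(\<lambda>(\<rho>, \<phi>). p \<rho> \<phi>) ` ({0..r} \<times> S) \<subseteq> cball c r"
      by (rule image_subsetI) (auto simp: p_in simp del: mem_cball)
    from continuous_on_compose2[OF cont p_cont this] show ?thesis by (simp add: split_beta)
  qed
  have conth: "continuous_on S (\<lambda>\<phi>. cscale i (w \<phi>) (f (p \<rho> \<phi>)))"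
    if "\<rho> \<in> {0..r}" "continuous_on S w" for \<rho> S w
  proof (rule cs.continuous_on[OF that(2)])
    show "continuous_on S (\<lambda>\<phi>. f (p \<rho> \<phi>))"
      by (rule continuous_on_compose2[OF cont_f]) (use p_in that in \<open>auto simp: p_def intro!: continuous_intros\<close>)
  qed
  have f_ray: "((\<lambda>\<rho>. f (p \<rho> \<phi>)) has_vector_derivative cscale i (cis \<phi>) (f1 (p \<rho> \<phi>))) (at \<rho> within {0..r})"
    if "\<rho> \<in> {0..r}" for \<rho> \<phi>
  proof -
    have "((\<lambda>\<rho>. p \<rho> \<phi>) has_derivative (\<lambda>x. of_real x * cis \<phi>)) (at \<rho> within {0..r})"
      unfolding p_def by (auto intro!: derivative_eq_intros)
    from has_derivative_compose[OF this der[OF p_in[OF that]]] show ?thesis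
      unfolding has_vector_derivative_def
      by (rule has_derivative_eq_rhs) (auto simp: mult cscale_of_real)
  qed
  have f_circle: "((\<lambda>\<phi>. f (p \<rho> \<phi>)) has_vector_derivative cscale i (of_real \<rho> * \<i> * cis \<phi>) (f1 (p \<rho> \<phi>))) (at \<phi> within S)"
    if "\<rho> \<in> {0..r}" for \<rho> \<phi> S
  proof -
    have "((\<lambda>\<phi>. p \<rho> \<phi>) has_derivative (\<lambda>x. of_real \<rho> * (x *\<^sub>R (\<i> * cis \<phi>)))) (at \<phi> within S)"
      unfolding p_def by (auto intro!: derivative_eq_intros)
    from has_derivative_compose[OF this der[OF p_in[OF that]]] show ?thesis
      unfolding has_vector_derivative_def
      by (rule has_derivative_eq_rhs) (auto simp: cs.scaleR_left scaleR_conv_of_real algebra_simps simp flip: cs.scaleR_left)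
  qed
  have hk: "(h has_vector_derivative k \<rho>) (at \<rho> within {0..r})" if \<rho>: "\<rho> \<in> {0..r}" for \<rho>
    unfolding h_def k_def
  proof (rule leibniz_rule_vector_derivative[where U = "{0..r}" and a = 0 and b = "2*pi" and 'b=real, unfolded interval_cbox[symmetric] box_real])
    show "((\<lambda>\<rho>. cscale i (cis (- \<phi>)) (f (p \<rho> \<phi>))) has_vector_derivative f1 (p \<rho> \<phi>)) (at \<rho> within {0..r})"
      if "\<rho> \<in> {0..r}" for \<rho> \<phi>
    proof -
      have "((\<lambda>\<rho>. cscale i (cis (- \<phi>)) (f (p \<rho> \<phi>))) has_vector_derivative
          cscale i (cis (-\<phi>)) (cscale i (cis \<phi>) (f1 (p \<rho> \<phi>)))) (at \<rho> within {0..r})"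
        by (rule bounded_linear.has_vector_derivative[OF bounded_linear_cscale_right[OF i(1)] f_ray[OF that]])
      then show ?thesis by (simp add: cis_mult cscale_one flip: mult)
    qed
    show "(\<lambda>\<phi>. cscale i (cis (- \<phi>)) (f (p \<rho> \<phi>))) integrable_on {0..2*pi}" if "\<rho> \<in> {0..r}" for \<rho>
      by (intro integrable_continuous_interval conth that) (auto intro!: continuous_intros)
  qed (use \<rho> cont2 in auto)
  have rk: "\<rho> *\<^sub>R k \<rho> = h \<rho>" if \<rho>: "\<rho> \<in> {0..r}" for \<rho>
  proof -
    \<comment> \<open>\<open>\<psi>\<close> is periodic, so the integral of its derivative over the circle vanishes\<close>
    define \<psi> where "\<psi> \<phi> = cscale i (- \<i> * cis (-\<phi>)) (f (p \<rho> \<phi>))" for \<phi>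
    have "(\<psi> has_vector_derivative \<rho> *\<^sub>R f1 (p \<rho> \<phi>) - cscale i (cis (-\<phi>)) (f (p \<rho> \<phi>))) (at \<phi> within {0..2*pi})" for \<phi>
    proof -
      have "((\<lambda>\<phi>. - \<i> * cis (-\<phi>)) has_vector_derivative - cis (-\<phi>)) (at \<phi> within {0..2*pi})"
        unfolding has_vector_derivative_def
        by (auto intro!: derivative_eq_intros simp: scaleR_conv_of_real complex_eq_iff)
      from cs.has_vector_derivative[OF this f_circle[OF \<rho>, of \<phi> "{0..2*pi}"]]
      have "(\<psi> has_vector_derivative cscale i (- \<i> * cis (-\<phi>)) (cscale i (of_real \<rho> * \<i> * cis \<phi>) (f1 (p \<rho> \<phi>)))
          + cscale i (- cis (-\<phi>)) (f (p \<rho> \<phi>))) (at \<phi> within {0..2*pi})"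
        unfolding \<psi>_def .
      moreover
      have "- \<i> * cis (-\<phi>) * (of_real \<rho> * \<i> * cis \<phi>) = of_real \<rho>"
      proof -
        have "- \<i> * cis (-\<phi>) * (of_real \<rho> * \<i> * cis \<phi>) = of_real \<rho> * (cis (-\<phi>) * cis \<phi>)"
          by (simp add: algebra_simps)
        then show ?thesis by (simp add: cis_mult)
      qed
      then have "cscale i (- \<i> * cis (-\<phi>)) (cscale i (of_real \<rho> * \<i> * cis \<phi>) (f1 (p \<rho> \<phi>))) = \<rho> *\<^sub>R f1 (p \<rho> \<phi>)"
        by (simp only: mult[symmetric] cscale_of_real)
      ultimately show ?thesis by (simp only: cs.minus_left add_uminus_conv_diff)
    qed
    then have int1: "((\<lambda>\<phi>. \<rho> *\<^sub>R f1 (p \<rho> \<phi>) - cscale i (cis (-\<phi>)) (f (p \<rho> \<phi>))) has_integral \<psi> (2*pi) - \<psi> 0) {0..2*pi}"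
      by (intro fundamental_theorem_of_calculus) auto
    have per: "\<psi> (2*pi) = \<psi> 0" by (simp add: \<psi>_def p_def cis.ctr)
    have int2: "((\<lambda>\<phi>. \<rho> *\<^sub>R f1 (p \<rho> \<phi>) - cscale i (cis (-\<phi>)) (f (p \<rho> \<phi>))) has_integral \<rho> *\<^sub>R k \<rho> - h \<rho>) {0..2*pi}"
      unfolding k_def h_def
    proof (intro has_integral_diff has_integral_cmul integrable_integral)
      have "continuous_on {0..2*pi} (\<lambda>\<phi>. f1 (p \<rho> \<phi>))"
        by (rule continuous_on_compose2[OF cont]) (use p_in \<rho> in \<open>auto simp: p_def intro!: continuous_intros\<close>)
      then show "(\<lambda>\<phi>. f1 (p \<rho> \<phi>)) integrable_on {0..2*pi}" by (rule integrable_continuous_interval)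
      show "(\<lambda>\<phi>. cscale i (cis (- \<phi>)) (f (p \<rho> \<phi>))) integrable_on {0..2*pi}"
        by (intro integrable_continuous_interval conth \<rho>) (auto intro!: continuous_intros)
    qed
    show ?thesis using has_integral_unique[OF int1 int2] per by simp
  qed
  have "\<exists>C. \<forall>\<rho>\<in>{0<..r}. k \<rho> = C"
  proof -
    have "\<exists>C. \<forall>\<rho>\<in>{0<..r}. inverse \<rho> *\<^sub>R h \<rho> = C"
    proof -
      have der0: "((\<lambda>\<rho>. inverse \<rho> *\<^sub>R h \<rho>) has_vector_derivative 0) (at \<rho> within {0<..r})"
        if \<rho>: "\<rho> \<in> {0<..r}" for \<rho>
      proof -
        have \<rho>': "\<rho> \<in> {0..r}" "\<rho> \<noteq> 0" using \<rho> by auto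
        have h': "(h has_vector_derivative k \<rho>) (at \<rho> within {0<..r})"
          by (rule has_vector_derivative_within_subset[OF hk[OF \<rho>'(1)]]) auto
        have "inverse \<rho> *\<^sub>R k \<rho> + (- (inverse \<rho> ^ Suc (Suc 0))) *\<^sub>R h \<rho> = 0"
          unfolding rk[OF \<rho>'(1), symmetric] using \<rho>'(2) by simp
        then show ?thesis
          using has_vector_derivative_scaleR[OF DERIV_inverse[OF \<rho>'(2)] h'] by simp
      qed
      obtain C where "\<And>\<rho>. \<rho> \<in> {0<..r} \<Longrightarrow> inverse \<rho> *\<^sub>R h \<rho> = C"
        using has_vector_derivative_zero_constant[OF convex_real_interval(6) der0] by blast
      then show ?thesis by blast
    qed
    then obtain C where C: "\<forall>\<rho>\<in>{0<..r}. inverse \<rho> *\<^sub>R h \<rho> = C" by blast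
    have "k \<rho> = C" if "\<rho> \<in> {0<..r}" for \<rho>
    proof -
      have "inverse \<rho> *\<^sub>R h \<rho> = k \<rho>" using rk[of \<rho>, symmetric] that by simp
      then show ?thesis using C that by simp
    qed
    then show ?thesis by blast
  qed
  then obtain C where C: "\<And>\<rho>. \<rho> \<in> {0<..r} \<Longrightarrow> k \<rho> = C" by blast
  have contk: "continuous_on {0..r} k"
    unfolding k_def using integral_continuous_on_param[of "{0..r}" 0 "2*pi" "\<lambda>\<rho> \<phi>. f1 (p \<rho> \<phi>)"] cont2[of "{0..2*pi}"]
    by simp
  have "k 0 = C"
    by (rule continuous_constant_on_closure[of "{0<..r}" k]) (use contk C r in auto)
  then have k0: "k 0 = k r" using C[of r] r by simp
  have "k 0 = (2 * pi) *\<^sub>R f1 c" by (simp add: k_def p_def)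
  then have "h r = (r * (2 * pi)) *\<^sub>R f1 c" using rk[of r] k0 r by simp
  then have "(2 * pi * r) * norm (f1 c) = norm (h r)" using r by simp
  also have "\<dots> \<le> (K * B) * (2 * pi - 0)"
    unfolding h_def
  proof (rule integral_bound)
    show "continuous_on {0..2*pi} (\<lambda>\<phi>. cscale i (cis (- \<phi>)) (f (p r \<phi>)))"
      by (rule conth) (use r in \<open>auto intro!: continuous_intros\<close>)
    fix \<phi>
    show "norm (cscale i (cis (- \<phi>)) (f (p r \<phi>))) \<le> K * B"
      using order_trans[OF K(2) mult_left_mono[OF bd[OF p_in] K(1)]] r by simp
  qed simp
  finally have "(2 * pi) * (r * norm (f1 c)) \<le> (2 * pi) * (K * B)" by (simp only: mult_ac diff_zero)
  then have "r * norm (f1 c) \<le> K * B" by (simp only: mult_le_cancel_left_pos[OF pi_gt_zero[THEN mult_pos_pos[OF zero_less_numeral]]])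
  then show ?thesis using r by (simp add: pos_le_divide_eq mult.commute)
qed

section \<open>Smoothing by analytic semigroups\<close>

lemma sector_scale: "0 < r \<Longrightarrow> of_real r * z \<in> sector \<delta> \<longleftrightarrow> z \<in> sector \<delta>"
  by (simp add: sector_def)

lemma of_real_in_sector: "0 < \<delta> \<Longrightarrow> 0 < t \<Longrightarrow> of_real t \<in> sector \<delta>"
  using sector_scale[of t 1 \<delta>] by (simp add: sector_def)

text \<open>
  The argument is continuous at \<open>1\<close>, which gives a disc around \<open>1\<close>; the sector is invariant under
  scaling.
\<close>

lemma sector_contains_disc:
  assumes "0 < \<delta>"
  obtains s where "0 < s" "s < 1" "\<And>t. 0 < t \<Longrightarrow> cball (of_real t) (t * s) \<subseteq> sector \<delta>"
proof -
  have "1 \<notin> \<real>\<^sub>\<le>\<^sub>0" by simp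
  then have "isCont Arg 1" by (rule continuous_at_Arg)
  then obtain e where e: "e > 0" "\<And>z. dist z 1 < e \<Longrightarrow> dist (Arg z) (Arg 1) < \<delta>"
    using assms unfolding continuous_at_eps_delta by blast
  define s where "s = min (e / 2) (1 / 2)"
  have s: "0 < s" "s < 1" "s < e" using e by (auto simp: s_def)
  have 1: "z \<in> sector \<delta>" if "dist z 1 \<le> s" for z
  proof -
    have "z \<noteq> 0" using that s by auto
    moreover have "\<bar>Arg z\<bar> < \<delta>" using e(2)[of z] that s by (simp add: dist_norm)
    ultimately show ?thesis by (simp add: sector_def)
  qed
  show thesis
  proof (rule that[OF s(1,2)], rule subsetI)
    fix t :: real and z :: complex assume t: "0 < t" and z: "z \<in> cball (of_real t) (t * s)"
    have "z / of_real t - 1 = (z - of_real t) / of_real t" using t by (simp add: field_simps)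
    then have "dist (z / of_real t) 1 = norm (z - of_real t) / t" using t by (simp add: dist_norm norm_divide)
    also have "\<dots> \<le> s" using z t by (simp add: dist_norm norm_minus_commute pos_divide_le_eq mult.commute)
    finally have "z / of_real t \<in> sector \<delta>" by (rule 1)
    then show "z \<in> sector \<delta>" using sector_scale[OF t, of "z / of_real t" \<delta>] t by simp
  qed
qed

text \<open>
  Otherwise there are \<open>z\<^sub>n \<rightarrow> 0\<close> in the sector with unbounded operator norms, although \<open>Z z\<^sub>n x \<rightarrow> x\<close>
  for every \<open>x\<close>; this contradicts uniform boundedness.
\<close>

lemma sector_locally_bounded:
  fixes Z :: "complex \<Rightarrow> 'e::banach \<Rightarrow> 'e"
  assumes lin: "\<And>z. z \<in> sector \<delta> \<Longrightarrow> bounded_linear (Z z)"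
    and lim: "\<And>x. ((\<lambda>z. Z z x) \<longlongrightarrow> x) (at 0 within sector \<delta>)"
  shows "\<exists>\<epsilon>>0. \<exists>M\<ge>0. \<forall>z\<in>sector \<delta>. cmod z < \<epsilon> \<longrightarrow> (\<forall>x. norm (Z z x) \<le> M * norm x)"
proof (rule ccontr)
  assume neg: "\<not> ?thesis"
  have "\<exists>z x. z \<in> sector \<delta> \<and> cmod z < inverse (real (Suc n)) \<and> real n * norm x < norm (Z z x)" for n
  proof (rule ccontr)
    assume "\<not> ?thesis"
    then have "\<forall>z\<in>sector \<delta>. cmod z < inverse (real (Suc n)) \<longrightarrow> (\<forall>x. norm (Z z x) \<le> real n * norm x)"
      by (meson not_le)
    moreover have "inverse (real (Suc n)) > 0" "real n \<ge> 0" by simp_all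
    ultimately show False using neg by blast
  qed
  then obtain z x where z: "\<And>n. z n \<in> sector \<delta>" "\<And>n. cmod (z n) < inverse (real (Suc n))"
    and x: "\<And>n. real n * norm (x n) < norm (Z (z n) (x n))"
    by metis
  have "(\<lambda>n. cmod (z n)) \<longlonglongrightarrow> 0"
    by (rule tendsto_0_bound[OF _ _ LIMSEQ_inverse_real_of_nat]) (use z less_imp_le in auto)
  then have "filterlim z (at 0 within sector \<delta>) sequentially"
    unfolding filterlim_at using z(1) by (auto simp: tendsto_norm_zero_iff sector_def)
  from filterlim_compose[OF lim this] have "(\<lambda>n. Z (z n) y) \<longlonglongrightarrow> y" for y by simp
  then have "Bseq (\<lambda>n. Z (z n) y)" for y using convergent_imp_Bseq convergentI by blast
  then have "\<exists>B. \<forall>n\<in>UNIV. norm (Z (z n) y) \<le> B" for y unfolding Bseq_def by blast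
  from uniform_boundedness[OF lin[OF z(1)] this]
  obtain C where C: "\<And>n y. norm (Z (z n) y) \<le> C * norm y" by blast
  obtain n where n: "C \<le> real n" using real_arch_simple by blast
  have "C * norm (x n) \<le> real n * norm (x n)" using n by (intro mult_right_mono) auto
  with x[of n] C[of n "x n"] show False by linarith
qed

text \<open>
  The Cauchy estimate on the disc around \<open>t\<close> whose radius \<open>r\<close> is a fixed fraction of \<open>t\<close>.
  The semigroup law expresses the derivative at every point of the disc through the derivative
  \<open>y\<close> at the single point \<open>r\<close>, namely as \<open>Z (z - r) y\<close>, and this makes it continuous.
\<close>

lemma sector_extension_derivative:
  fixes S :: "real \<Rightarrow> 'e::banach \<Rightarrow> 'e"
  assumes i: "bounded_linear i" "\<And>x. i (i x) = - x" and ext: "has_sector_extension i S"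
  shows "\<exists>\<tau>>0. \<exists>C\<ge>0. \<forall>t. 0 < t \<longrightarrow> t < \<tau> \<longrightarrow>
     (\<forall>x. \<exists>d. ((\<lambda>t. S t x) has_vector_derivative d) (at t) \<and> norm d \<le> C / t * norm x)"
proof -
  obtain \<delta> Z where \<delta>: "0 < \<delta>" and ZS: "\<And>t. 0 < t \<Longrightarrow> Z (complex_of_real t) = S t"
    and Zlin: "\<And>z. z \<in> sector \<delta> \<Longrightarrow> bounded_linear (Z z)"
    and Zi: "\<And>z. z \<in> sector \<delta> \<Longrightarrow> lin_on (Some i) UNIV (Z z)"
    and Zadd: "\<And>z w x. z \<in> sector \<delta> \<Longrightarrow> w \<in> sector \<delta> \<Longrightarrow> Z (z + w) x = Z z (Z w x)"
    and Zder: "\<And>z x. z \<in> sector \<delta> \<Longrightarrow> \<exists>d. ((\<lambda>z. Z z x) has_derivative (\<lambda>h. cscale i h d)) (at z)"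
    and Zlim: "\<And>x. ((\<lambda>z. Z z x) \<longlongrightarrow> x) (at 0 within sector \<delta>)"
    using ext unfolding has_sector_extension_def by blast
  note lin_i = bounded_linear.linear[OF i(1)]
  obtain s0 where s0: "0 < s0" "s0 < 1" and disc: "\<And>t. 0 < t \<Longrightarrow> cball (of_real t) (t * s0) \<subseteq> sector \<delta>"
    using sector_contains_disc[OF \<delta>] by blast
  obtain \<epsilon> M where \<epsilon>: "\<epsilon> > 0" and M: "M \<ge> 0"
    and Zbd: "\<And>z x. z \<in> sector \<delta> \<Longrightarrow> cmod z < \<epsilon> \<Longrightarrow> norm (Z z x) \<le> M * norm x"
    using sector_locally_bounded[OF Zlin Zlim] by blast
  obtain K where K: "K > 0" "\<And>c x. norm (cscale i c x) \<le> norm c * norm x * K"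
    using bounded_bilinear.pos_bounded[OF bounded_bilinear_cscale[OF i(1)]] by blast
  have Zcs: "Z z (cscale i c x) = cscale i c (Z z x)" if "z \<in> sector \<delta>" for z c x
    using Zi[OF that] unfolding lin_on_def cscale_def by simp
  \<comment> \<open>half of \<open>s0\<close>, so that translating the disc by its radius stays inside the sector\<close>
  define s where "s = s0 / 2"
  have s: "0 < s" "s < 1" using s0 by (auto simp: s_def)
  have main: "\<exists>d. ((\<lambda>t. S t x) has_vector_derivative d) (at t) \<and> norm d \<le> (K * M / s) / t * norm x"
    if t: "0 < t" "t < \<epsilon> / 2" for t x
  proof -
    define r where "r = t * s"
    have r: "r > 0" "r < t" using t s by (auto simp: r_def)
    define w0 where "w0 = complex_of_real r"
    have w0: "w0 \<in> sector \<delta>" unfolding w0_def by (rule of_real_in_sector[OF \<delta> r(1)])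
    obtain y where y: "((\<lambda>z. Z z x) has_derivative (\<lambda>h. cscale i h y)) (at w0)" using Zder[OF w0] by blast
    define f1 where "f1 z = Z (z - w0) y" for z
    have in1: "z - w0 \<in> sector \<delta>" if "z \<in> cball (of_real t) r" for z
    proof -
      have "dist (of_real t) (z - w0) \<le> dist (of_real t) z + cmod w0"
        using norm_triangle_ineq[of "of_real t - z" w0] by (simp add: dist_norm algebra_simps)
      also have "\<dots> \<le> r + r" using that r by (intro add_mono) (auto simp: w0_def)
      also have "\<dots> = t * s0" by (simp add: r_def s_def)
      finally show ?thesis using disc[OF t(1)] by auto
    qed
    have in2: "z \<in> sector \<delta>" if "z \<in> cball (of_real t) r" for z
    proof -
      have "r \<le> t * s0" using t s0 by (simp add: r_def s_def)
      then have "z \<in> cball (of_real t) (t * s0)" using that by auto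
      then show ?thesis using disc[OF t(1)] by blast
    qed
    have der: "((\<lambda>z. Z z x) has_derivative (\<lambda>h. cscale i h (f1 z))) (at z)" if z: "z \<in> cball (of_real t) r" for z
    proof -
      have "((\<lambda>z'. w0 + (z' - z)) has_derivative (\<lambda>h. h)) (at z)"
        by (auto intro!: derivative_eq_intros)
      from has_derivative_compose[OF this, of "\<lambda>z. Z z x" "\<lambda>h. cscale i h y"] y
      have "((\<lambda>z'. Z (w0 + (z' - z)) x) has_derivative (\<lambda>h. cscale i h y)) (at z)" by simp
      from bounded_linear.has_derivative[OF Zlin[OF in1[OF z]] this]
      have d: "((\<lambda>z'. Z (z - w0) (Z (w0 + (z' - z)) x)) has_derivative (\<lambda>h. cscale i h (f1 z))) (at z)"
        by (simp add: Zcs[OF in1[OF z]] f1_def)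
      show ?thesis
      proof (rule has_derivative_transform_within_open[OF d, of "ball z (r * s0)"])
        show "z \<in> ball z (r * s0)" using r s0 by simp
        fix z' assume "z' \<in> ball z (r * s0)"
        then have "w0 + (z' - z) \<in> cball (of_real r) (r * s0)"
          by (simp add: dist_norm w0_def norm_minus_commute)
        then have "w0 + (z' - z) \<in> sector \<delta>" using disc[OF r(1)] by blast
        from Zadd[OF in1[OF z] this, of x] show "Z (z - w0) (Z (w0 + (z' - z)) x) = Z z' x" by simp
      qed simp
    qed
    have contZ: "continuous_on (sector \<delta>) (\<lambda>z. Z z y)"
    proof (intro continuous_at_imp_continuous_on ballI)
      fix z assume "z \<in> sector \<delta>"
      then obtain d where "((\<lambda>z. Z z y) has_derivative (\<lambda>h. cscale i h d)) (at z)" using Zder by blast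
      then show "isCont (\<lambda>z. Z z y) z" by (rule has_derivative_continuous)
    qed
    have cont: "continuous_on (cball (of_real t) r) f1"
      unfolding f1_def
      by (rule continuous_on_compose2[OF contZ]) (use in1 in \<open>auto intro!: continuous_intros\<close>)
    have bd: "norm (Z z x) \<le> M * norm x" if z: "z \<in> cball (of_real t) r" for z
    proof (rule Zbd[OF in2[OF z]])
      have "cmod z \<le> cmod (of_real t) + cmod (z - of_real t)" by norm
      also have "\<dots> \<le> t + r" using z t by (simp add: dist_norm norm_minus_commute)
      finally show "cmod z < \<epsilon>" using r t by linarith
    qed
    have "norm (f1 (of_real t)) \<le> K * (M * norm x) / r"
    proof (rule vector_cauchy_estimate[OF i _ _ r(1) der cont bd])
      show "norm (cscale i c z) \<le> K * norm z" if "cmod c = 1" for c z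
        using K(2)[of c z] that by (simp add: mult.commute)
    qed (use K in auto)
    moreover have "((\<lambda>t. S t x) has_vector_derivative f1 (of_real t)) (at t)"
    proof -
      have "(complex_of_real has_derivative (\<lambda>h. of_real h)) (at t)"
        by (auto intro!: derivative_eq_intros)
      from has_derivative_compose[OF this der[of "of_real t"]] r
      have "((\<lambda>t. Z (of_real t) x) has_vector_derivative f1 (of_real t)) (at t)"
        by (simp add: has_vector_derivative_def cscale_of_real)
      then show ?thesis
        by (rule has_vector_derivative_transform_within_open[of _ _ _ "{0<..}"]) (use t ZS in auto)
    qed
    moreover have "K * (M * norm x) / r = (K * M / s) / t * norm x" by (simp add: r_def mult.commute)
    ultimately show ?thesis by auto
  qed
  moreover have "0 \<le> K * M / s" "0 < \<epsilon> / 2" using K M s \<epsilon> by auto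
  ultimately show ?thesis by blast
qed

lemma c0_semigroup_bounded:
  assumes S: "c0_semigroup J S"
  shows "\<exists>M\<ge>0. \<forall>t\<in>{0..T}. \<forall>x. norm (S t x) \<le> M * norm x"
proof (rule uniform_boundedness)
  show "bounded_linear (S t)" if "t \<in> {0..T}" for t using S that by (auto simp: c0_semigroup_def)
  fix x
  have "continuous_on {0..T} (\<lambda>t. S t x)"
    using S by (auto simp: c0_semigroup_def intro: continuous_on_subset)
  then have "bounded ((\<lambda>t. S t x) ` {0..T})"
    by (intro compact_imp_bounded compact_continuous_image) auto
  then show "\<exists>B. \<forall>t\<in>{0..T}. norm (S t x) \<le> B" by (auto simp: bounded_iff)
qed

lemma complexification_unit:
  "bounded_linear (\<lambda>(x, y). (- y, x) :: 'a \<times> 'a::real_normed_vector)"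
proof -
  have "bounded_linear (\<lambda>p. (- snd p, fst p) :: 'a \<times> 'a)"
    by (rule bounded_linear_Pair[OF bounded_linear_minus[OF bounded_linear_snd] bounded_linear_fst])
  moreover have "(\<lambda>(x, y). (- y, x)) = (\<lambda>p. (- snd p, fst p) :: 'a \<times> 'a)" by auto
  ultimately show ?thesis by simp
qed

lemma scalar_structure_bounded:
  assumes "scalar_structure J" "banach_on J (NSpace (UNIV :: 'a::banach set) norm)" "J = Some i"
  shows "bounded_linear i"
proof (rule bounded_linear_intro[of _ 1])
  have i: "linear i" using assms by (simp add: scalar_structure_def)
  show "i (x + y) = i x + i y" "i (r *\<^sub>R x) = r *\<^sub>R i x" for x y r using i by (simp_all add: linear_add linear_cmul)
  have "norm (cscale i \<i> x) = cmod \<i> * norm x" for x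
    using assms by (simp add: banach_on_def normed_on_def)
  then show "norm (i x) \<le> norm x * 1" for x by (simp add: cscale_def)
qed

lemma analytic_semigroup_local_derivative:
  fixes S :: "real \<Rightarrow> 'a::banach \<Rightarrow> 'a"
  assumes J: "scalar_structure J" "banach_on J (NSpace (UNIV::'a set) norm)" and S: "analytic_semigroup J S"
  shows "\<exists>\<tau>>0. \<exists>C\<ge>0. \<forall>t. 0 < t \<longrightarrow> t < \<tau> \<longrightarrow>
     (\<forall>x. \<exists>d. ((\<lambda>t. S t x) has_vector_derivative d) (at t) \<and> norm d \<le> C / t * norm x)"
proof (cases J)
  case (Some i)
  have i: "bounded_linear i" "\<And>x. i (i x) = - x"
    using scalar_structure_bounded[OF J Some] J Some by (auto simp: scalar_structure_def)
  have "has_sector_extension i S" using S Some by (simp add: analytic_semigroup_def)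
  from sector_extension_derivative[OF i this] show ?thesis .
next
  case None
  define S' where "S' = (\<lambda>t (x, y). (S t x, S t y))"
  have "has_sector_extension (\<lambda>(x, y). (- y, x)) S'"
    using S None by (simp add: analytic_semigroup_def S'_def)
  from sector_extension_derivative[OF complexification_unit _ this]
  obtain \<tau> C where \<tau>: "\<tau> > 0" and C: "C \<ge> 0" and
    *: "\<And>t x. 0 < t \<Longrightarrow> t < \<tau> \<Longrightarrow> \<exists>d. ((\<lambda>t. S' t x) has_vector_derivative d) (at t) \<and> norm d \<le> C / t * norm x"
    by auto
  have "\<exists>d. ((\<lambda>t. S t x) has_vector_derivative d) (at t) \<and> norm d \<le> C / t * norm x"
    if t: "0 < t" "t < \<tau>" for t x
  proof -
    obtain d where d: "((\<lambda>t. S' t (x, 0)) has_vector_derivative d) (at t)" "norm d \<le> C / t * norm (x, 0::'a)"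
      using *[OF t, of "(x, 0)"] by blast
    have "((\<lambda>t. S t x) has_vector_derivative fst d) (at t)"
      using bounded_linear.has_vector_derivative[OF bounded_linear_fst d(1)] by (simp add: S'_def)
    moreover have "norm (fst d) \<le> norm d" by (metis norm_fst_le prod.collapse)
    ultimately show ?thesis using d(2) by (auto simp: norm_Pair intro!: exI[of _ "fst d"])
  qed
  with \<tau> C show ?thesis by blast
qed

text \<open>
  Times that are not small are reached from a fixed small time \<open>t0\<close> by the semigroup law; on
  \<open>(0, T]\<close> the bound keeps the form \<open>C / t\<close> with a larger constant.
\<close>

lemma analytic_semigroup_derivative:
  fixes S :: "real \<Rightarrow> 'a::banach \<Rightarrow> 'a"
  assumes J: "scalar_structure J" "banach_on J (NSpace (UNIV::'a set) norm)" and S: "analytic_semigroup J S"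
    and T: "0 < T"
  shows "\<exists>C\<ge>0. \<forall>t>0. \<forall>x. \<exists>d. ((\<lambda>t. S t x) has_vector_derivative d) (at t) \<and> (t \<le> T \<longrightarrow> norm d \<le> C / t * norm x)"
proof -
  have c0: "c0_semigroup J S" using S by (simp add: analytic_semigroup_def)
  have lin: "bounded_linear (S t)" if "0 \<le> t" for t using c0 that by (auto simp: c0_semigroup_def)
  have add: "S (s + t) x = S s (S t x)" if "0 \<le> s" "0 \<le> t" for s t x using c0 that by (auto simp: c0_semigroup_def)
  obtain M where M: "M \<ge> 0" "\<And>t x. 0 \<le> t \<Longrightarrow> t \<le> T \<Longrightarrow> norm (S t x) \<le> M * norm x"
    using c0_semigroup_bounded[OF c0, of T] by auto
  obtain \<tau> C where \<tau>: "\<tau> > 0" and C: "C \<ge> 0" and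
    near: "\<And>t x. 0 < t \<Longrightarrow> t < \<tau> \<Longrightarrow> \<exists>d. ((\<lambda>t. S t x) has_vector_derivative d) (at t) \<and> norm d \<le> C / t * norm x"
    using analytic_semigroup_local_derivative[OF J S] by blast
  define t0 where "t0 = \<tau> / 2"
  have t0: "0 < t0" "t0 < \<tau>" using \<tau> by (auto simp: t0_def)
  define C' where "C' = max C (M * C * T / t0)"
  have C': "C \<le> C'" "M * C * T / t0 \<le> C'" "0 \<le> C'" using C by (auto simp: C'_def)
  have "\<exists>d. ((\<lambda>t. S t x) has_vector_derivative d) (at t) \<and> (t \<le> T \<longrightarrow> norm d \<le> C' / t * norm x)"
    if t: "t > 0" for t x
  proof (cases "t < \<tau>")
    case True
    obtain d where d: "((\<lambda>t. S t x) has_vector_derivative d) (at t)" "norm d \<le> C / t * norm x"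
      using near[OF t True] by blast
    have "C / t * norm x \<le> C' / t * norm x" using C' t by (intro mult_right_mono divide_right_mono) auto
    with d show ?thesis by auto
  next
    case False
    obtain d where d: "((\<lambda>t. S t x) has_vector_derivative d) (at t0)" "norm d \<le> C / t0 * norm x"
      using near[OF t0] by blast
    have tt: "0 < t - t0" using False t0 by simp
    have "((\<lambda>u. t0 + (u - t)) has_vector_derivative 1) (at t)"
      by (auto intro!: derivative_eq_intros)
    from vector_diff_chain_at[OF this, of "\<lambda>t. S t x" d] d(1)
    have "((\<lambda>u. S (t0 + (u - t)) x) has_vector_derivative d) (at t)" by (simp add: o_def)
    from bounded_linear.has_vector_derivative[OF lin[of "t - t0"] this] tt
    have "((\<lambda>u. S (t - t0) (S (t0 + (u - t)) x)) has_vector_derivative S (t - t0) d) (at t)" by simp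
    then have "((\<lambda>u. S u x) has_vector_derivative S (t - t0) d) (at t)"
    proof (rule has_vector_derivative_transform_within_open[of _ _ _ "{t - t0<..}"])
      show "S (t - t0) (S (t0 + (u - t)) x) = S u x" if "u \<in> {t - t0<..}" for u
        using add[of "t - t0" "t0 + (u - t)" x] tt that by simp
    qed (use t0 in auto)
    moreover have "norm (S (t - t0) d) \<le> C' / t * norm x" if "t \<le> T"
    proof -
      have "norm (S (t - t0) d) \<le> M * norm d" using M(2)[of "t - t0" d] tt t0 that by simp
      also have "\<dots> \<le> M * (C / t0 * norm x)" by (intro mult_left_mono d M)
      also have "\<dots> = (M * C * T / t0) / T * norm x" using T by simp
      also have "\<dots> \<le> C' / t * norm x"
        using C' that t T by (intro mult_right_mono frac_le) auto
      finally show ?thesis .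
    qed
    ultimately show ?thesis by blast
  qed
  with C'(3) show ?thesis by blast
qed

text \<open>
  What the solution theory needs from an analytic semigroup: \<open>R\<close> plays the resolvent
  \<open>(\<lambda> - A)\<^sup>-\<^sup>1\<close>, whose range is the domain, so that \<open>A R x = \<lambda> R x - x\<close>; the operator
  \<open>D t = R\<^sup>-\<^sup>1 S t\<close> is \<open>(\<lambda> - A) S t\<close>.
\<close>

locale smoothing_semigroup =
  fixes S D :: "real \<Rightarrow> 'a::banach \<Rightarrow> 'a" and R :: "'a \<Rightarrow> 'a" and lam T C :: real
  assumes T_pos: "0 < T" and C_nonneg: "0 \<le> C"
    and S_linear: "0 \<le> t \<Longrightarrow> bounded_linear (S t)"
    and S_zero: "S 0 x = x"
    and S_add: "0 \<le> s \<Longrightarrow> 0 \<le> t \<Longrightarrow> S (s + t) x = S s (S t x)"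
    and S_cont: "continuous_on {0..} (\<lambda>t. S t x)"
    and S_bound: "0 \<le> t \<Longrightarrow> t \<le> T \<Longrightarrow> norm (S t x) \<le> C * norm x"
    and R_linear: "bounded_linear R"
    and R_eq_0: "R x = 0 \<Longrightarrow> x = 0"
    and S_R: "0 \<le> t \<Longrightarrow> S t (R x) = R (S t x)"
    and S_R_derivative: "0 < t \<Longrightarrow>
       ((\<lambda>t. S t (R x)) has_vector_derivative S t (lam *\<^sub>R R x - x)) (at t)"
    and S_eq_R_D: "0 < t \<Longrightarrow> S t x = R (D t x)"
    and D_bound: "0 < t \<Longrightarrow> t \<le> T \<Longrightarrow> norm (D t x) \<le> C / t * norm x"

section \<open>The resolvent of a generator\<close>

text \<open>
  Generators are defined by difference quotients; this form passes between those and derivatives.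
\<close>

lemma has_vector_derivative_quotient:
  "(f has_vector_derivative d) (at x within X) \<longleftrightarrow>
   ((\<lambda>y. (1 / (y - x)) *\<^sub>R (f y - f x)) \<longlongrightarrow> d) (at x within X)"
proof -
  have eq: "norm ((1 / norm (y - x)) *\<^sub>R (f y - (f x + (y - x) *\<^sub>R d)))
      = norm ((1 / (y - x)) *\<^sub>R (f y - f x) - d)" if "y \<noteq> x" for y
  proof -
    have "(1 / (y - x)) *\<^sub>R (f y - f x) - d = (1 / (y - x)) *\<^sub>R (f y - (f x + (y - x) *\<^sub>R d))"
      using that by (simp add: scaleR_diff_right scaleR_add_right)
    then show ?thesis by simp
  qed
  have "(f has_vector_derivative d) (at x within X) \<longleftrightarrow>
      ((\<lambda>y. norm ((1 / norm (y - x)) *\<^sub>R (f y - (f x + (y - x) *\<^sub>R d)))) \<longlongrightarrow> 0) (at x within X)"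
    unfolding has_vector_derivative_def has_derivative_within tendsto_norm_zero_iff
    by (simp add: bounded_linear_scaleR_left)
  also have "\<dots> \<longleftrightarrow> ((\<lambda>y. norm ((1 / (y - x)) *\<^sub>R (f y - f x) - d)) \<longlongrightarrow> 0) (at x within X)"
    by (rule tendsto_cong, unfold eventually_at_filter, rule always_eventually) (use eq in blast)
  also have "\<dots> \<longleftrightarrow> ((\<lambda>y. (1 / (y - x)) *\<^sub>R (f y - f x)) \<longlongrightarrow> d) (at x within X)"
    unfolding tendsto_norm_zero_iff LIM_zero_iff ..
  finally show ?thesis .
qed

lemma right_quotient_tendsto:
  assumes "(f has_vector_derivative d) (at_right 0)"
  shows "((\<lambda>h. (1 / h) *\<^sub>R (f h - f 0)) \<longlongrightarrow> d) (at_right (0::real))"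
  using assms unfolding has_vector_derivative_quotient by simp

lemma generator_unique:
  assumes "generates dmn A S" "((\<lambda>h. (1 / h) *\<^sub>R (S h x - x)) \<longlongrightarrow> y) (at_right 0)"
  shows "x \<in> dmn" "A x = y"
proof -
  show x: "x \<in> dmn" using assms by (auto simp: generates_def)
  then have "((\<lambda>h. (1 / h) *\<^sub>R (S h x - x)) \<longlongrightarrow> A x) (at_right 0)"
    using assms(1) by (auto simp: generates_def)
  from tendsto_unique[OF _ this assms(2)] show "A x = y" by simp
qed

lemma generator_limit:
  assumes "generates dmn A S" "x \<in> dmn"
  shows "((\<lambda>h. (1 / h) *\<^sub>R (S h x - x)) \<longlongrightarrow> A x) (at_right 0)"
  using assms by (auto simp: generates_def)

lemma generator_linear:
  assumes c0: "c0_semigroup J S" and gen: "generates dmn A S"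
  shows "subspace dmn"
    and "\<And>x y. x \<in> dmn \<Longrightarrow> y \<in> dmn \<Longrightarrow> A (x + y) = A x + A y"
    and "\<And>x c. x \<in> dmn \<Longrightarrow> A (c *\<^sub>R x) = c *\<^sub>R A x"
proof -
  have lin: "bounded_linear (S t)" if "0 \<le> t" for t using c0 that by (auto simp: c0_semigroup_def)
  have "((\<lambda>h. (1 / h) *\<^sub>R (S h (x + y) - (x + y))) \<longlongrightarrow> A x + A y) (at_right 0)"
    if "x \<in> dmn" "y \<in> dmn" for x y
  proof (rule Lim_transform_eventually[OF tendsto_add[OF that[THEN generator_limit[OF gen]]]])
    show "\<forall>\<^sub>F h in at_right 0. (1 / h) *\<^sub>R (S h x - x) + (1 / h) *\<^sub>R (S h y - y) = (1 / h) *\<^sub>R (S h (x + y) - (x + y))"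
      using eventually_at_right_less[of "0::real"]
      by eventually_elim (simp add: linear_simps(1)[OF lin] algebra_simps)
  qed
  note add = generator_unique[OF gen this]
  have "((\<lambda>h. (1 / h) *\<^sub>R (S h (c *\<^sub>R x) - c *\<^sub>R x)) \<longlongrightarrow> c *\<^sub>R A x) (at_right 0)"
    if "x \<in> dmn" for x c
  proof (rule Lim_transform_eventually[OF tendsto_scaleR[OF tendsto_const generator_limit[OF gen that]]])
    show "\<forall>\<^sub>F h in at_right 0. c *\<^sub>R (1 / h) *\<^sub>R (S h x - x) = (1 / h) *\<^sub>R (S h (c *\<^sub>R x) - c *\<^sub>R x)"
      using eventually_at_right_less[of "0::real"]
      by eventually_elim (simp add: linear_simps(5)[OF lin] algebra_simps)
  qed
  note scale = generator_unique[OF gen this]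
  have "((\<lambda>h. (1 / h) *\<^sub>R (S h 0 - 0)) \<longlongrightarrow> 0) (at_right 0)"
    by (rule Lim_transform_eventually[OF tendsto_const])
      (use eventually_at_right_less[of "0::real"] in \<open>eventually_elim, simp add: linear_simps(3)[OF lin]\<close>)
  from generator_unique(1)[OF gen this] have "0 \<in> dmn" .
  with add(1) scale(1) show "subspace dmn" by (simp add: subspace_def)
  show "A (x + y) = A x + A y" if "x \<in> dmn" "y \<in> dmn" for x y using add(2)[OF that] .
  show "A (c *\<^sub>R x) = c *\<^sub>R A x" if "x \<in> dmn" for x c using scale(2)[OF that] .
qed

lemma generator_commutes:
  assumes c0: "c0_semigroup J S" and gen: "generates dmn A S" and x: "x \<in> dmn" and t: "0 \<le> t"
  shows "S t x \<in> dmn" "A (S t x) = S t (A x)"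
proof -
  have lin: "bounded_linear (S t)" if "0 \<le> t" for t using c0 that by (auto simp: c0_semigroup_def)
  have add: "S (s + t) x = S s (S t x)" if "0 \<le> s" "0 \<le> t" for s t x using c0 that by (auto simp: c0_semigroup_def)
  have "((\<lambda>h. (1 / h) *\<^sub>R (S h (S t x) - S t x)) \<longlongrightarrow> S t (A x)) (at_right 0)"
  proof (rule Lim_transform_eventually[OF bounded_linear.tendsto[OF lin[OF t] generator_limit[OF gen x]]])
    show "\<forall>\<^sub>F h in at_right 0. S t ((1 / h) *\<^sub>R (S h x - x)) = (1 / h) *\<^sub>R (S h (S t x) - S t x)"
      using eventually_at_right_less[of "0::real"]
    proof eventually_elim
      case (elim h)
      have "S t (S h x) = S h (S t x)" using add[of t h x] add[of h t x] t elim by (simp add: add.commute)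
      then show ?case by (simp add: linear_simps(2,5)[OF lin[OF t]])
    qed
  qed
  from generator_unique[OF gen this] show "S t x \<in> dmn" "A (S t x) = S t (A x)" .
qed

lemma generator_derivative:
  assumes c0: "c0_semigroup J S" and gen: "generates dmn A S" and t: "0 \<le> t"
    and d: "((\<lambda>t. S t x) has_vector_derivative d) (at t)"
  shows "S t x \<in> dmn" "A (S t x) = d"
proof -
  have add: "S (s + t) x = S s (S t x)" if "0 \<le> s" "0 \<le> t" for s t x using c0 that by (auto simp: c0_semigroup_def)
  have "((\<lambda>h. t + h) has_vector_derivative 1) (at 0)" by (auto intro!: derivative_eq_intros)
  from vector_diff_chain_at[OF this, of "\<lambda>t. S t x" d] d
  have "((\<lambda>h. S (t + h) x) has_vector_derivative d) (at 0)" by (simp add: o_def)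
  from right_quotient_tendsto[OF has_vector_derivative_at_within[OF this]]
  have "((\<lambda>h. (1 / h) *\<^sub>R (S (t + h) x - S t x)) \<longlongrightarrow> d) (at_right 0)" by simp
  then have "((\<lambda>h. (1 / h) *\<^sub>R (S h (S t x) - S t x)) \<longlongrightarrow> d) (at_right 0)"
    by (rule Lim_transform_eventually)
      (use eventually_at_right_less[of "0::real"] in \<open>eventually_elim, use add[of _ t] t in \<open>simp add: add.commute\<close>\<close>)
  from generator_unique[OF gen this] show "S t x \<in> dmn" "A (S t x) = d" .
qed

text \<open>
  The truncated Laplace transform \<open>V x\<close> inverts \<open>\<lambda> - A\<close> up to the error \<open>e\<^bsup>- \<lambda> T\<^esup> S(T)\<close>. Truncation
  keeps all integrands continuous on a compact interval.
\<close>

lemma generator_laplace: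
  fixes S :: "real \<Rightarrow> 'a::banach \<Rightarrow> 'a" and lam :: real
  assumes c0: "c0_semigroup J S" and gen: "generates dmn A S" and T: "0 < T"
  defines "V \<equiv> \<lambda>x. integral {0..T} (\<lambda>t. exp (- lam * t) *\<^sub>R S t x)"
  shows "V x \<in> dmn" "A (V x) = lam *\<^sub>R V x + exp (- lam * T) *\<^sub>R S T x - x"
proof -
  have lin: "bounded_linear (S t)" if "0 \<le> t" for t using c0 that by (auto simp: c0_semigroup_def)
  have add: "S (s + t) x = S s (S t x)" if "0 \<le> s" "0 \<le> t" for s t x using c0 that by (auto simp: c0_semigroup_def)
  have S0: "S 0 x = x" for x using c0 by (auto simp: c0_semigroup_def)
  define \<phi> where "\<phi> s = exp (- lam * s) *\<^sub>R S s x" for s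
  have Scont: "continuous_on {0..b} (\<lambda>t. S t x)" for b
    using c0 by (auto simp: c0_semigroup_def intro: continuous_on_subset)
  have \<phi>: "continuous_on {0..b} \<phi>" for b unfolding \<phi>_def by (intro continuous_intros Scont)
  define P where "P h = integral {0..h} \<phi>" for h
  have dP: "(P has_vector_derivative \<phi> u) (at u within {0..b})" if "u \<in> {0..b}" for u b
    unfolding P_def by (rule integral_has_vector_derivative[OF \<phi> that])
  have Pdiff: "P b - P a = integral {a..b} \<phi>" if "0 \<le> a" "a \<le> b" for a b
    unfolding P_def using Henstock_Kurzweil_Integration.integral_combine[OF that integrable_continuous_interval[OF \<phi>]]
    by (simp add: algebra_simps)
  define W where "W h = exp (lam * h) *\<^sub>R (P (T + h) - P h)" for h
  have "((\<lambda>h. T + h) has_vector_derivative 1) (at 0 within {0..T})" by (auto intro!: derivative_eq_intros)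
  from vector_diff_chain_within[OF this, of P "\<phi> T"]
  have d1: "((\<lambda>h. P (T + h)) has_vector_derivative \<phi> T) (at 0 within {0..T})"
    using has_vector_derivative_within_subset[OF dP[of T "2 * T"], of "(\<lambda>h. T + h) ` {0..T}"] T
    by (auto simp: o_def)
  have d2: "(P has_vector_derivative \<phi> 0) (at 0 within {0..T})" using dP[of 0 T] T by simp
  have "((\<lambda>h. exp (lam * h)) has_real_derivative lam) (at 0 within {0..T})"
    by (auto intro!: derivative_eq_intros)
  from has_vector_derivative_scaleR[OF this has_vector_derivative_diff[OF d1 d2]]
  have "(W has_vector_derivative \<phi> T - \<phi> 0 + lam *\<^sub>R P T) (at 0 within {0..T})"
    unfolding W_def by (simp add: P_def)
  then have "(W has_vector_derivative \<phi> T - \<phi> 0 + lam *\<^sub>R P T) (at_right 0)"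
    using at_within_Icc_at_right[OF T] by simp
  note lim = right_quotient_tendsto[OF this]
  have \<phi>_eq: "\<phi> = (\<lambda>s. exp (- lam * s) *\<^sub>R S s x)" by (rule ext) (simp add: \<phi>_def)
  have VP: "V x = P T" unfolding V_def P_def \<phi>_eq ..
  have W0: "W 0 = V x" by (simp add: W_def VP) (simp add: P_def)
  have SW: "S h (V x) = W h" if "0 < h" for h
  proof -
    have "W h = exp (lam * h) *\<^sub>R integral {0..T} (\<phi> \<circ> (+) h)"
      unfolding W_def using Pdiff[of h "T + h"] that T integral_shift_Icc_real[of 0 T \<phi> h] by simp
    also have "\<dots> = integral {0..T} (\<lambda>s. exp (lam * h) *\<^sub>R \<phi> (h + s))"
      by (simp add: o_def)
    also have "\<dots> = integral {0..T} (\<lambda>s. S h (exp (- lam * s) *\<^sub>R S s x))"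
    proof (rule Henstock_Kurzweil_Integration.integral_cong)
      fix s assume s: "s \<in> {0..T}"
      have "exp (lam * h) * exp (- lam * (h + s)) = exp (- lam * s)"
        by (simp add: algebra_simps flip: exp_add)
      then show "exp (lam * h) *\<^sub>R \<phi> (h + s) = S h (exp (- lam * s) *\<^sub>R S s x)"
        using s that by (simp add: \<phi>_def add linear_simps(5)[OF lin])
    qed
    also have "\<dots> = S h (V x)"
      using integral_linear[OF integrable_continuous_interval[OF \<phi>[of T]] lin[of h]] that
      unfolding V_def \<phi>_eq o_def by simp
    finally show ?thesis by simp
  qed
  have "((\<lambda>h. (1 / h) *\<^sub>R (S h (V x) - V x)) \<longlongrightarrow> \<phi> T - \<phi> 0 + lam *\<^sub>R P T) (at_right 0)"
    by (rule Lim_transform_eventually[OF lim])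
      (use eventually_at_right_less[of "0::real"] in \<open>eventually_elim, simp add: SW W0\<close>)
  from generator_unique[OF gen this] show "V x \<in> dmn" "A (V x) = lam *\<^sub>R V x + exp (- lam * T) *\<^sub>R S T x - x"
    by (auto simp: VP \<phi>_def S0 algebra_simps)
qed

lemma contraction_perturbation:
  fixes E :: "'a::banach \<Rightarrow> 'a"
  assumes E: "bounded_linear E" "\<And>x. norm (E x) \<le> 1 / 2 * norm x"
  shows "\<exists>x. x - E x = y \<and> norm x \<le> 2 * norm y"
proof -
  interpret bounded_linear E by (rule E)
  have "\<exists>!x. y + E x = x"
    by (rule banach_fix_type[of "1/2"]) (use E(2) in \<open>auto simp: dist_norm simp flip: diff\<close>)
  then obtain x where x: "y + E x = x" by blast
  have "norm x \<le> norm y + norm (E x)" using norm_triangle_ineq[of y "E x"] x by simp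
  with E(2)[of x] have "norm x \<le> 2 * norm y" by linarith
  with x show ?thesis by (intro exI[of _ x]) (metis add_diff_cancel_right')
qed

text \<open>
  For \<open>\<lambda>\<close> with \<open>e\<^bsup>- \<lambda> T\<^esup> \<parallel>S(T)\<parallel> \<le> 1 / 2\<close> the error of the truncated Laplace transform is a
  contraction, so \<open>\<lambda> - A\<close> is onto. It is injective since \<open>A x = \<lambda> x\<close> forces
  \<open>S(T) x = e\<^bsup>\<lambda> T\<^esup> x\<close>. Thus \<open>\<lambda> - A\<close> is a bijection from the domain with bounded inverse \<open>R\<close>.
\<close>

lemma generator_smoothing_semigroup:
  fixes S :: "real \<Rightarrow> 'a::banach \<Rightarrow> 'a"
  assumes c0: "c0_semigroup J S" and gen: "generates dmn A S" and T: "0 < T"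
    and Cb: "0 \<le> Cb" "\<And>t x. 0 \<le> t \<Longrightarrow> t \<le> T \<Longrightarrow> norm (S t x) \<le> Cb * norm x"
    and Cd: "0 \<le> Cd" "\<And>t x. 0 < t \<Longrightarrow> \<exists>d. ((\<lambda>t. S t x) has_vector_derivative d) (at t) \<and>
       (t \<le> T \<longrightarrow> norm d \<le> Cd / t * norm x)"
  shows "\<exists>lam D R C. smoothing_semigroup S D R lam T C \<and> dmn = range R \<and> (\<forall>x. A (R x) = lam *\<^sub>R R x - x)"
proof -
  have lin: "bounded_linear (S t)" if "0 \<le> t" for t using c0 that by (auto simp: c0_semigroup_def)
  have add: "S (s + t) x = S s (S t x)" if "0 \<le> s" "0 \<le> t" for s t x using c0 that by (auto simp: c0_semigroup_def)
  have S0: "S 0 x = x" for x using c0 by (auto simp: c0_semigroup_def)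
  have Scont: "continuous_on {0..} (\<lambda>t. S t x)" for x using c0 by (auto simp: c0_semigroup_def)
  note dmn_linear = generator_linear[OF c0 gen]
  have dmn_diff: "x \<in> dmn \<Longrightarrow> y \<in> dmn \<Longrightarrow> x - y \<in> dmn" for x y using subspace_diff[OF dmn_linear(1)] .
  have Adiff: "A (x - y) = A x - A y" if "x \<in> dmn" "y \<in> dmn" for x y
    using dmn_linear(2)[OF dmn_diff[OF that] that(2)] by simp
  \<comment> \<open>chosen such that \<open>exp (- lam * T) = 1 / (2 * (Cb + 1))\<close>\<close>
  define lam where "lam = ln (2 * (Cb + 1)) / T"
  have lam: "lam > 0" using Cb T by (simp add: lam_def)
  define E where "E x = exp (- lam * T) *\<^sub>R S T x" for x
  have Elin: "bounded_linear E" unfolding E_def using lin[of T] T by (intro bounded_linear_const_scaleR) simp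
  have E_half: "norm (E x) \<le> 1 / 2 * norm x" for x
  proof -
    have "exp (- lam * T) = 1 / (2 * (Cb + 1))"
      using T Cb by (simp add: lam_def exp_minus inverse_eq_divide)
    then have "norm (E x) \<le> 1 / (2 * (Cb + 1)) * (Cb * norm x)"
      unfolding E_def using Cb(2)[of T x] T Cb(1) by (simp add: divide_right_mono)
    also have "\<dots> = Cb / (2 * (Cb + 1)) * norm x" by simp
    also have "\<dots> \<le> 1 / 2 * norm x" using Cb by (intro mult_right_mono) (auto simp: field_simps)
    finally show ?thesis .
  qed
  define V where "V x = integral {0..T} (\<lambda>t. exp (- lam * t) *\<^sub>R S t x)" for x
  have V: "V x \<in> dmn" "A (V x) = lam *\<^sub>R V x + E x - x" for x
    using generator_laplace[OF c0 gen T, where lam = lam and x = x] by (simp_all add: V_def E_def)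
  have Vbd: "norm (V x) \<le> (Cb * norm x) * (T - 0)" for x
    unfolding V_def
  proof (rule integral_bound)
    show "continuous_on {0..T} (\<lambda>t. exp (- lam * t) *\<^sub>R S t x)"
      by (intro continuous_intros continuous_on_subset[OF Scont]) auto
    fix t assume t: "t \<in> {0..T}"
    have "exp (- lam * t) \<le> 1" using lam t by simp
    then have "exp (- lam * t) * norm (S t x) \<le> 1 * (Cb * norm x)" using Cb t by (intro mult_mono) auto
    then show "norm (exp (- lam * t) *\<^sub>R S t x) \<le> Cb * norm x" by simp
  qed (use T in simp)
  have surj: "\<exists>x\<in>dmn. lam *\<^sub>R x - A x = y \<and> norm x \<le> (2 * Cb * T) * norm y" for y
  proof -
    obtain z where z: "z - E z = y" "norm z \<le> 2 * norm y" using contraction_perturbation[OF Elin E_half] by blast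
    have "norm (V z) \<le> (Cb * norm z) * T" using Vbd by simp
    also have "\<dots> \<le> (Cb * (2 * norm y)) * T" using z Cb T by (intro mult_right_mono mult_left_mono) auto
    finally have "norm (V z) \<le> (2 * Cb * T) * norm y" by (simp add: mult_ac)
    moreover have "lam *\<^sub>R V z - A (V z) = y" using V(2)[of z] z(1) by simp
    ultimately show ?thesis using V(1)[of z] by blast
  qed
  have derS: "((\<lambda>t. S t x) has_vector_derivative S t (A x)) (at t)" if xt: "x \<in> dmn" "0 < t" for x t
  proof -
    obtain d where d: "((\<lambda>t. S t x) has_vector_derivative d) (at t)" using Cd(2)[OF xt(2)] by blast
    have "d = S t (A x)"
      using generator_derivative(2)[OF c0 gen _ d] generator_commutes(2)[OF c0 gen xt(1), of t] xt by simp
    with d show ?thesis by simp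
  qed
  have inj: "x = 0" if x: "x \<in> dmn" "lam *\<^sub>R x - A x = 0" for x
  proof -
    define g where "g t = exp (- lam * t) *\<^sub>R S t x" for t
    have "((\<lambda>t. 0) has_integral g T - g 0) {0..T}"
    proof (rule fundamental_theorem_of_calculus_interior)
      show "continuous_on {0..T} g" unfolding g_def
        by (intro continuous_intros continuous_on_subset[OF Scont]) auto
      fix t assume "t \<in> {0<..<T}"
      then have t: "0 < t" by simp
      have "((\<lambda>t. exp (- lam * t)) has_real_derivative - lam * exp (- lam * t)) (at t)"
        by (auto intro!: derivative_eq_intros)
      from has_vector_derivative_scaleR[OF this derS[OF x(1) t]]
      have "(g has_vector_derivative exp (- lam * t) *\<^sub>R S t (A x) + (- lam * exp (- lam * t)) *\<^sub>R S t x) (at t)"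
        unfolding g_def .
      moreover have "A x = lam *\<^sub>R x" using x(2) by simp
      ultimately show "(g has_vector_derivative 0) (at t)"
        using t by (simp add: linear_simps(5)[OF lin] mult.commute)
    qed (use T in simp)
    then have "g T - g 0 = 0" using has_integral_unique[OF _ has_integral_0] by blast
    then have "E x = x" by (simp add: g_def E_def S0)
    with E_half[of x] show ?thesis by simp
  qed
  define R where "R y = (SOME x. x \<in> dmn \<and> lam *\<^sub>R x - A x = y \<and> norm x \<le> (2 * Cb * T) * norm y)" for y
  have R: "R y \<in> dmn" "lam *\<^sub>R R y - A (R y) = y" "norm (R y) \<le> (2 * Cb * T) * norm y" for y
    unfolding R_def using someI_ex[OF surj[of y, unfolded Bex_def]] by auto
  have Runique: "x = R y" if "x \<in> dmn" "lam *\<^sub>R x - A x = y" for x y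
  proof -
    have "lam *\<^sub>R (x - R y) - A (x - R y) = 0"
      using that R(2)[of y] by (simp add: Adiff[OF that(1) R(1)] algebra_simps)
    with inj[OF dmn_diff[OF that(1) R(1)]] show ?thesis by simp
  qed
  have AR: "A (R y) = lam *\<^sub>R R y - y" for y using R(2)[of y] by (simp add: algebra_simps)
  have Rlin: "bounded_linear R"
  proof (rule bounded_linear_intro)
    show "R (x + y) = R x + R y" for x y
      by (rule Runique[symmetric]) (auto simp: R(1) subspace_add[OF dmn_linear(1)] dmn_linear(2) AR algebra_simps)
    show "R (c *\<^sub>R x) = c *\<^sub>R R x" for c x
      by (rule Runique[symmetric]) (auto simp: R(1) subspace_scale[OF dmn_linear(1)] dmn_linear(3) AR algebra_simps)
    show "norm (R x) \<le> norm x * (2 * Cb * T)" for x using R(3)[of x] by (simp add: mult.commute)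
  qed
  have SR: "S t (R x) = R (S t x)" if "0 \<le> t" for t x
  proof (rule Runique)
    show "S t (R x) \<in> dmn" by (rule generator_commutes(1)[OF c0 gen R(1) that])
    show "lam *\<^sub>R S t (R x) - A (S t (R x)) = S t x"
      using generator_commutes(2)[OF c0 gen R(1) that] by (simp add: AR linear_simps(2,5)[OF lin[OF that]])
  qed
  define D where "D t x = lam *\<^sub>R S t x - A (S t x)" for t x
  define C where "C = Cb + lam * Cb * T + Cd"
  have C: "0 \<le> C" using Cb Cd lam T by (simp add: C_def)
  have smooth: "S t x \<in> dmn \<and> (t \<le> T \<longrightarrow> norm (A (S t x)) \<le> Cd / t * norm x)" if t: "0 < t" for t x
  proof -
    obtain d where "((\<lambda>t. S t x) has_vector_derivative d) (at t)" "t \<le> T \<longrightarrow> norm d \<le> Cd / t * norm x"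
      using Cd(2)[OF t] by blast
    then show ?thesis using generator_derivative[OF c0 gen, of t x d] t by simp
  qed
  have "smoothing_semigroup S D R lam T C"
  proof (rule smoothing_semigroup.intro)
    show "norm (S t x) \<le> C * norm x" if "0 \<le> t" "t \<le> T" for t x
    proof (rule order_trans[OF Cb(2)[OF that]])
      show "Cb * norm x \<le> C * norm x" using Cb(1) Cd(1) lam T by (intro mult_right_mono) (auto simp: C_def)
    qed
    show "x = 0" if "R x = 0" for x
    proof -
      have "A 0 = 0" using dmn_linear(3)[OF subspace_0[OF dmn_linear(1)], of 0] by simp
      then show ?thesis using R(2)[of x] that by simp
    qed
    show "((\<lambda>t. S t (R x)) has_vector_derivative S t (lam *\<^sub>R R x - x)) (at t)" if "0 < t" for t x
      using derS[OF R(1) that, of x] by (simp add: AR)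
    show "S t x = R (D t x)" if "0 < t" for t x
      by (rule Runique) (use smooth[OF that] in \<open>auto simp: D_def\<close>)
    show "norm (D t x) \<le> C / t * norm x" if t: "0 < t" "t \<le> T" for t x
    proof -
      have "norm (D t x) \<le> lam * norm (S t x) + norm (A (S t x))"
        unfolding D_def using norm_triangle_ineq4[of "lam *\<^sub>R S t x" "A (S t x)"] lam by simp
      also have "\<dots> \<le> lam * (Cb * norm x) + Cd / t * norm x"
        using Cb(2)[of t x] smooth[OF t(1), of x] t lam by (intro add_mono mult_left_mono) auto
      also have "lam * (Cb * norm x) \<le> lam * (Cb * norm x) * (T / t)"
        using mult_left_mono[of 1 "T / t" "lam * (Cb * norm x)"] t lam Cb(1) by simp
      also have "lam * (Cb * norm x) * (T / t) + Cd / t * norm x \<le> C / t * norm x"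
        using t Cb by (simp add: C_def field_simps)
      finally show ?thesis by simp
    qed
  qed (use T C lin S0 add Scont Rlin SR in auto)
  moreover have "dmn = range R" using Runique R(1) by blast
  ultimately show ?thesis using AR by blast
qed

section \<open>Duhamel integrals\<close>

lemma continuous_on_Ioc:
  fixes f :: "real \<Rightarrow> 'b::topological_space"
  assumes "\<And>c. 0 < c \<Longrightarrow> c \<le> T \<Longrightarrow> continuous_on {c..T} f"
  shows "continuous_on {0<..T} f"
  unfolding continuous_on_def
proof
  fix t assume t: "t \<in> {0<..T}"
  have "(f \<longlongrightarrow> f t) (at t within {t/2..T})"
    using assms[of "t/2"] t by (auto simp: continuous_on_def)
  moreover have "at t within {t/2..T} = at t within {0<..T}"
    by (rule at_within_nhd[of t "{t/2<..}"]) (use t in auto)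
  ultimately show "(f \<longlongrightarrow> f t) (at t within {0<..T})" by simp
qed

context smoothing_semigroup
begin

lemma R_inject: "R x = R y \<Longrightarrow> x = y"
  using R_eq_0[of "x - y"] linear_simps(2)[OF R_linear] by simp

lemma D_eqI: "0 < t \<Longrightarrow> S t x = R y \<Longrightarrow> D t x = y"
  by (rule R_inject) (simp flip: S_eq_R_D)

lemma S_D: "0 \<le> s \<Longrightarrow> 0 < t \<Longrightarrow> S s (D t x) = D (s + t) x"
  by (rule D_eqI[symmetric]) (simp_all add: S_add S_eq_R_D[of t] S_R)

lemma D_S: "0 < t \<Longrightarrow> 0 \<le> s \<Longrightarrow> D t (S s x) = D (t + s) x"
  by (rule D_eqI) (simp_all add: S_eq_R_D[symmetric] flip: S_add)

lemma D_linear: assumes "0 < t" "t \<le> T" shows "bounded_linear (D t)"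
proof (rule bounded_linear_intro)
  note S = linear_simps[OF S_linear[of t]] and R = linear_simps[OF R_linear]
  show "D t (x + y) = D t x + D t y" for x y
    by (rule D_eqI) (use assms S R in \<open>simp_all add: S_eq_R_D\<close>)
  show "D t (c *\<^sub>R x) = c *\<^sub>R D t x" for c x
    by (rule D_eqI) (use assms S R in \<open>simp_all add: S_eq_R_D\<close>)
  show "norm (D t x) \<le> norm x * (C / t)" for x
    using D_bound[OF assms, of x] by (simp add: mult.commute)
qed

lemma S_continuous_joint:
  fixes \<tau> :: "real \<Rightarrow> real"
  assumes \<tau>: "continuous_on I \<tau>" "\<And>s. s \<in> I \<Longrightarrow> 0 \<le> \<tau> s \<and> \<tau> s \<le> T" and y: "continuous_on I y"
  shows "continuous_on I (\<lambda>s. S (\<tau> s) (y s))"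
  unfolding continuous_on_def
proof
  fix s0 assume s0: "s0 \<in> I"
  have "continuous_on I (\<lambda>s. S (\<tau> s) (y s0))"
    by (rule continuous_on_compose2[OF S_cont \<tau>(1)]) (use \<tau>(2) in auto)
  then have 1: "((\<lambda>s. S (\<tau> s) (y s0)) \<longlongrightarrow> S (\<tau> s0) (y s0)) (at s0 within I)"
    using s0 by (simp add: continuous_on_def)
  have y0: "((\<lambda>s. y s - y s0) \<longlongrightarrow> 0) (at s0 within I)"
    using y s0 by (simp add: continuous_on_def LIM_zero)
  have 2: "((\<lambda>s. S (\<tau> s) (y s - y s0)) \<longlongrightarrow> 0) (at s0 within I)"
  proof (rule Lim_null_comparison)
    show "\<forall>\<^sub>F s in at s0 within I. norm (S (\<tau> s) (y s - y s0)) \<le> C * norm (y s - y s0)"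
      unfolding eventually_at_filter by (rule always_eventually) (use \<tau>(2) S_bound in blast)
    show "((\<lambda>s. C * norm (y s - y s0)) \<longlongrightarrow> 0) (at s0 within I)"
      using tendsto_mult_right_zero[OF tendsto_norm_zero[OF y0]] .
  qed
  show "((\<lambda>s. S (\<tau> s) (y s)) \<longlongrightarrow> S (\<tau> s0) (y s0)) (at s0 within I)"
  proof (rule Lim_transform_eventually)
    show "((\<lambda>s. S (\<tau> s) (y s - y s0) + S (\<tau> s) (y s0)) \<longlongrightarrow> S (\<tau> s0) (y s0)) (at s0 within I)"
      using tendsto_add[OF 2 1] by simp
    have "S (\<tau> s) (y s - y s0) + S (\<tau> s) (y s0) = S (\<tau> s) (y s)" if "s \<in> I" for s
      using linear_simps(2)[OF S_linear[of "\<tau> s"]] \<tau>(2)[OF that] by simp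
    then show "\<forall>\<^sub>F s in at s0 within I. S (\<tau> s) (y s - y s0) + S (\<tau> s) (y s0) = S (\<tau> s) (y s)"
      unfolding eventually_at_filter by (intro always_eventually) blast
  qed
qed

text \<open>
  Near \<open>s0\<close> one can split off the fixed smoothing time \<open>\<delta>\<close> and write \<open>D (\<tau> s) = S (\<tau> s - \<delta>) (D \<delta>)\<close>;
  the truncation at \<open>0\<close> only makes this expression meaningful away from \<open>s0\<close>.
\<close>

lemma D_continuous_joint:
  fixes \<tau> :: "real \<Rightarrow> real"
  assumes \<tau>: "continuous_on I \<tau>" "\<And>s. s \<in> I \<Longrightarrow> 0 < \<tau> s \<and> \<tau> s \<le> T" and y: "continuous_on I y"
  shows "continuous_on I (\<lambda>s. D (\<tau> s) (y s))"
  unfolding continuous_on_def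
proof
  fix s0 assume s0: "s0 \<in> I"
  define \<delta> where "\<delta> = \<tau> s0 / 2"
  have \<delta>: "0 < \<delta>" "\<delta> \<le> T" "\<delta> < \<tau> s0" using \<tau>(2)[OF s0] by (auto simp: \<delta>_def)
  define g where "g s = S (max 0 (\<tau> s - \<delta>)) (D \<delta> (y s))" for s
  have g_eq: "g s = D (\<tau> s) (y s)" if "\<delta> \<le> \<tau> s" for s
    using that S_D[of "\<tau> s - \<delta>" \<delta>] \<delta> by (simp add: g_def)
  have "continuous_on I g"
    unfolding g_def
  proof (rule S_continuous_joint)
    show "continuous_on I (\<lambda>s. max 0 (\<tau> s - \<delta>))" by (intro continuous_intros \<tau>)
    show "0 \<le> max 0 (\<tau> s - \<delta>) \<and> max 0 (\<tau> s - \<delta>) \<le> T" if "s \<in> I" for s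
      using \<tau>(2)[OF that] \<delta> by auto
    show "continuous_on I (\<lambda>s. D \<delta> (y s))"
      by (rule bounded_linear.continuous_on[OF D_linear[OF \<delta>(1,2)] y])
  qed
  then have "(g \<longlongrightarrow> g s0) (at s0 within I)" using s0 unfolding continuous_on_def by blast
  then have lim: "(g \<longlongrightarrow> D (\<tau> s0) (y s0)) (at s0 within I)"
    unfolding g_eq[OF less_imp_le[OF \<delta>(3)]] .
  have "(\<tau> \<longlongrightarrow> \<tau> s0) (at s0 within I)" using \<tau>(1) s0 by (simp add: continuous_on_def)
  from order_tendstoD(1)[OF this \<delta>(3)]
  have "\<forall>\<^sub>F s in at s0 within I. g s = D (\<tau> s) (y s)"
    by eventually_elim (simp add: g_eq)
  with lim show "((\<lambda>s. D (\<tau> s) (y s)) \<longlongrightarrow> D (\<tau> s0) (y s0)) (at s0 within I)"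
    by (rule Lim_transform_eventually)
qed

lemma S_derivative:
  assumes t: "0 < t"
  shows "((\<lambda>t. S t x) has_vector_derivative lam *\<^sub>R S t x - D t x) (at t)"
proof -
  define r where "r = t / 2"
  have r: "0 < r" "0 < t - r" using t by (auto simp: r_def)
  have "((\<lambda>u. u - r) has_vector_derivative 1) (at t)" by (auto intro!: derivative_eq_intros)
  from vector_diff_chain_at[OF this S_R_derivative[OF r(2), of "D r x"]]
  have "((\<lambda>u. S (u - r) (R (D r x))) has_vector_derivative S (t - r) (lam *\<^sub>R R (D r x) - D r x)) (at t)"
    by (simp add: o_def)
  moreover have "S (t - r) (lam *\<^sub>R R (D r x) - D r x) = lam *\<^sub>R S t x - D t x"
    using r linear_simps(2,5)[OF S_linear[of "t - r"]] S_D[of "t - r" r x]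
    by (simp flip: S_eq_R_D S_add)
  ultimately have "((\<lambda>u. S (u - r) (R (D r x))) has_vector_derivative lam *\<^sub>R S t x - D t x) (at t)" by simp
  then show ?thesis
  proof (rule has_vector_derivative_transform_within_open[of _ _ _ "{r<..}"])
    show "S (u - r) (R (D r x)) = S u x" if "u \<in> {r<..}" for u
      using that r S_add[of "u - r" r x] by (simp add: S_eq_R_D)
  qed (use r in auto)
qed

lemma S_R_integral:
  assumes h: "0 \<le> h"
  shows "((\<lambda>s. S s (lam *\<^sub>R R x - x)) has_integral S h (R x) - R x) {0..h}"
proof -
  have "((\<lambda>s. S s (lam *\<^sub>R R x - x)) has_integral S h (R x) - S 0 (R x)) {0..h}"
  proof (rule fundamental_theorem_of_calculus_interior[OF h])
    show "continuous_on {0..h} (\<lambda>t. S t (R x))" by (rule continuous_on_subset[OF S_cont]) auto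
    show "((\<lambda>t. S t (R x)) has_vector_derivative S t (lam *\<^sub>R R x - x)) (at t)" if "t \<in> {0<..<h}" for t
      using S_R_derivative that by simp
  qed
  then show ?thesis by (simp add: S_zero)
qed

lemma S_R_increment:
  assumes h: "0 \<le> h" and e: "\<And>s. 0 \<le> s \<Longrightarrow> s \<le> h \<Longrightarrow> norm (S s (lam *\<^sub>R R x - x) - y) \<le> e"
  shows "norm (S h (R x) - R x - h *\<^sub>R y) \<le> e * h"
proof -
  have "((\<lambda>s. S s (lam *\<^sub>R R x - x) - y) has_integral (S h (R x) - R x) - h *\<^sub>R y) {0..h}"
    using has_integral_diff[OF S_R_integral[OF h] has_integral_const_real[of y 0 h]] h by simp
  from integral_unique[OF this]
  have "S h (R x) - R x - h *\<^sub>R y = integral {0..h} (\<lambda>s. S s (lam *\<^sub>R R x - x) - y)" by simp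
  also have "norm \<dots> \<le> e * (h - 0)"
    by (rule integral_bound[OF h])
      (use e in \<open>auto intro!: continuous_intros continuous_on_subset[OF S_cont]\<close>)
  finally show ?thesis by simp
qed

text \<open>
  The derivative of \<open>S (t - s) (w s)\<close> in \<open>s\<close> is \<open>S (t - s) (g s)\<close>. The fundamental theorem needs
  this on the open interval, together with continuity up to \<open>s = 0\<close>; the integrability of the
  right-hand side is part of what it yields.
\<close>

lemma variation_of_constants:
  assumes w: "continuous_on {0..T} w"
    and w_dom: "\<And>t. t \<in> {0<..T} \<Longrightarrow> w t = R (\<omega> t)"
    and w_der: "\<And>t. t \<in> {0<..T} \<Longrightarrow>
        (w has_vector_derivative (lam *\<^sub>R w t - \<omega> t + g t)) (at t within {0<..T})"
    and t: "t \<in> {0<..T}"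
  shows "((\<lambda>s. S (t - s) (g s)) has_integral (w t - S t (w 0))) {0..t}"
proof -
  have "((\<lambda>s. S (t - s) (g s)) has_integral S (t - t) (w t) - S (t - 0) (w 0)) {0..t}"
  proof (rule fundamental_theorem_of_calculus_interior)
    show "continuous_on {0..t} (\<lambda>s. S (t - s) (w s))"
    proof (rule S_continuous_joint)
      show "continuous_on {0..t} w" by (rule continuous_on_subset[OF w]) (use t in auto)
    qed (use t in \<open>auto intro!: continuous_intros\<close>)
    fix s assume s: "s \<in> {0<..<t}"
    define d where "d = lam *\<^sub>R w s - \<omega> s + g s"
    have "(w has_vector_derivative d) (at s within {0<..<t})"
      unfolding d_def by (rule has_vector_derivative_within_subset[OF w_der]) (use s t in auto)
    then have wd: "(w has_vector_derivative d) (at s)"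
      using s at_within_open[of s "{0<..<t}"] by simp
    \<comment> \<open>difference quotient of \<open>w\<close> at \<open>s\<close>, made continuous by its limit\<close>
    define Q where "Q r = (if r = s then d else (1 / (r - s)) *\<^sub>R (w r - w s))" for r
    have "Q \<midarrow>s\<rightarrow> d"
      using wd unfolding has_vector_derivative_quotient
      by (rule Lim_transform_eventually) (auto simp: eventually_at_filter Q_def)
    then have Q_s: "isCont Q s" by (simp add: isCont_def Q_def)
    have wcont: "continuous_on {0<..<t} w" by (rule continuous_on_subset[OF w]) (use t in auto)
    have Q_cont: "continuous_on {0<..<t} Q"
      unfolding continuous_on_eq_continuous_at[OF open_greaterThanLessThan]
    proof
      fix r assume r: "r \<in> {0<..<t}"
      show "isCont Q r"
      proof (cases "r = s")
        case False
        have "isCont w r" using wcont r by (simp add: continuous_on_eq_continuous_at)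
        then have "isCont (\<lambda>r. (1 / (r - s)) *\<^sub>R (w r - w s)) r"
          using False by (intro continuous_intros) auto
        moreover have "\<forall>\<^sub>F u in nhds r. (1 / (u - s)) *\<^sub>R (w u - w s) = Q u"
          using t1_space_nhds[OF False] by (rule eventually_mono) (simp add: Q_def)
        ultimately show ?thesis using isCont_cong by fast
      qed (simp add: Q_s)
    qed
    have "continuous_on {0<..<t} (\<lambda>r. S (t - r) (Q r))"
      by (rule S_continuous_joint) (use t Q_cont in \<open>auto intro!: continuous_intros\<close>)
    then have "isCont (\<lambda>r. S (t - r) (Q r)) s"
      using s by (simp add: continuous_on_eq_continuous_at)
    then have 1: "(\<lambda>r. S (t - r) (Q r)) \<midarrow>s\<rightarrow> S (t - s) d" by (simp add: isCont_def Q_def)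
    have ws: "w s = R (\<omega> s)" using w_dom[of s] s t by simp
    have "((\<lambda>r. t - r) has_vector_derivative - 1) (at s)" by (auto intro!: derivative_eq_intros)
    from vector_diff_chain_at[OF this S_R_derivative[of "t - s" "\<omega> s"]] s
    have "((\<lambda>r. S (t - r) (w s)) has_vector_derivative - S (t - s) (lam *\<^sub>R w s - \<omega> s)) (at s)"
      by (simp add: o_def ws)
    then have 2: "(\<lambda>r. (1 / (r - s)) *\<^sub>R (S (t - r) (w s) - S (t - s) (w s))) \<midarrow>s\<rightarrow> - S (t - s) (lam *\<^sub>R w s - \<omega> s)"
      by (simp add: has_vector_derivative_quotient)
    have "S (t - s) d + - S (t - s) (lam *\<^sub>R w s - \<omega> s) = S (t - s) (g s)"
      using linear_simps(1)[OF S_linear[of "t - s"], of "lam *\<^sub>R w s - \<omega> s" "g s"] s by (simp add: d_def)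
    with tendsto_add[OF 1 2]
    have lim: "(\<lambda>r. S (t - r) (Q r) + (1 / (r - s)) *\<^sub>R (S (t - r) (w s) - S (t - s) (w s))) \<midarrow>s\<rightarrow> S (t - s) (g s)"
      by simp
    show "((\<lambda>s. S (t - s) (w s)) has_vector_derivative S (t - s) (g s)) (at s)"
      unfolding has_vector_derivative_quotient
    proof (rule Lim_transform_eventually[OF lim])
      have "\<forall>\<^sub>F r in at s. r \<in> {0<..<t}"
        using s by (intro eventually_at_in_open') auto
      moreover have "\<forall>\<^sub>F r in at s. r \<noteq> s" by (simp add: eventually_at_filter)
      ultimately show "\<forall>\<^sub>F r in at s. S (t - r) (Q r) + (1 / (r - s)) *\<^sub>R (S (t - r) (w s) - S (t - s) (w s))
         = (1 / (r - s)) *\<^sub>R (S (t - r) (w r) - S (t - s) (w s))"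
      proof eventually_elim
        case (elim r)
        note L = linear_simps[OF S_linear[of "t - r"]]
        have "S (t - r) (Q r) = (1 / (r - s)) *\<^sub>R (S (t - r) (w r) - S (t - r) (w s))"
          using elim L(2,5) by (simp add: Q_def)
        then show ?case by (simp flip: scaleR_add_right)
      qed
    qed
  qed (use t in auto)
  then show ?thesis by (simp add: S_zero)
qed

end

text \<open>
  The exponents \<open>\<gamma>\<close> and \<open>\<nu>\<close> are those of a forcing of weight \<open>\<nu>\<close> with values in \<open>E\<^sub>\<gamma>\<close>. All that
  matters of \<open>E\<^sub>\<gamma>\<close> is that \<open>D t\<close> maps it to \<open>E0\<close> with a norm of order \<open>t\<^bsup>\<gamma> - 1\<^esup>\<close>, and this is built
  into the notion of forcing.
\<close>

locale smoothing_duhamel = smoothing_semigroup S D R lam T C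
  for S D :: "real \<Rightarrow> 'a::banach \<Rightarrow> 'a" and R :: "'a \<Rightarrow> 'a" and lam T C :: real +
  fixes \<gamma> \<nu> :: real
  assumes params: "0 < \<gamma>" "\<gamma> \<le> 1" "0 \<le> \<nu>" "\<nu> < 1"
begin

definition forcing :: "real \<Rightarrow> (real \<Rightarrow> 'a) \<Rightarrow> bool" where
  "forcing q g \<longleftrightarrow> 0 \<le> q \<and> continuous_on {0<..T} g \<and>
     (\<forall>s\<in>{0<..T}. norm (g s) \<le> q * s powr (- \<nu>) \<and>
        (\<forall>t\<in>{0<..T}. norm (D t (g s)) \<le> q * (t powr (\<gamma> - 1) * s powr (- \<nu>))))"

definition duhamel :: "(real \<Rightarrow> 'a) \<Rightarrow> real \<Rightarrow> 'a" where
  "duhamel g t = integral {0..t} (\<lambda>s. S (t - s) (g s))"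

text \<open>
  The preimage of the Duhamel integral under \<open>R\<close>; its norm is the \<open>E1\<close>-norm of the Duhamel integral.
\<close>

definition smoothed_duhamel :: "(real \<Rightarrow> 'a) \<Rightarrow> real \<Rightarrow> 'a" where
  "smoothed_duhamel g t = integral {0..t} (\<lambda>s. D (t - s) (g s))"

text \<open>
  Bounds of the Beta integrals \<open>\<integral> s\<^bsup>- \<nu>\<^esup> ds\<close> and \<open>\<integral> (t - s)\<^bsup>\<gamma> - 1\<^esup> s\<^bsup>- \<nu>\<^esup> ds\<close> over \<open>[0, t]\<close>, up to the powers of \<open>t\<close>.
\<close>

definition k1 :: real where "k1 = 2 / (1 - \<nu>) + 2"
definition k2 :: real where "k2 = 2 / (1 - \<nu>) + 2 / \<gamma>"

lemma k_nonneg: "0 \<le> k1" "0 \<le> k2"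
  using params by (auto simp: k1_def k2_def)

lemma forcingD:
  assumes "forcing q g"
  shows "0 \<le> q" "continuous_on {0<..T} g"
    "\<And>s. 0 < s \<Longrightarrow> s \<le> T \<Longrightarrow> norm (g s) \<le> q * s powr (- \<nu>)"
    "\<And>s t. 0 < s \<Longrightarrow> s \<le> T \<Longrightarrow> 0 < t \<Longrightarrow> t \<le> T \<Longrightarrow> norm (D t (g s)) \<le> q * (t powr (\<gamma> - 1) * s powr (- \<nu>))"
  using assms by (auto simp: forcing_def)

lemma duhamel_integrand_continuous:
  assumes g: "forcing q g" and t: "t \<le> T"
  shows "continuous_on {0<..t} (\<lambda>s. S (t - s) (g s))"
proof (rule S_continuous_joint)
  show "continuous_on {0<..t} g" by (rule continuous_on_subset[OF forcingD(2)[OF g]]) (use t in auto)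
qed (use t in \<open>auto intro!: continuous_intros\<close>)

lemma smoothed_integrand_continuous:
  assumes g: "forcing q g" and t: "t \<le> T"
  shows "continuous_on {0<..<t} (\<lambda>s. D (t - s) (g s))"
proof (rule D_continuous_joint)
  show "continuous_on {0<..<t} g" by (rule continuous_on_subset[OF forcingD(2)[OF g]]) (use t in auto)
qed (use t in \<open>auto intro!: continuous_intros\<close>)

lemma
  assumes g: "forcing q g" and t: "0 < t" "t \<le> T"
  shows duhamel_integrable: "(\<lambda>s. S (t - s) (g s)) integrable_on {0..t}"
    and duhamel_bound: "norm (duhamel g t) \<le> C * q * (k1 * t powr (1 - \<nu>))"
    and smoothed_integrable: "(\<lambda>s. D (t - s) (g s)) integrable_on {0..t}"
    and smoothed_bound: "norm (smoothed_duhamel g t) \<le> q * (k2 * t powr (\<gamma> - \<nu>))"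
proof -
  have c: "continuous_on {0<..<t} (\<lambda>s. S (t - s) (g s))"
    by (rule continuous_on_subset[OF duhamel_integrand_continuous[OF g t(2)]]) auto
  have bd: "norm (S (t - s) (g s)) \<le> C * q * ((t - s) powr (1 - 1) * s powr (- \<nu>))" if "0 < s" "s < t" for s
  proof -
    have "norm (S (t - s) (g s)) \<le> C * norm (g s)" using S_bound[of "t - s"] that t by simp
    also have "\<dots> \<le> C * (q * s powr (- \<nu>))" using forcingD(3)[OF g, of s] that t C_nonneg by (intro mult_left_mono) auto
    finally show ?thesis using that by simp
  qed
  have Cq: "0 \<le> C * q" using C_nonneg forcingD(1)[OF g] by simp
  have "0 < (1::real)" "(1::real) \<le> 1" by simp_all
  from weakly_singular_integral[OF t(1) c this params(3,4) Cq bd]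
  show "(\<lambda>s. S (t - s) (g s)) integrable_on {0..t}" "norm (duhamel g t) \<le> C * q * (k1 * t powr (1 - \<nu>))"
    by (simp_all add: duhamel_def k1_def)
  have "norm (D (t - s) (g s)) \<le> q * ((t - s) powr (\<gamma> - 1) * s powr (- \<nu>))" if "0 < s" "s < t" for s
    using forcingD(4)[OF g, of s "t - s"] that t by simp
  from weakly_singular_integral[OF t(1) smoothed_integrand_continuous[OF g t(2)] params forcingD(1)[OF g] this]
  show "(\<lambda>s. D (t - s) (g s)) integrable_on {0..t}" "norm (smoothed_duhamel g t) \<le> q * (k2 * t powr (\<gamma> - \<nu>))"
    by (simp_all add: smoothed_duhamel_def k2_def)
qed

lemma duhamel_eq_R:
  assumes g: "forcing q g" and t: "0 < t" "t \<le> T"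
  shows "duhamel g t = R (smoothed_duhamel g t)"
proof -
  have "R (smoothed_duhamel g t) = integral {0..t} (\<lambda>s. R (D (t - s) (g s)))"
    using integral_linear[OF smoothed_integrable[OF g t] R_linear] by (simp add: smoothed_duhamel_def o_def)
  also have "\<dots> = duhamel g t"
    unfolding duhamel_def
    \<comment> \<open>at \<open>s = t\<close> the factorisation fails, since \<open>S 0\<close> is the identity\<close>
    by (rule integral_spike[of "{t}"]) (auto simp: S_eq_R_D)
  finally show ?thesis by simp
qed

lemma
  assumes g: "forcing q g" and rt: "0 < r" "r < t" "t \<le> T"
  shows duhamel_split: "duhamel g t = S (t - r) (duhamel g r) + integral {r..t} (\<lambda>s. S (t - s) (g s))"
    and smoothed_split: "smoothed_duhamel g t = D (t - r) (duhamel g r) + integral {r..t} (\<lambda>s. D (t - s) (g s))"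
proof -
  have t: "0 < t" and r: "r \<le> T" using rt by auto
  have "integral {0..r} (\<lambda>s. S (t - s) (g s)) = integral {0..r} (\<lambda>s. S (t - r) (S (r - s) (g s)))"
    by (rule Henstock_Kurzweil_Integration.integral_cong) (use rt in \<open>simp flip: S_add\<close>)
  also have "\<dots> = S (t - r) (duhamel g r)"
    using integral_linear[OF duhamel_integrable[OF g rt(1) r] S_linear[of "t - r"]] rt
    by (simp add: duhamel_def o_def)
  finally show "duhamel g t = S (t - r) (duhamel g r) + integral {r..t} (\<lambda>s. S (t - s) (g s))"
    using Henstock_Kurzweil_Integration.integral_combine[OF _ _ duhamel_integrable[OF g t rt(3)], of r] rt
    by (simp add: duhamel_def)
  have "integral {0..r} (\<lambda>s. D (t - s) (g s)) = integral {0..r} (\<lambda>s. D (t - r) (S (r - s) (g s)))"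
    by (rule Henstock_Kurzweil_Integration.integral_cong) (use rt in \<open>simp add: D_S\<close>)
  also have "\<dots> = D (t - r) (duhamel g r)"
    using integral_linear[OF duhamel_integrable[OF g rt(1) r] D_linear[of "t - r"]] rt
    by (simp add: duhamel_def o_def)
  finally show "smoothed_duhamel g t = D (t - r) (duhamel g r) + integral {r..t} (\<lambda>s. D (t - s) (g s))"
    using Henstock_Kurzweil_Integration.integral_combine[OF _ _ smoothed_integrable[OF g t rt(3)], of r] rt
    by (simp add: smoothed_duhamel_def)
qed

text \<open>
  Away from \<open>0\<close> the Duhamel integral is even Lipschitz with values in \<open>E0\<close>, because it is bounded in
  \<open>E1\<close> there and the semigroup is Lipschitz on bounded subsets of \<open>E1\<close>.
\<close>

lemma duhamel_continuous_interior:
  assumes g: "forcing q g"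
  shows "continuous_on {0<..T} (duhamel g)"
proof -
  note q = forcingD(1)[OF g]
  have cont: "continuous_on {c..T} (duhamel g)" if c: "0 < c" "c \<le> T" for c
  proof -
    have L: "norm (R x) \<le> norm x * onorm R" for x
      using onorm[OF R_linear, of x] by (simp add: mult.commute)
    define B where "B = q * (k2 * (c powr (\<gamma> - \<nu>) + T powr (\<gamma> - \<nu>)))"
    define K where "K = C * (\<bar>lam\<bar> * (B * onorm R) + B) + C * (q * c powr (- \<nu>))"
    have B0: "0 \<le> B" using q k_nonneg by (simp add: B_def)
    have onR: "0 \<le> onorm R" by (rule onorm_pos_le[OF R_linear])
    have K0: "0 \<le> K" unfolding K_def using B0 onR C_nonneg q by (intro add_nonneg_nonneg mult_nonneg_nonneg) auto
    have est: "norm (duhamel g t - duhamel g r) \<le> K * (t - r)" if rt: "c \<le> r" "r < t" "t \<le> T" for r t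
    proof -
      have r: "0 < r" "r \<le> T" using rt c by auto
      define v where "v = smoothed_duhamel g r"
      have "r powr (\<gamma> - \<nu>) \<le> c powr (\<gamma> - \<nu>) + T powr (\<gamma> - \<nu>)"
      proof (cases "0 \<le> \<gamma> - \<nu>")
        case True
        then have "r powr (\<gamma> - \<nu>) \<le> T powr (\<gamma> - \<nu>)" using r by (intro powr_mono2) auto
        then show ?thesis by (simp add: add_increasing)
      next
        case False
        then have "r powr (\<gamma> - \<nu>) \<le> c powr (\<gamma> - \<nu>)" using r rt c by (intro powr_mono2') auto
        then show ?thesis by (simp add: add_increasing2)
      qed
      then have "q * (k2 * r powr (\<gamma> - \<nu>)) \<le> B"
        unfolding B_def using q k_nonneg by (intro mult_left_mono) auto
      then have v: "norm v \<le> B" using smoothed_bound[OF g r] by (simp add: v_def)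
      have "norm (lam *\<^sub>R R v - v) \<le> \<bar>lam\<bar> * norm (R v) + norm v"
        using norm_triangle_ineq4[of "lam *\<^sub>R R v" v] by simp
      also have "\<dots> \<le> \<bar>lam\<bar> * (B * onorm R) + B"
        using v onR by (intro add_mono mult_left_mono order_trans[OF L mult_right_mono]) auto
      finally have lv: "norm (lam *\<^sub>R R v - v) \<le> \<bar>lam\<bar> * (B * onorm R) + B" .
      have "norm (S (t - r) (R v) - R v - (t - r) *\<^sub>R 0) \<le> (C * (\<bar>lam\<bar> * (B * onorm R) + B)) * (t - r)"
      proof (rule S_R_increment)
        fix s assume s: "0 \<le> s" "s \<le> t - r"
        then have "s \<le> T" using r rt by linarith
        from order_trans[OF S_bound[OF s(1) this] mult_left_mono[OF lv C_nonneg]]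
        show "norm (S s (lam *\<^sub>R R v - v) - 0) \<le> C * (\<bar>lam\<bar> * (B * onorm R) + B)" by simp
      qed (use rt in simp)
      then have 1: "norm (S (t - r) (duhamel g r) - duhamel g r) \<le> (C * (\<bar>lam\<bar> * (B * onorm R) + B)) * (t - r)"
        by (simp add: duhamel_eq_R[OF g r] v_def)
      have 2: "norm (integral {r..t} (\<lambda>s. S (t - s) (g s))) \<le> (C * (q * c powr (- \<nu>))) * (t - r)"
      proof (rule integral_bound)
        show "continuous_on {r..t} (\<lambda>s. S (t - s) (g s))"
          by (rule continuous_on_subset[OF duhamel_integrand_continuous[OF g rt(3)]]) (use r in auto)
        fix s assume s: "s \<in> {r..t}"
        have "norm (g s) \<le> q * s powr (- \<nu>)" using forcingD(3)[OF g, of s] s r rt by simp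
        also have "\<dots> \<le> q * c powr (- \<nu>)"
          using s rt c q params by (intro mult_left_mono powr_mono2') auto
        finally have "C * norm (g s) \<le> C * (q * c powr (- \<nu>))" using C_nonneg by (rule mult_left_mono)
        moreover have "norm (S (t - s) (g s)) \<le> C * norm (g s)" using S_bound[of "t - s"] s rt r by simp
        ultimately show "norm (S (t - s) (g s)) \<le> C * (q * c powr (- \<nu>))" by linarith
      qed (use rt in simp)
      have eq: "duhamel g t - duhamel g r = (S (t - r) (duhamel g r) - duhamel g r) + integral {r..t} (\<lambda>s. S (t - s) (g s))"
        using duhamel_split[OF g r(1) rt(2,3)] by simp
      have "norm (duhamel g t - duhamel g r) \<le> (C * (\<bar>lam\<bar> * (B * onorm R) + B)) * (t - r) + (C * (q * c powr (- \<nu>))) * (t - r)"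
        unfolding eq by (rule norm_triangle_le[OF add_mono[OF 1 2]])
      then show ?thesis by (simp only: K_def distrib_right)
    qed
    have "K-lipschitz_on {c..T} (duhamel g)"
    proof (rule lipschitz_onI[OF _ K0])
      fix x y assume xy: "x \<in> {c..T}" "y \<in> {c..T}"
      consider "x < y" | "x = y" | "y < x" by linarith
      then show "dist (duhamel g x) (duhamel g y) \<le> K * dist x y"
      proof cases
        case 1 then show ?thesis using est[of x y] xy by (simp add: dist_norm norm_minus_commute)
      next
        case 3 then show ?thesis using est[of y x] xy by (simp add: dist_norm)
      qed simp
    qed
    then show ?thesis by (rule lipschitz_on_continuous_on)
  qed
  then show ?thesis by (rule continuous_on_Ioc)
qed

text \<open>
  Cutting off the last \<open>\<epsilon>\<close> of the integral leaves \<open>D \<epsilon> (duhamel g (t - \<epsilon>))\<close>, which is continuous in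
  \<open>t\<close>. The part cut off is of order \<open>\<epsilon>\<^bsup>\<gamma>\<^esup>\<close>, uniformly for \<open>t\<close> away from \<open>0\<close>.
\<close>

lemma smoothed_duhamel_continuous:
  assumes g: "forcing q g"
  shows "continuous_on {0<..T} (smoothed_duhamel g)"
proof -
  note q = forcingD(1)[OF g]
  have cont: "continuous_on {c..T} (smoothed_duhamel g)" if c: "0 < c" "c \<le> T" for c
  proof (rule uniform_limit_theorem)
    define f where "f \<epsilon> t = D \<epsilon> (duhamel g (t - \<epsilon>))" for \<epsilon> t
    have ev: "\<forall>\<^sub>F \<epsilon> in at_right (0::real). 0 < \<epsilon> \<and> \<epsilon> < c / 2"
      using c by (auto simp: eventually_at_right intro!: exI[of _ "c / 2"])
    show "\<forall>\<^sub>F \<epsilon> in at_right 0. continuous_on {c..T} (f \<epsilon>)"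
      using ev
    proof eventually_elim
      case (elim \<epsilon>)
      have cd: "continuous_on {c..T} (\<lambda>t. duhamel g (t - \<epsilon>))"
        by (rule continuous_on_compose2[OF duhamel_continuous_interior[OF g]])
          (use elim in \<open>auto intro!: continuous_intros\<close>)
      have "bounded_linear (D \<epsilon>)" by (rule D_linear) (use elim c in auto)
      from bounded_linear.continuous_on[OF this cd] show ?case unfolding f_def .
    qed
    have lim: "((\<lambda>\<epsilon>. q * (c / 2) powr (- \<nu>) * (\<epsilon> powr \<gamma> / \<gamma>)) \<longlongrightarrow> 0) (at_right 0)"
    proof -
      have "((\<lambda>\<epsilon>::real. \<epsilon> powr \<gamma>) \<longlongrightarrow> 0) (at_right 0)"
      proof (rule tendsto_zero_powrI[OF tendsto_ident_at tendsto_const])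
        show "\<forall>\<^sub>F x in at_right (0::real). 0 \<le> x" using eventually_at_right_less[of "0::real"] by eventually_elim simp
      qed (use params in auto)
      from tendsto_mult_right_zero[OF tendsto_divide_zero[OF this]] show ?thesis by simp
    qed
    show "uniform_limit {c..T} f (smoothed_duhamel g) (at_right 0)"
    proof (rule uniform_limitI)
      fix e :: real assume "e > 0"
      from order_tendstoD(2)[OF lim this] ev
      show "\<forall>\<^sub>F \<epsilon> in at_right 0. \<forall>t\<in>{c..T}. dist (f \<epsilon> t) (smoothed_duhamel g t) < e"
      proof eventually_elim
        case (elim \<epsilon>)
        show ?case
        proof
          fix t assume t: "t \<in> {c..T}"
          have r: "0 < t - \<epsilon>" "t - \<epsilon> < t" "t \<le> T" "t - \<epsilon> \<le> T" using t elim by auto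
          have "norm (integral {t - \<epsilon>..t} (\<lambda>s. D (t - s) (g s))) \<le> q * (c / 2) powr (- \<nu>) * ((t - (t - \<epsilon>)) powr \<gamma> / \<gamma>)"
          proof (rule power_singular_integral_tail[OF r(2)])
            show "continuous_on {t - \<epsilon><..<t} (\<lambda>s. D (t - s) (g s))"
              by (rule continuous_on_subset[OF smoothed_integrand_continuous[OF g r(3)]]) (use r in auto)
            fix s assume s: "t - \<epsilon> < s" "s < t"
            have "norm (D (t - s) (g s)) \<le> q * ((t - s) powr (\<gamma> - 1) * s powr (- \<nu>))"
              using forcingD(4)[OF g, of s "t - s"] s r by simp
            also have "\<dots> \<le> q * ((t - s) powr (\<gamma> - 1) * (c / 2) powr (- \<nu>))"
              using s t elim c q params by (intro mult_left_mono powr_mono2') auto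
            finally show "norm (D (t - s) (g s)) \<le> q * (c / 2) powr (- \<nu>) * (t - s) powr (\<gamma> - 1)"
              by (simp add: mult_ac)
          qed (use params in simp)
          then show "dist (f \<epsilon> t) (smoothed_duhamel g t) < e"
            using elim(1) smoothed_split[OF g r(1-3)] by (simp add: f_def dist_norm)
        qed
      qed
    qed
  qed simp
  then show ?thesis by (rule continuous_on_Ioc)
qed

lemma duhamel_zero [simp]: "duhamel g 0 = 0"
  by (simp add: duhamel_def)

lemma duhamel_continuous:
  assumes g: "forcing q g"
  shows "continuous_on {0..T} (duhamel g)"
  unfolding continuous_on_def
proof
  fix t assume t: "t \<in> {0..T}"
  show "(duhamel g \<longlongrightarrow> duhamel g t) (at t within {0..T})"
  proof (cases "t = 0")
    case False
    then have t: "t \<in> {0<..T}" using t by auto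
    have "(duhamel g \<longlongrightarrow> duhamel g t) (at t within {0<..T})"
      using duhamel_continuous_interior[OF g] t by (simp add: continuous_on_def)
    moreover have "at t within {0<..T} = at t within {0..T}"
      by (rule at_within_nhd[of t "{0<..}"]) (use t in auto)
    ultimately show ?thesis by simp
  next
    case True
    have "(duhamel g \<longlongrightarrow> 0) (at 0 within {0..T})"
    proof (rule Lim_null_comparison)
      have "norm (duhamel g s) \<le> C * q * (k1 * s powr (1 - \<nu>))" if "s \<in> {0..T}" "s \<noteq> 0" for s
        using duhamel_bound[OF g, of s] that by simp
      then show "\<forall>\<^sub>F s in at 0 within {0..T}. norm (duhamel g s) \<le> C * q * (k1 * s powr (1 - \<nu>))"
        unfolding eventually_at_filter by (intro always_eventually) blast
      have "((\<lambda>s::real. s powr (1 - \<nu>)) \<longlongrightarrow> 0) (at 0 within {0..T})"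
      proof (rule tendsto_zero_powrI[OF tendsto_ident_at tendsto_const])
        show "\<forall>\<^sub>F x in at 0 within {0..T}. 0 \<le> x" by (auto simp: eventually_at_filter)
      qed (use params in auto)
      from tendsto_mult_right_zero[OF tendsto_mult_right_zero[OF this]]
      show "((\<lambda>s. C * q * (k1 * s powr (1 - \<nu>))) \<longlongrightarrow> 0) (at 0 within {0..T})" .
    qed
    with True show ?thesis by simp
  qed
qed

lemma S_approximates:
  assumes y: "continuous_on {0<..T} y" and t: "t \<in> {0<..T}" and e: "0 < e"
  obtains \<delta> where "0 < \<delta>"
    "\<And>\<sigma> r. 0 \<le> \<sigma> \<Longrightarrow> \<sigma> < \<delta> \<Longrightarrow> \<sigma> \<le> T \<Longrightarrow> r \<in> {0<..T} \<Longrightarrow> \<bar>r - t\<bar> < \<delta> \<Longrightarrow> norm (S \<sigma> (y r) - y t) \<le> e"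
proof -
  have C1: "0 < 2 * (C + 1)" using C_nonneg by simp
  obtain d1 where d1: "d1 > 0" "\<And>r. r \<in> {0<..T} \<Longrightarrow> dist r t < d1 \<Longrightarrow> dist (y r) (y t) < e / (2 * (C + 1))"
    using y t divide_pos_pos[OF e C1] unfolding continuous_on_iff by blast
  have "continuous_on {0..} (\<lambda>\<sigma>. S \<sigma> (y t))" by (rule S_cont)
  then obtain d2 where d2: "d2 > 0" "\<And>\<sigma>. \<sigma> \<in> {0..} \<Longrightarrow> dist \<sigma> 0 < d2 \<Longrightarrow> dist (S \<sigma> (y t)) (S 0 (y t)) < e / 2"
    using half_gt_zero[OF e] atLeast_iff[of 0 "0::real"] unfolding continuous_on_iff by blast
  show thesis
  proof (rule that[of "min d1 d2"])
    fix \<sigma> r assume \<sigma>: "0 \<le> \<sigma>" "\<sigma> < min d1 d2" "\<sigma> \<le> T" and r: "r \<in> {0<..T}" "\<bar>r - t\<bar> < min d1 d2"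
    have "norm (S \<sigma> (y r) - S \<sigma> (y t)) \<le> C * norm (y r - y t)"
      using S_bound[OF \<sigma>(1,3), of "y r - y t"] linear_simps(2)[OF S_linear[OF \<sigma>(1)]] by simp
    also have "\<dots> \<le> (C + 1) * (e / (2 * (C + 1)))"
      using d1(2)[OF r(1)] r(2) C_nonneg by (intro mult_mono) (auto simp: dist_norm)
    also have "\<dots> = e / 2" using C1 by (simp add: field_simps)
    finally have "norm (S \<sigma> (y r) - S \<sigma> (y t)) \<le> e / 2" .
    moreover have "norm (S \<sigma> (y t) - y t) \<le> e / 2"
      using d2(2)[of \<sigma>] \<sigma> by (simp add: dist_norm S_zero)
    ultimately show "norm (S \<sigma> (y r) - y t) \<le> e"
      using norm_triangle_ineq[of "S \<sigma> (y r) - S \<sigma> (y t)" "S \<sigma> (y t) - y t"] by simp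
  qed (use d1 d2 in simp)
qed

text \<open>
  For \<open>u < v\<close> near \<open>t\<close> the increment is \<open>(S (v - u) - I)\<close> applied to the value at \<open>u\<close>, plus an
  integral over the short interval \<open>[u, v]\<close>. Both are \<open>v - u\<close> times something close to the claimed
  derivative. Taking \<open>u\<close> as base point treats the left and the right derivative alike.
\<close>

lemma duhamel_derivative:
  assumes g: "forcing q g" and t: "t \<in> {0<..T}"
  shows "(duhamel g has_vector_derivative (lam *\<^sub>R duhamel g t - smoothed_duhamel g t + g t)) (at t within {0<..T})"
proof -
  define y where "y r = lam *\<^sub>R duhamel g r - smoothed_duhamel g r" for r
  have y: "continuous_on {0<..T} y"
    unfolding y_def by (intro continuous_intros duhamel_continuous_interior[OF g] smoothed_duhamel_continuous[OF g])
  have "\<exists>\<delta>>0. \<forall>r\<in>{0<..T}. norm (r - t) < \<delta> \<longrightarrow>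
      norm (duhamel g r - duhamel g t - (r - t) *\<^sub>R (y t + g t)) \<le> e * norm (r - t)" if e: "e > 0" for e
  proof -
    have e2: "e / 2 > 0" using e by simp
    obtain d1 where d1: "0 < d1" "\<And>\<sigma> r. 0 \<le> \<sigma> \<Longrightarrow> \<sigma> < d1 \<Longrightarrow> \<sigma> \<le> T \<Longrightarrow> r \<in> {0<..T} \<Longrightarrow> \<bar>r - t\<bar> < d1 \<Longrightarrow> norm (S \<sigma> (y r) - y t) \<le> e / 2"
      using S_approximates[OF y t e2] by blast
    obtain d2 where d2: "0 < d2" "\<And>\<sigma> r. 0 \<le> \<sigma> \<Longrightarrow> \<sigma> < d2 \<Longrightarrow> \<sigma> \<le> T \<Longrightarrow> r \<in> {0<..T} \<Longrightarrow> \<bar>r - t\<bar> < d2 \<Longrightarrow> norm (S \<sigma> (g r) - g t) \<le> e / 2"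
      using S_approximates[OF forcingD(2)[OF g] t e2] by blast
    define \<delta> where "\<delta> = min d1 d2"
    have inc: "norm (duhamel g v - duhamel g u - (v - u) *\<^sub>R (y t + g t)) \<le> e * (v - u)"
      if uv: "u \<in> {0<..T}" "v \<in> {0<..T}" "u < v" "\<bar>u - t\<bar> < \<delta>" "\<bar>v - t\<bar> < \<delta>" "v - u < \<delta>" for u v
    proof -
      have u: "0 < u" "u \<le> T" and v: "v \<le> T" using uv by auto
      have "norm (S (v - u) (R (smoothed_duhamel g u)) - R (smoothed_duhamel g u) - (v - u) *\<^sub>R y t) \<le> e / 2 * (v - u)"
      proof (rule S_R_increment)
        fix s assume s: "0 \<le> s" "s \<le> v - u"
        have "norm (S s (y u) - y t) \<le> e / 2"
          by (rule d1(2)) (use s uv in \<open>auto simp: \<delta>_def\<close>)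
        then show "norm (S s (lam *\<^sub>R R (smoothed_duhamel g u) - smoothed_duhamel g u) - y t) \<le> e / 2"
          by (simp add: y_def duhamel_eq_R[OF g u])
      qed (use uv in simp)
      then have 1: "norm (S (v - u) (duhamel g u) - duhamel g u - (v - u) *\<^sub>R y t) \<le> e / 2 * (v - u)"
        by (simp add: duhamel_eq_R[OF g u])
      have c: "continuous_on {u..v} (\<lambda>s. S (v - s) (g s))"
        by (rule continuous_on_subset[OF duhamel_integrand_continuous[OF g v]]) (use u in auto)
      have "norm (integral {u..v} (\<lambda>s. S (v - s) (g s) - g t)) \<le> e / 2 * (v - u)"
      proof (rule integral_bound)
        show "continuous_on {u..v} (\<lambda>s. S (v - s) (g s) - g t)" by (intro continuous_intros c)
        fix s assume s: "s \<in> {u..v}"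
        show "norm (S (v - s) (g s) - g t) \<le> e / 2"
          by (rule d2(2)) (use s uv in \<open>auto simp: \<delta>_def\<close>)
      qed (use uv in simp)
      moreover have "integral {u..v} (\<lambda>s. S (v - s) (g s) - g t) = integral {u..v} (\<lambda>s. S (v - s) (g s)) - (v - u) *\<^sub>R g t"
        using Henstock_Kurzweil_Integration.integral_diff[OF integrable_continuous_interval[OF c] integrable_const_ivl[of "g t" u v]] uv(3) by simp
      ultimately have 2: "norm (integral {u..v} (\<lambda>s. S (v - s) (g s)) - (v - u) *\<^sub>R g t) \<le> e / 2 * (v - u)" by simp
      have eq: "duhamel g v - duhamel g u - (v - u) *\<^sub>R (y t + g t)
          = (S (v - u) (duhamel g u) - duhamel g u - (v - u) *\<^sub>R y t) + (integral {u..v} (\<lambda>s. S (v - s) (g s)) - (v - u) *\<^sub>R g t)"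
        using duhamel_split[OF g u(1) uv(3) v] by (simp add: scaleR_add_right)
      have "norm (duhamel g v - duhamel g u - (v - u) *\<^sub>R (y t + g t)) \<le> e / 2 * (v - u) + e / 2 * (v - u)"
        unfolding eq by (rule norm_triangle_le[OF add_mono[OF 1 2]])
      then show ?thesis by simp
    qed
    show ?thesis
    proof (intro exI[of _ \<delta>] conjI ballI impI)
      show "0 < \<delta>" using d1 d2 by (simp add: \<delta>_def)
      fix r assume r: "r \<in> {0<..T}" "norm (r - t) < \<delta>"
      consider "t < r" | "r = t" | "r < t" by linarith
      then show "norm (duhamel g r - duhamel g t - (r - t) *\<^sub>R (y t + g t)) \<le> e * norm (r - t)"
      proof cases
        case 1
        then show ?thesis using inc[of t r] r t by simp
      next
        case 3
        have "norm (duhamel g r - duhamel g t - (r - t) *\<^sub>R (y t + g t)) = norm (- (duhamel g t - duhamel g r - (t - r) *\<^sub>R (y t + g t)))"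
          by (simp add: algebra_simps)
        also have "\<dots> \<le> e * (t - r)" unfolding norm_minus_cancel using inc[of r t] r t 3 by simp
        finally show ?thesis using 3 by simp
      qed simp
    qed
  qed
  then show ?thesis
    unfolding has_vector_derivative_def has_derivative_within_alt y_def
    by (simp add: bounded_linear_scaleR_left)
qed

lemma
  assumes g: "forcing q g" and h: "forcing p h" and t: "0 \<le> t" "t \<le> T"
  shows duhamel_diff: "duhamel (\<lambda>s. g s - h s) t = duhamel g t - duhamel h t"
    and smoothed_duhamel_diff: "smoothed_duhamel (\<lambda>s. g s - h s) t = smoothed_duhamel g t - smoothed_duhamel h t"
proof -
  have *: "duhamel (\<lambda>s. g s - h s) t = duhamel g t - duhamel h t \<and>
    smoothed_duhamel (\<lambda>s. g s - h s) t = smoothed_duhamel g t - smoothed_duhamel h t" if t: "0 < t" "t \<le> T"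
  proof
    have "integral {0..t} (\<lambda>s. S (t - s) (g s - h s)) = integral {0..t} (\<lambda>s. S (t - s) (g s) - S (t - s) (h s))"
      by (rule Henstock_Kurzweil_Integration.integral_cong) (simp add: linear_simps(2)[OF S_linear])
    then show "duhamel (\<lambda>s. g s - h s) t = duhamel g t - duhamel h t"
      using Henstock_Kurzweil_Integration.integral_diff[OF duhamel_integrable[OF g t] duhamel_integrable[OF h t]]
      by (simp add: duhamel_def)
    have "integral {0..t} (\<lambda>s. D (t - s) (g s - h s)) = integral {0..t} (\<lambda>s. D (t - s) (g s) - D (t - s) (h s))"
      by (rule integral_spike[of "{t}"]) (use t in \<open>auto simp: linear_simps(2)[OF D_linear]\<close>)
    then show "smoothed_duhamel (\<lambda>s. g s - h s) t = smoothed_duhamel g t - smoothed_duhamel h t"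
      using Henstock_Kurzweil_Integration.integral_diff[OF smoothed_integrable[OF g t] smoothed_integrable[OF h t]]
      by (simp add: smoothed_duhamel_def)
  qed
  show "duhamel (\<lambda>s. g s - h s) t = duhamel g t - duhamel h t"
    "smoothed_duhamel (\<lambda>s. g s - h s) t = smoothed_duhamel g t - smoothed_duhamel h t"
    using * t by (cases "t = 0", auto simp: duhamel_def smoothed_duhamel_def)+
qed

end

section \<open>The linear time-average problem\<close>

lemma compact_closure_subset:
  fixes A B :: "'a::metric_space set"
  assumes "compact B" "A \<subseteq> B" shows "compact (closure A)"
proof -
  have "closure A \<subseteq> B" using assms compact_imp_closed closure_minimal by blast
  then have "B \<inter> closure A = closure A" by blast
  then show ?thesis using compact_Int_closed[OF assms(1) closed_closure, of A] by simp
qed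

lemma compact_closure_scaleR:
  fixes A :: "'a::real_normed_vector set"
  assumes "compact (closure A)" shows "compact (closure ((\<lambda>x. c *\<^sub>R x) ` A))"
  by (rule compact_closure_subset[OF compact_scaling[OF assms, of c]]) (use closure_subset in blast)

text \<open>
  Compactness of \<open>R\<close> on the unit ball is the compact embedding of \<open>E1\<close> into \<open>E0\<close>.
\<close>

locale average_problem = smoothing_duhamel S D R lam T C \<gamma> \<nu>
  for S D :: "real \<Rightarrow> 'a::banach \<Rightarrow> 'a" and R :: "'a \<Rightarrow> 'a" and lam T C \<gamma> \<nu> :: real +
  fixes a :: real and b b' :: "real \<Rightarrow> real"
  assumes b': "continuous_on {0..T} b'"
    "\<And>t. t \<in> {0..T} \<Longrightarrow> (b has_vector_derivative b' t) (at t within {0..T})"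
    and b0: "b 0 \<noteq> 0"
    and R_compact: "compact (closure (R ` cball 0 1))"
    and ker: "\<And>x. a *\<^sub>R S T x + integral {0..T} (\<lambda>t. b t *\<^sub>R S t x) = 0 \<Longrightarrow> x = 0"
begin

definition average :: "'a \<Rightarrow> 'a" where
  "average x = a *\<^sub>R S T x + integral {0..T} (\<lambda>t. b t *\<^sub>R S t x)"

lemma b_cont: "continuous_on {0..T} b"
  unfolding continuous_on_eq_continuous_within by (blast intro: has_vector_derivative_continuous b'(2))

lemma bounded_weight:
  assumes "continuous_on {0..T} c"
  shows "\<exists>B\<ge>0. \<forall>t\<in>{0..T}. \<bar>c t\<bar> \<le> (B::real)"
proof -
  have "bounded (c ` {0..T})" by (intro compact_imp_bounded compact_continuous_image assms) simp
  then obtain B where "\<forall>t\<in>{0..T}. \<bar>c t\<bar> \<le> B" by (auto simp: bounded_iff)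
  then have B: "\<And>t. t \<in> {0..T} \<Longrightarrow> \<bar>c t\<bar> \<le> B" by blast
  have "0 \<le> B" using B[of 0] T_pos by (simp add: order_trans[OF abs_ge_zero])
  with B show ?thesis by blast
qed

lemma S_cont_Icc: "continuous_on {0..t} (\<lambda>t. S t x)"
  by (rule continuous_on_subset[OF S_cont]) auto

lemma weighted_S_integrable:
  assumes "continuous_on {0..T} c"
  shows "(\<lambda>t. c t *\<^sub>R S t x) integrable_on {0..T}"
  by (intro integrable_continuous_interval continuous_intros assms S_cont_Icc)

definition weight :: "real \<Rightarrow> real" where "weight t = lam * b t + b' t"

lemma weight_cont: "continuous_on {0..T} weight"
  unfolding weight_def by (intro continuous_intros b_cont b')

text \<open>
  Integration by parts: integrate the derivative of \<open>b(t) S(t) R x\<close> over \<open>[0, T]\<close>. The boundary term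
  at \<open>0\<close> produces the leading part \<open>b(0) x\<close>.
\<close>

lemma average_eq_R:
  "average x = R (b 0 *\<^sub>R x + (a *\<^sub>R D T x - b T *\<^sub>R S T x + integral {0..T} (\<lambda>t. weight t *\<^sub>R S t x)))"
proof -
  note R = linear_simps[OF R_linear]
  have "((\<lambda>t. b t *\<^sub>R S t (lam *\<^sub>R R x - x) + b' t *\<^sub>R S t (R x)) has_integral
      b T *\<^sub>R S T (R x) - b 0 *\<^sub>R S 0 (R x)) {0..T}"
  proof (rule fundamental_theorem_of_calculus_interior)
    show "continuous_on {0..T} (\<lambda>t. b t *\<^sub>R S t (R x))" by (intro continuous_intros b_cont S_cont_Icc)
    fix t assume t: "t \<in> {0<..<T}"
    have "(b has_vector_derivative b' t) (at t within {0<..<T})"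
      by (rule has_vector_derivative_within_subset[OF b'(2)]) (use t in auto)
    then have "(b has_real_derivative b' t) (at t)"
      using t at_within_open[of t "{0<..<T}"] by (simp add: has_real_derivative_iff_has_vector_derivative)
    from has_vector_derivative_scaleR[OF this S_R_derivative[of t x]] t
    show "((\<lambda>t. b t *\<^sub>R S t (R x)) has_vector_derivative b t *\<^sub>R S t (lam *\<^sub>R R x - x) + b' t *\<^sub>R S t (R x)) (at t)" by simp
  qed (use T_pos in simp)
  then have I1: "((\<lambda>t. b t *\<^sub>R S t (lam *\<^sub>R R x - x) + b' t *\<^sub>R S t (R x)) has_integral
      R (b T *\<^sub>R S T x - b 0 *\<^sub>R x)) {0..T}"
    using T_pos by (simp add: S_zero S_R R)
  have eq: "b t *\<^sub>R S t (lam *\<^sub>R R x - x) + b' t *\<^sub>R S t (R x) = R (weight t *\<^sub>R S t x) - b t *\<^sub>R S t x"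
    if "t \<in> {0..T}" for t
  proof -
    have A: "S t (lam *\<^sub>R R x - x) = lam *\<^sub>R R (S t x) - S t x"
      using that by (simp add: linear_simps(2,5)[OF S_linear] S_R)
    show ?thesis unfolding A using that by (simp add: weight_def S_R R(1,5) algebra_simps)
  qed
  have "((\<lambda>t. R (weight t *\<^sub>R S t x)) has_integral R (integral {0..T} (\<lambda>t. weight t *\<^sub>R S t x))) {0..T}"
    using has_integral_linear[OF integrable_integral[OF weighted_S_integrable[OF weight_cont]] R_linear] by (simp add: o_def)
  from has_integral_diff[OF this integrable_integral[OF weighted_S_integrable[OF b_cont]]]
  have "((\<lambda>t. b t *\<^sub>R S t (lam *\<^sub>R R x - x) + b' t *\<^sub>R S t (R x)) has_integral
     (R (integral {0..T} (\<lambda>t. weight t *\<^sub>R S t x)) - integral {0..T} (\<lambda>t. b t *\<^sub>R S t x))) {0..T}"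
    by (rule has_integral_eq[rotated]) (simp add: eq)
  from has_integral_unique[OF this I1]
  have "integral {0..T} (\<lambda>t. b t *\<^sub>R S t x) = R (integral {0..T} (\<lambda>t. weight t *\<^sub>R S t x)) - R (b T *\<^sub>R S T x - b 0 *\<^sub>R x)"
    by (simp add: algebra_simps)
  then show ?thesis unfolding average_def by (simp add: R S_eq_R_D[OF T_pos, of x, symmetric] algebra_simps)
qed

definition remainder :: "'a \<Rightarrow> 'a" where
  "remainder x = a *\<^sub>R D T x - b T *\<^sub>R S T x + integral {0..T} (\<lambda>t. weight t *\<^sub>R S t x)"

lemma remainder_linear: "bounded_linear remainder"
proof -
  obtain B where B: "B \<ge> 0" "\<And>t. t \<in> {0..T} \<Longrightarrow> \<bar>weight t\<bar> \<le> B" using bounded_weight[OF weight_cont] by blast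
  note I = weighted_S_integrable[OF weight_cont]
  have "bounded_linear (\<lambda>x. integral {0..T} (\<lambda>t. weight t *\<^sub>R S t x))"
  proof (rule bounded_linear_intro)
    fix x y and r :: real
    have "integral {0..T} (\<lambda>t. weight t *\<^sub>R S t (x + y)) = integral {0..T} (\<lambda>t. weight t *\<^sub>R S t x + weight t *\<^sub>R S t y)"
      by (rule Henstock_Kurzweil_Integration.integral_cong)
        (simp add: linear_simps(1)[OF S_linear] scaleR_add_right)
    then show "integral {0..T} (\<lambda>t. weight t *\<^sub>R S t (x + y)) = integral {0..T} (\<lambda>t. weight t *\<^sub>R S t x) + integral {0..T} (\<lambda>t. weight t *\<^sub>R S t y)"
      by (simp add: Henstock_Kurzweil_Integration.integral_add[OF I I])
    have "integral {0..T} (\<lambda>t. weight t *\<^sub>R S t (r *\<^sub>R x)) = integral {0..T} (\<lambda>t. r *\<^sub>R (weight t *\<^sub>R S t x))"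
      by (rule Henstock_Kurzweil_Integration.integral_cong) (simp add: linear_simps(5)[OF S_linear])
    then show "integral {0..T} (\<lambda>t. weight t *\<^sub>R S t (r *\<^sub>R x)) = r *\<^sub>R integral {0..T} (\<lambda>t. weight t *\<^sub>R S t x)"
      by (simp only: Henstock_Kurzweil_Integration.integral_cmul)
    have "norm (integral {0..T} (\<lambda>t. weight t *\<^sub>R S t x)) \<le> (B * (C * norm x)) * (T - 0)"
    proof (rule integral_bound)
      show "continuous_on {0..T} (\<lambda>t. weight t *\<^sub>R S t x)" by (intro continuous_intros weight_cont S_cont_Icc)
      show "norm (weight t *\<^sub>R S t x) \<le> B * (C * norm x)" if "t \<in> {0..T}" for t
        using B(1) B(2)[OF that] S_bound[of t x] that by (auto intro!: mult_mono)
    qed (use T_pos in simp)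
    then show "norm (integral {0..T} (\<lambda>t. weight t *\<^sub>R S t x)) \<le> norm x * (B * C * T)" by (simp add: mult_ac)
  qed
  moreover have "bounded_linear (\<lambda>x. a *\<^sub>R D T x)" "bounded_linear (\<lambda>x. b T *\<^sub>R S T x)"
    using T_pos by (auto intro!: bounded_linear_const_scaleR D_linear S_linear)
  ultimately show ?thesis unfolding remainder_def by (intro bounded_linear_add bounded_linear_sub)
qed

text \<open>
  Up to the integral over \<open>[0, \<epsilon>]\<close>, which is small in norm, the operator is \<open>R\<close> applied to a bounded
  operator, since \<open>S t = R (D t)\<close> for \<open>t \<ge> \<epsilon>\<close>.
\<close>

lemma remainder_compact: "compact (closure (remainder ` cball 0 1))"
proof (rule compact_closure_approximation)
  fix e :: real assume e: "0 < e"
  obtain B where B: "B \<ge> 0" "\<And>t. t \<in> {0..T} \<Longrightarrow> \<bar>weight t\<bar> \<le> B" using bounded_weight[OF weight_cont] by blast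
  define \<epsilon> where "\<epsilon> = min T (e / (2 * (B * C + 1)))"
  have BC: "0 < B * C + 1" using B C_nonneg by (simp add: add_nonneg_pos)
  have \<epsilon>: "0 < \<epsilon>" "\<epsilon> \<le> T" using e BC T_pos by (auto simp: \<epsilon>_def)
  have "B * C * \<epsilon> \<le> (B * C + 1) * (e / (2 * (B * C + 1)))"
    using \<epsilon> B C_nonneg e BC by (intro mult_mono) (auto simp: \<epsilon>_def)
  also have "\<dots> = e / 2" using BC by (simp add: field_simps)
  finally have Be: "B * C * \<epsilon> \<le> e / 2" .
  define N where "N = \<bar>a\<bar> * (C / (T/2) * (C / (T/2))) + \<bar>b T\<bar> * (C / T) + B * (C / \<epsilon>) * (T - \<epsilon>)"
  have N: "0 \<le> N" unfolding N_def using B C_nonneg T_pos \<epsilon> by (intro add_nonneg_nonneg mult_nonneg_nonneg) auto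
  have "\<exists>z\<in>R ` cball 0 (N + 1). dist (remainder x) z < e" if x: "norm x \<le> 1" for x
  proof -
    have T2: "0 < T / 2" "T / 2 \<le> T" using T_pos by auto
    have Dc: "continuous_on {\<epsilon>..T} (\<lambda>t. weight t *\<^sub>R D t x)"
    proof (rule continuous_on_scaleR)
      show "continuous_on {\<epsilon>..T} weight" by (rule continuous_on_subset[OF weight_cont]) (use \<epsilon> in auto)
      show "continuous_on {\<epsilon>..T} (\<lambda>t. D t x)"
        by (rule D_continuous_joint) (use \<epsilon> in \<open>auto intro!: continuous_intros\<close>)
    qed
    define y where "y = a *\<^sub>R D (T/2) (D (T/2) x) - b T *\<^sub>R D T x + integral {\<epsilon>..T} (\<lambda>t. weight t *\<^sub>R D t x)"
    have n1: "norm (a *\<^sub>R D (T/2) (D (T/2) x)) \<le> \<bar>a\<bar> * (C / (T/2) * (C / (T/2)))"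
    proof -
      have "norm (D (T/2) (D (T/2) x)) \<le> C / (T/2) * norm (D (T/2) x)" by (rule D_bound[OF T2])
      also have "\<dots> \<le> C / (T/2) * (C / (T/2) * 1)"
        using D_bound[OF T2, of x] x C_nonneg T_pos
        by (intro mult_left_mono order_trans[OF D_bound[OF T2] mult_left_mono]) auto
      finally have "norm (D (T/2) (D (T/2) x)) \<le> C / (T/2) * (C / (T/2))" by (simp only: mult_1_right)
      then show ?thesis unfolding norm_scaleR by (rule mult_left_mono) simp
    qed
    have n2: "norm (b T *\<^sub>R D T x) \<le> \<bar>b T\<bar> * (C / T)"
    proof -
      have "norm (D T x) \<le> C / T * 1"
        using x C_nonneg T_pos by (intro order_trans[OF D_bound mult_left_mono]) auto
      then have "norm (D T x) \<le> C / T" by (simp only: mult_1_right)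
      then show ?thesis unfolding norm_scaleR by (rule mult_left_mono) simp
    qed
    have n3: "norm (integral {\<epsilon>..T} (\<lambda>t. weight t *\<^sub>R D t x)) \<le> B * (C / \<epsilon>) * (T - \<epsilon>)"
    proof (rule integral_bound[OF \<epsilon>(2) Dc])
      fix t assume t: "t \<in> {\<epsilon>..T}"
      have "norm (D t x) \<le> C / t * 1"
        using x C_nonneg t \<epsilon> by (intro order_trans[OF D_bound mult_left_mono]) auto
      also have "\<dots> \<le> C / \<epsilon>" using t \<epsilon> C_nonneg by (simp add: frac_le)
      finally show "norm (weight t *\<^sub>R D t x) \<le> B * (C / \<epsilon>)"
        unfolding norm_scaleR by (rule mult_mono[rotated]) (use B(1) B(2)[of t] t \<epsilon> in auto)
    qed
    have y: "norm y \<le> N"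
      unfolding y_def N_def by (intro norm_triangle_le add_mono order_trans[OF norm_triangle_ineq4] n1 n2 n3)
    have 1: "integral {\<epsilon>..T} (\<lambda>t. weight t *\<^sub>R S t x) = R (integral {\<epsilon>..T} (\<lambda>t. weight t *\<^sub>R D t x))"
    proof -
      have "R (integral {\<epsilon>..T} (\<lambda>t. weight t *\<^sub>R D t x)) = integral {\<epsilon>..T} (\<lambda>t. R (weight t *\<^sub>R D t x))"
        using integral_linear[OF integrable_continuous_interval[OF Dc] R_linear] by (simp add: o_def)
      also have "\<dots> = integral {\<epsilon>..T} (\<lambda>t. weight t *\<^sub>R S t x)"
        by (rule Henstock_Kurzweil_Integration.integral_cong)
          (use \<epsilon> in \<open>simp add: linear_simps(5)[OF R_linear] S_eq_R_D\<close>)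
      finally show ?thesis by simp
    qed
    \<comment> \<open>half of the time \<open>T\<close> is used for each of the two factors\<close>
    have 2: "D T x = R (D (T/2) (D (T/2) x))"
      using S_D[of "T/2" "T/2" x] S_eq_R_D[of "T/2" "D (T/2) x"] T2 by simp
    have 3: "S T x = R (D T x)" by (rule S_eq_R_D[OF T_pos])
    have "R y = a *\<^sub>R D T x - b T *\<^sub>R S T x + integral {\<epsilon>..T} (\<lambda>t. weight t *\<^sub>R S t x)"
      unfolding y_def 1 2 3 by (simp add: linear_simps[OF R_linear] 2)
    moreover have "integral {0..T} (\<lambda>t. weight t *\<^sub>R S t x) = integral {0..\<epsilon>} (\<lambda>t. weight t *\<^sub>R S t x) + integral {\<epsilon>..T} (\<lambda>t. weight t *\<^sub>R S t x)"
      using Henstock_Kurzweil_Integration.integral_combine[OF _ \<epsilon>(2) weighted_S_integrable[OF weight_cont], of x] \<epsilon> by simp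
    ultimately have "remainder x - R y = integral {0..\<epsilon>} (\<lambda>t. weight t *\<^sub>R S t x)"
      by (simp add: remainder_def)
    moreover have "norm (integral {0..\<epsilon>} (\<lambda>t. weight t *\<^sub>R S t x)) \<le> B * C * (\<epsilon> - 0)"
    proof (rule integral_bound)
      show "continuous_on {0..\<epsilon>} (\<lambda>t. weight t *\<^sub>R S t x)"
        by (intro continuous_on_scaleR S_cont_Icc continuous_on_subset[OF weight_cont]) (use \<epsilon> in auto)
      fix t assume t: "t \<in> {0..\<epsilon>}"
      have "norm (S t x) \<le> C * 1" using x C_nonneg t \<epsilon> by (intro order_trans[OF S_bound mult_left_mono]) auto
      then show "norm (weight t *\<^sub>R S t x) \<le> B * C"
        unfolding norm_scaleR mult_1_right by (rule mult_mono[rotated]) (use B(1) B(2)[of t] t \<epsilon> in auto)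
    qed (use \<epsilon> in simp)
    ultimately have "dist (remainder x) (R y) < e" using Be e by (simp add: dist_norm)
    then show ?thesis using y by (intro bexI[of _ "R y"]) auto
  qed
  moreover have "compact (closure (R ` cball 0 (N + 1)))"
  proof -
    have "R ` cball 0 (N + 1) \<subseteq> (\<lambda>x. (N + 1) *\<^sub>R x) ` (R ` cball 0 1)"
    proof (rule image_subsetI)
      fix z :: 'a assume z: "z \<in> cball 0 (N + 1)"
      have "R z = (N + 1) *\<^sub>R R ((1 / (N + 1)) *\<^sub>R z)" using N by (simp add: linear_simps(5)[OF R_linear])
      moreover have "norm ((1 / (N + 1)) *\<^sub>R z) \<le> 1" using z N by simp
      ultimately show "R z \<in> (\<lambda>x. (N + 1) *\<^sub>R x) ` (R ` cball 0 1)" by (auto simp: image_iff intro!: bexI[of _ "(1 / (N + 1)) *\<^sub>R z"])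
    qed
    from order_trans[OF this closure_subset] show ?thesis
      by (rule compact_closure_subset[OF compact_closure_scaleR[OF R_compact]])
  qed
  ultimately show "\<exists>B. compact (closure B) \<and> (\<forall>x\<in>remainder ` cball 0 1. \<exists>b\<in>B. dist x b < e)"
    by (intro exI[of _ "R ` cball 0 (N + 1)"]) auto
qed

lemma average_eq: "average x = R (b 0 *\<^sub>R x + remainder x)"
  unfolding average_eq_R remainder_def ..

lemma average_eq_0: "average x = 0 \<Longrightarrow> x = 0"
  unfolding average_def by (rule ker)

lemma average_diff: "average (x - y) = average x - average y"
proof -
  have "b 0 *\<^sub>R (x - y) + remainder (x - y) = (b 0 *\<^sub>R x + remainder x) - (b 0 *\<^sub>R y + remainder y)"
    by (simp add: linear_simps(2)[OF remainder_linear] scaleR_diff_right)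
  then show ?thesis unfolding average_eq by (simp only: linear_simps(2)[OF R_linear])
qed

lemma average_surjective: "\<exists>B\<ge>0. \<forall>y. \<exists>x. average x = R y \<and> norm x \<le> B * norm y"
proof -
  define K where "K x = (- (1 / b 0)) *\<^sub>R remainder x" for x
  have Kl: "bounded_linear K" unfolding K_def by (rule bounded_linear_const_scaleR[OF remainder_linear])
  have Kc: "compact (closure (K ` cball 0 1))"
    using compact_closure_scaleR[OF remainder_compact, of "- (1 / b 0)"] by (simp add: image_image K_def)
  have K: "x - K x = (1 / b 0) *\<^sub>R (b 0 *\<^sub>R x + remainder x)" for x
    using b0 by (simp add: K_def scaleR_add_right)
  have inj: "x = 0" if "x - K x = 0" for x
    using that b0 average_eq_0[of x] linear_simps(3)[OF R_linear] unfolding K average_eq by simp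
  obtain B where B: "B \<ge> 0" "\<And>y. \<exists>x. x - K x = y \<and> norm x \<le> B * norm y"
    using fredholm_injective_imp_surjective[OF Kl Kc inj] by blast
  have "\<exists>x. average x = R y \<and> norm x \<le> (B * \<bar>1 / b 0\<bar>) * norm y" for y
  proof -
    obtain x where x: "x - K x = (1 / b 0) *\<^sub>R y" "norm x \<le> B * norm ((1 / b 0) *\<^sub>R y)" using B(2) by blast
    have "b 0 *\<^sub>R x + remainder x = y" using x(1) b0 unfolding K by simp
    then show ?thesis using x(2) by (intro exI[of _ x]) (simp add: average_eq)
  qed
  moreover have "0 \<le> B * \<bar>1 / b 0\<bar>" using B by simp
  ultimately show ?thesis by blast
qed

definition average_inverse :: "'a \<Rightarrow> 'a" where
  "average_inverse y = (THE x. average x = R y)"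

lemma average_inverse_unique: "average x = R y \<Longrightarrow> average_inverse y = x"
  unfolding average_inverse_def
proof (rule the_equality)
  fix x' assume "average x = R y" "average x' = R y"
  then show "x' = x" using average_eq_0[of "x' - x"] by (simp add: average_diff)
qed

lemma average_average_inverse: "average (average_inverse y) = R y"
  using average_surjective average_inverse_unique by metis

lemma average_inverse_bound: "\<exists>B\<ge>0. \<forall>y. norm (average_inverse y) \<le> B * norm y"
  using average_surjective average_inverse_unique by metis

lemma average_inverse_diff: "average_inverse (y - z) = average_inverse y - average_inverse z"
  by (rule average_inverse_unique) (simp add: average_diff average_average_inverse linear_simps(2)[OF R_linear])

definition duhamel_average :: "(real \<Rightarrow> 'a) \<Rightarrow> 'a" where
  "duhamel_average g = a *\<^sub>R smoothed_duhamel g T + integral {0..T} (\<lambda>t. b t *\<^sub>R smoothed_duhamel g t)"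

text \<open>
  The integrand is of order \<open>t\<^bsup>\<gamma> - \<nu>\<^esup>\<close> at \<open>0\<close>, and \<open>\<gamma> - \<nu> > -1\<close>.
\<close>

lemma weighted_smoothed:
  shows "forcing q g \<Longrightarrow> (\<lambda>t. b t *\<^sub>R smoothed_duhamel g t) integrable_on {0..T}"
    and "\<exists>K\<ge>0. \<forall>q g. forcing q g \<longrightarrow> norm (integral {0..T} (\<lambda>t. b t *\<^sub>R smoothed_duhamel g t)) \<le> K * q"
proof -
  obtain B where B: "B \<ge> 0" "\<And>t. t \<in> {0..T} \<Longrightarrow> \<bar>b t\<bar> \<le> B" using bounded_weight[OF b_cont] by blast
  define K where "K = B * k2 * (T powr (1 + \<gamma> - \<nu>) / (1 + \<gamma> - \<nu>))"
  have p: "0 < 1 + \<gamma> - \<nu>" using params by simp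
  have *: "(\<lambda>t. b t *\<^sub>R smoothed_duhamel g t) integrable_on {0..T} \<and>
     norm (integral {0..T} (\<lambda>t. b t *\<^sub>R smoothed_duhamel g t)) \<le> K * q" if g: "forcing q g" for q g
  proof -
    note q = forcingD(1)[OF g]
    define H where "H s = (B * q * k2) * (s powr (1 + \<gamma> - \<nu>) / (1 + \<gamma> - \<nu>))" for s
    have c: "continuous_on {0<..<T} (\<lambda>t. b t *\<^sub>R smoothed_duhamel g t)"
      by (intro continuous_on_scaleR continuous_on_subset[OF b_cont] continuous_on_subset[OF smoothed_duhamel_continuous[OF g]]) auto
    have bd: "norm (b s *\<^sub>R smoothed_duhamel g s) \<le> (B * q * k2) * s powr (\<gamma> - \<nu>)" if "0 < s" "s < T" for s
    proof -
      have "\<bar>b s\<bar> * norm (smoothed_duhamel g s) \<le> B * (q * (k2 * s powr (\<gamma> - \<nu>)))"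
        using B(1) B(2)[of s] smoothed_bound[OF g, of s] that by (intro mult_mono) auto
      then show ?thesis by (simp add: mult_ac)
    qed
    have Hc: "continuous_on {0..T} H"
      unfolding H_def using p by (intro continuous_on_mult_left continuous_on_divide continuous_on_powr' continuous_on_id continuous_on_const) auto
    have Hd: "(H has_real_derivative (B * q * k2) * s powr (\<gamma> - \<nu>)) (at s)" if "0 < s" "s < T" for s
      unfolding H_def
      using DERIV_cmult[OF DERIV_cdivide[OF has_real_derivative_powr[of s "1 + \<gamma> - \<nu>"], of "1 + \<gamma> - \<nu>"], of "B * q * k2"] that p
      by simp
    show ?thesis using dominated_integral[OF T_pos c bd Hc Hd] by (simp add: H_def K_def mult_ac)
  qed
  then show "forcing q g \<Longrightarrow> (\<lambda>t. b t *\<^sub>R smoothed_duhamel g t) integrable_on {0..T}" by blast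
  have "0 \<le> K" unfolding K_def using B k_nonneg p by simp
  with * show "\<exists>K\<ge>0. \<forall>q g. forcing q g \<longrightarrow> norm (integral {0..T} (\<lambda>t. b t *\<^sub>R smoothed_duhamel g t)) \<le> K * q" by blast
qed

lemma duhamel_average_bound: "\<exists>K\<ge>0. \<forall>q g. forcing q g \<longrightarrow> norm (duhamel_average g) \<le> K * q"
proof -
  obtain K where K: "K \<ge> 0" "\<And>q g. forcing q g \<Longrightarrow> norm (integral {0..T} (\<lambda>t. b t *\<^sub>R smoothed_duhamel g t)) \<le> K * q"
    using weighted_smoothed(2) by blast
  have "norm (duhamel_average g) \<le> (\<bar>a\<bar> * (k2 * T powr (\<gamma> - \<nu>)) + K) * q" if g: "forcing q g" for q g
  proof -
    have "norm (duhamel_average g) \<le> \<bar>a\<bar> * (q * (k2 * T powr (\<gamma> - \<nu>))) + K * q"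
      unfolding duhamel_average_def
      by (intro norm_triangle_le add_mono K(2)[OF g]) (use smoothed_bound[OF g T_pos] in \<open>simp add: mult_left_mono\<close>)
    then show ?thesis by (simp add: algebra_simps)
  qed
  moreover have "0 \<le> \<bar>a\<bar> * (k2 * T powr (\<gamma> - \<nu>)) + K" using K k_nonneg by simp
  ultimately show ?thesis by blast
qed

lemma R_duhamel_average:
  assumes g: "forcing q g"
  shows "(\<lambda>t. b t *\<^sub>R duhamel g t) integrable_on {0..T}"
    and "a *\<^sub>R duhamel g T + integral {0..T} (\<lambda>t. b t *\<^sub>R duhamel g t) = R (duhamel_average g)"
proof -
  show "(\<lambda>t. b t *\<^sub>R duhamel g t) integrable_on {0..T}"
    by (intro integrable_continuous_interval continuous_intros b_cont duhamel_continuous[OF g])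
  have "R (integral {0..T} (\<lambda>t. b t *\<^sub>R smoothed_duhamel g t)) = integral {0..T} (\<lambda>t. R (b t *\<^sub>R smoothed_duhamel g t))"
    using integral_linear[OF weighted_smoothed(1)[OF g] R_linear] by (simp add: o_def)
  also have "\<dots> = integral {0..T} (\<lambda>t. b t *\<^sub>R duhamel g t)"
    by (rule integral_spike[of "{0}"]) (auto simp: linear_simps(5)[OF R_linear] duhamel_eq_R[OF g])
  finally show "a *\<^sub>R duhamel g T + integral {0..T} (\<lambda>t. b t *\<^sub>R duhamel g t) = R (duhamel_average g)"
    using duhamel_eq_R[OF g T_pos] by (simp add: duhamel_average_def linear_simps[OF R_linear])
qed

lemma duhamel_average_diff:
  assumes g: "forcing q g" and h: "forcing p h"
  shows "duhamel_average (\<lambda>s. g s - h s) = duhamel_average g - duhamel_average h"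
proof -
  have "integral {0..T} (\<lambda>t. b t *\<^sub>R smoothed_duhamel (\<lambda>s. g s - h s) t) =
      integral {0..T} (\<lambda>t. b t *\<^sub>R smoothed_duhamel g t - b t *\<^sub>R smoothed_duhamel h t)"
    by (rule Henstock_Kurzweil_Integration.integral_cong) (simp add: smoothed_duhamel_diff[OF g h] scaleR_diff_right)
  also have "\<dots> = integral {0..T} (\<lambda>t. b t *\<^sub>R smoothed_duhamel g t) - integral {0..T} (\<lambda>t. b t *\<^sub>R smoothed_duhamel h t)"
    by (rule Henstock_Kurzweil_Integration.integral_diff[OF weighted_smoothed(1)[OF g] weighted_smoothed(1)[OF h]])
  finally show ?thesis
    using smoothed_duhamel_diff[OF g h, of T] T_pos by (simp add: duhamel_average_def scaleR_diff_right)
qed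

definition initial :: "'a \<Rightarrow> (real \<Rightarrow> 'a) \<Rightarrow> 'a" where
  "initial m g = average_inverse (m - duhamel_average g)"

definition sol :: "'a \<Rightarrow> (real \<Rightarrow> 'a) \<Rightarrow> real \<Rightarrow> 'a" where
  "sol m g t = S t (initial m g) + duhamel g t"

definition sol_lift :: "'a \<Rightarrow> (real \<Rightarrow> 'a) \<Rightarrow> real \<Rightarrow> 'a" where
  "sol_lift m g t = D t (initial m g) + smoothed_duhamel g t"

lemma sol_eq_R: "forcing q g \<Longrightarrow> 0 < t \<Longrightarrow> t \<le> T \<Longrightarrow> sol m g t = R (sol_lift m g t)"
  by (simp add: sol_def sol_lift_def linear_simps(1)[OF R_linear] S_eq_R_D duhamel_eq_R)

lemma sol_continuous: "forcing q g \<Longrightarrow> continuous_on {0..T} (sol m g)"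
  unfolding sol_def by (intro continuous_on_add S_cont_Icc duhamel_continuous)

lemma sol_lift_continuous: "forcing q g \<Longrightarrow> continuous_on {0<..T} (sol_lift m g)"
  unfolding sol_lift_def
  by (intro continuous_on_add smoothed_duhamel_continuous D_continuous_joint) (auto intro!: continuous_intros)

lemma sol_derivative:
  assumes g: "forcing q g" and t: "t \<in> {0<..T}"
  shows "(sol m g has_vector_derivative (lam *\<^sub>R sol m g t - sol_lift m g t + g t)) (at t within {0<..T})"
proof -
  have "((\<lambda>t. S t (initial m g)) has_vector_derivative lam *\<^sub>R S t (initial m g) - D t (initial m g)) (at t within {0<..T})"
    by (rule has_vector_derivative_at_within[OF S_derivative]) (use t in simp)
  from has_vector_derivative_add[OF this duhamel_derivative[OF g t]]
  show ?thesis by (simp add: sol_def[abs_def] sol_lift_def algebra_simps)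
qed

lemma average_sol_general:
  assumes g: "forcing q g"
  shows "a *\<^sub>R (S T x + duhamel g T) + integral {0..T} (\<lambda>t. b t *\<^sub>R (S t x + duhamel g t)) = average x + R (duhamel_average g)"
proof -
  have "integral {0..T} (\<lambda>t. b t *\<^sub>R (S t x + duhamel g t)) = integral {0..T} (\<lambda>t. b t *\<^sub>R S t x) + integral {0..T} (\<lambda>t. b t *\<^sub>R duhamel g t)"
    unfolding scaleR_add_right
    by (rule Henstock_Kurzweil_Integration.integral_add[OF weighted_S_integrable[OF b_cont] R_duhamel_average(1)[OF g]])
  then show ?thesis unfolding average_def R_duhamel_average(2)[OF g, symmetric] by (simp add: algebra_simps)
qed

lemma sol_average:
  assumes g: "forcing q g"
  shows "a *\<^sub>R sol m g T + integral {0..T} (\<lambda>t. b t *\<^sub>R sol m g t) = R m"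
  unfolding sol_def average_sol_general[OF g] initial_def average_average_inverse
  by (simp add: linear_simps[OF R_linear])

text \<open>
  Variation of constants identifies \<open>u\<close> up to its initial value, which the average condition
  determines.
\<close>

lemma sol_unique:
  assumes g: "forcing q g"
    and u: "continuous_on {0..T} u"
    and u_dom: "\<And>t. t \<in> {0<..T} \<Longrightarrow> u t = R (\<omega> t)"
    and u_der: "\<And>t. t \<in> {0<..T} \<Longrightarrow>
        (u has_vector_derivative (lam *\<^sub>R u t - \<omega> t + g t)) (at t within {0<..T})"
    and u_avg: "a *\<^sub>R u T + integral {0..T} (\<lambda>t. b t *\<^sub>R u t) = R m"
    and t: "t \<in> {0..T}"
  shows "u t = sol m g t"
proof -
  have eq: "u t = S t (u 0) + duhamel g t" if t: "t \<in> {0..T}" for t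
  proof (cases "t = 0")
    case False
    then have "t \<in> {0<..T}" using t by simp
    from integral_unique[OF variation_of_constants[OF u u_dom u_der this]]
    show ?thesis by (simp add: duhamel_def)
  qed (simp add: S_zero)
  have "integral {0..T} (\<lambda>t. b t *\<^sub>R u t) = integral {0..T} (\<lambda>t. b t *\<^sub>R (S t (u 0) + duhamel g t))"
    by (rule Henstock_Kurzweil_Integration.integral_cong) (simp add: eq[symmetric])
  then have "average (u 0) + R (duhamel_average g) = R m"
    using u_avg eq[of T] T_pos average_sol_general[OF g, of "u 0"] by simp
  then have "average (u 0) = R (m - duhamel_average g)" by (simp add: linear_simps[OF R_linear] algebra_simps)
  from average_inverse_unique[OF this] have "initial m g = u 0" by (simp add: initial_def)
  with eq[OF t] show ?thesis by (simp add: sol_def)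
qed

lemma sol_diff:
  assumes g: "forcing q g" and h: "forcing p h"
  shows "t \<in> {0..T} \<Longrightarrow> sol m g t - sol n h t = sol (m - n) (\<lambda>s. g s - h s) t"
    and "t \<in> {0<..T} \<Longrightarrow> sol_lift m g t - sol_lift n h t = sol_lift (m - n) (\<lambda>s. g s - h s) t"
proof -
  have "(m - n) - (duhamel_average g - duhamel_average h) = (m - duhamel_average g) - (n - duhamel_average h)" by simp
  then have i: "initial (m - n) (\<lambda>s. g s - h s) = initial m g - initial n h"
    unfolding initial_def duhamel_average_diff[OF g h] by (simp only: average_inverse_diff)
  show "sol m g t - sol n h t = sol (m - n) (\<lambda>s. g s - h s) t" if "t \<in> {0..T}"
    using that by (simp add: sol_def i duhamel_diff[OF g h] linear_simps(2)[OF S_linear])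
  show "sol_lift m g t - sol_lift n h t = sol_lift (m - n) (\<lambda>s. g s - h s) t" if "t \<in> {0<..T}"
    using that by (simp add: sol_lift_def i smoothed_duhamel_diff[OF g h] linear_simps(2)[OF D_linear])
qed

lemma sol_bound:
  "\<exists>K\<ge>0. \<forall>m g q. forcing q g \<longrightarrow>
     (\<forall>t\<in>{0..T}. norm (sol m g t) \<le> K * (norm m + q)) \<and>
     (\<forall>t\<in>{0<..T}. t * norm (sol_lift m g t) \<le> K * (norm m + q))"
proof -
  obtain B where B: "B \<ge> 0" "\<And>y. norm (average_inverse y) \<le> B * norm y" using average_inverse_bound by blast
  obtain K3 where K3: "K3 \<ge> 0" "\<And>q g. forcing q g \<Longrightarrow> norm (duhamel_average g) \<le> K3 * q"
    using duhamel_average_bound by blast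
  define L where "L = C * (B * (1 + K3))"
  have L: "L \<ge> 0" unfolding L_def using B K3 C_nonneg by simp
  define K where "K = L + C * k1 * T powr (1 - \<nu>) + k2 * T powr (1 + \<gamma> - \<nu>)"
  have K: "L \<le> K" "L + C * k1 * T powr (1 - \<nu>) \<le> K" "L + k2 * T powr (1 + \<gamma> - \<nu>) \<le> K"
    unfolding K_def using k_nonneg C_nonneg by auto
  have ini: "C * norm (initial m g) \<le> L * (norm m + q)" if g: "forcing q g" for m g q
  proof -
    have "norm (m - duhamel_average g) \<le> norm m + K3 * q"
      using norm_triangle_ineq4[of m "duhamel_average g"] K3(2)[OF g] by linarith
    also have "\<dots> \<le> (1 + K3) * (norm m + q)" using K3 forcingD(1)[OF g] by (simp add: algebra_simps)
    finally have "norm (initial m g) \<le> B * ((1 + K3) * (norm m + q))"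
      unfolding initial_def by (intro order_trans[OF B(2) mult_left_mono[OF _ B(1)]])
    from mult_left_mono[OF this C_nonneg] show ?thesis by (simp add: L_def mult_ac)
  qed
  have 1: "norm (sol m g t) \<le> K * (norm m + q)" if g: "forcing q g" and t: "t \<in> {0..T}" for m g q t
  proof -
    note q = forcingD(1)[OF g]
    have "norm (S t (initial m g)) \<le> L * (norm m + q)"
      using S_bound[of t "initial m g"] ini[OF g, of m] t by auto
    moreover have "norm (duhamel g t) \<le> (C * k1 * T powr (1 - \<nu>)) * (norm m + q)"
    proof (cases "t = 0")
      case True then show ?thesis using C_nonneg k_nonneg q by simp
    next
      case False
      then have t: "0 < t" "t \<le> T" using t by auto
      have "norm (duhamel g t) \<le> C * q * (k1 * t powr (1 - \<nu>))" by (rule duhamel_bound[OF g t])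
      also have "\<dots> \<le> C * (norm m + q) * (k1 * T powr (1 - \<nu>))"
        using t q C_nonneg k_nonneg params by (intro mult_mono mult_left_mono powr_mono2) auto
      finally show ?thesis by (simp add: mult_ac)
    qed
    ultimately have "norm (sol m g t) \<le> (L + C * k1 * T powr (1 - \<nu>)) * (norm m + q)"
      unfolding sol_def distrib_right by (intro norm_triangle_le add_mono)
    also have "\<dots> \<le> K * (norm m + q)" using K q by (intro mult_right_mono) auto
    finally show ?thesis .
  qed
  have 2: "t * norm (sol_lift m g t) \<le> K * (norm m + q)" if g: "forcing q g" and t: "t \<in> {0<..T}" for m g q t
  proof -
    note q = forcingD(1)[OF g]
    have "t * norm (D t (initial m g)) \<le> C * norm (initial m g)"
      using D_bound[of t "initial m g"] t by (simp add: field_simps)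
    then have d: "t * norm (D t (initial m g)) \<le> L * (norm m + q)" using ini[OF g, of m] by linarith
    have "t * norm (smoothed_duhamel g t) \<le> t * (q * (k2 * t powr (\<gamma> - \<nu>)))"
      using smoothed_bound[OF g, of t] t by (intro mult_left_mono) auto
    also have "\<dots> = q * (k2 * t powr (1 + \<gamma> - \<nu>))"
      using t powr_add[of t 1 "\<gamma> - \<nu>"] by (simp add: add_diff_eq)
    also have "\<dots> \<le> (norm m + q) * (k2 * T powr (1 + \<gamma> - \<nu>))"
      using t q k_nonneg params by (intro mult_mono mult_left_mono powr_mono2) auto
    finally have s: "t * norm (smoothed_duhamel g t) \<le> (k2 * T powr (1 + \<gamma> - \<nu>)) * (norm m + q)" by (simp add: mult_ac)
    have "t * norm (sol_lift m g t) \<le> t * (norm (D t (initial m g)) + norm (smoothed_duhamel g t))"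
      unfolding sol_lift_def using t norm_triangle_ineq by (intro mult_left_mono) auto
    also have "\<dots> = t * norm (D t (initial m g)) + t * norm (smoothed_duhamel g t)" by (rule distrib_left)
    also have "\<dots> \<le> L * (norm m + q) + (k2 * T powr (1 + \<gamma> - \<nu>)) * (norm m + q)" by (rule add_mono[OF d s])
    also have "\<dots> = (L + k2 * T powr (1 + \<gamma> - \<nu>)) * (norm m + q)" by (rule distrib_right[symmetric])
    also have "\<dots> \<le> K * (norm m + q)" using K q by (intro mult_right_mono) auto
    finally show ?thesis .
  qed
  have "0 \<le> K" using L K(1) by linarith
  with 1 2 show ?thesis by blast
qed

end

section \<open>Interpolation spaces\<close>

lemma sum_space_lower_bound:
  assumes z: "z \<in> car (sum_space X Y)" and K: "0 < K"
    and bd: "\<And>x y. x \<in> car X \<Longrightarrow> y \<in> car Y \<Longrightarrow> N (x + y) \<le> K * (nrm X x + nrm Y y)"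
  shows "N z \<le> K * nrm (sum_space X Y) z"
proof -
  have "N z / K \<le> Inf {nrm X x + nrm Y y |x y. x \<in> car X \<and> y \<in> car Y \<and> x + y = z}"
  proof (rule cInf_greatest)
    show "{nrm X x + nrm Y y |x y. x \<in> car X \<and> y \<in> car Y \<and> x + y = z} \<noteq> {}"
      using z by (auto simp: sum_space_def)
    show "N z / K \<le> s" if "s \<in> {nrm X x + nrm Y y |x y. x \<in> car X \<and> y \<in> car Y \<and> x + y = z}" for s
      using that bd K by (auto simp: pos_divide_le_eq mult.commute)
  qed
  then show ?thesis using K by (simp add: sum_space_def pos_divide_le_eq mult.commute)
qed

lemma lin_on_subset: "lin_on J UNIV L \<Longrightarrow> lin_on J U L"
  by (auto simp: lin_on_def split: option.splits)

lemma cont_embedded_const: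
  assumes "cont_embedded X Y" "\<And>x. x \<in> car X \<Longrightarrow> 0 \<le> nrm X x"
  obtains c where "0 < c" "\<And>x. x \<in> car X \<Longrightarrow> x \<in> car Y \<and> nrm Y x \<le> c * nrm X x"
proof -
  obtain c where c: "car X \<subseteq> car Y" "\<And>x. x \<in> car X \<Longrightarrow> nrm Y x \<le> c * nrm X x"
    using assms(1) by (auto simp: cont_embedded_def)
  show thesis
  proof (rule that[of "max c 1"])
    fix x assume x: "x \<in> car X"
    have "c * nrm X x \<le> max c 1 * nrm X x" using assms(2)[OF x] by (intro mult_right_mono) auto
    then show "x \<in> car Y \<and> nrm Y x \<le> max c 1 * nrm X x" using c x by force
  qed simp
qed

locale embedded_couple =
  fixes J :: "('a::banach \<Rightarrow> 'a) option" and E0 E1 :: "'a nspace"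
  assumes E0_def: "E0 = NSpace UNIV norm" and E0: "banach_on J E0"
    and E1: "banach_on J E1" "cont_embedded E1 E0"
begin

lemma E0_simps [simp]: "car E0 = UNIV" "nrm E0 = norm"
  by (simp_all add: E0_def)

lemma couples: "banach_couple J E0 E0" "banach_couple J E0 E1" "banach_couple J E1 E1"
proof -
  have "cont_embedded E0 E0" by (auto simp: cont_embedded_def intro: exI[of _ 1])
  then show "banach_couple J E0 E0" "banach_couple J E0 E1" "banach_couple J E1 E1"
    using E0 E1 banach_on_normed_on[OF E0] unfolding banach_couple_def by blast+
qed

lemma E1_norm: obtains c where "0 < c" "\<And>x. x \<in> car E1 \<Longrightarrow> norm x \<le> c * nrm E1 x"
  using cont_embedded_const[OF E1(2) nrm_nonneg[OF banach_on_normed_on[OF E1(1)]]] by auto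

lemma functor_embeddings:
  assumes F: "interpolation_functor J \<theta> F"
  shows "banach_on J (F E0 E1)"
    and "\<exists>c\<ge>0. \<forall>x\<in>car (F E0 E1). norm x \<le> c * nrm (F E0 E1) x"
proof -
  note N1 = banach_on_normed_on[OF E1(1)]
  show X: "banach_on J (F E0 E1)"
    using F couples(2) by (auto simp: interpolation_functor_def)
  have emb: "cont_embedded (F E0 E1) (sum_space E0 E1)"
    using F couples(2) by (auto simp: interpolation_functor_def)
  obtain c1 where c1: "0 < c1" "\<And>x. x \<in> car E1 \<Longrightarrow> norm x \<le> c1 * nrm E1 x" using E1_norm by blast
  obtain d where d: "0 < d" "\<And>x. x \<in> car (F E0 E1) \<Longrightarrow> x \<in> car (sum_space E0 E1) \<and> nrm (sum_space E0 E1) x \<le> d * nrm (F E0 E1) x"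
    using cont_embedded_const[OF emb nrm_nonneg[OF banach_on_normed_on[OF X]]] by blast
  have low: "norm x \<le> ((1 + c1) * d) * nrm (F E0 E1) x" if x: "x \<in> car (F E0 E1)" for x
  proof -
    have "norm x \<le> (1 + c1) * nrm (sum_space E0 E1) x"
    proof (rule sum_space_lower_bound)
      show "x \<in> car (sum_space E0 E1)" using d(2)[OF x] by simp
      fix y z assume z: "z \<in> car E1"
      have "norm (y + z) \<le> norm y + c1 * nrm E1 z" using norm_triangle_ineq[of y z] c1(2)[OF z] by linarith
      also have "\<dots> \<le> (1 + c1) * (nrm E0 y + nrm E1 z)"
        using c1(1) nrm_nonneg[OF N1 z] by (simp add: algebra_simps)
      finally show "norm (y + z) \<le> (1 + c1) * (nrm E0 y + nrm E1 z)" .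
    qed (use c1 in simp)
    also have "\<dots> \<le> (1 + c1) * (d * nrm (F E0 E1) x)" using d(2)[OF x] c1 by (intro mult_left_mono) auto
    finally show ?thesis by simp
  qed
  then show "\<exists>c\<ge>0. \<forall>x\<in>car (F E0 E1). norm x \<le> c * nrm (F E0 E1) x"
    using c1 d by (intro exI[of _ "(1 + c1) * d"]) auto
qed

text \<open>
  The two interpolation estimates that are used: for operators from \<open>E0\<close> into \<open>E1\<close>, interpolated in
  the target space, and for operators into \<open>E1\<close> that act on \<open>E0\<close> and \<open>E1\<close>, interpolated in the
  source space. Stated as properties of \<open>X\<close>, they cover the endpoint \<open>X = E1\<close> together with the functors.
\<close>

definition interp_from_E0 :: "'a nspace \<Rightarrow> real \<Rightarrow> real \<Rightarrow> bool" where
  "interp_from_E0 X \<theta> c \<longleftrightarrow> 0 \<le> c \<and> (\<forall>L B0 B1. lin_on J UNIV L \<longrightarrow> 0 < B0 \<longrightarrow> 0 \<le> B1 \<longrightarrow>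
     (\<forall>x. norm (L x) \<le> B0 * norm x) \<longrightarrow> (\<forall>x. L x \<in> car E1 \<and> nrm E1 (L x) \<le> B1 * norm x) \<longrightarrow>
     (\<forall>x. L x \<in> car X \<and> nrm X (L x) \<le> c * (B0 powr (1 - \<theta>) * B1 powr \<theta>) * norm x))"

definition interp_to_E1 :: "'a nspace \<Rightarrow> real \<Rightarrow> real \<Rightarrow> bool" where
  "interp_to_E1 X \<theta> c \<longleftrightarrow> 0 \<le> c \<and> (\<forall>L B0 B1. lin_on J UNIV L \<longrightarrow> 0 < B0 \<longrightarrow> 0 \<le> B1 \<longrightarrow>
     (\<forall>x. L x \<in> car E1 \<and> nrm E1 (L x) \<le> B0 * norm x) \<longrightarrow> (\<forall>x\<in>car E1. nrm E1 (L x) \<le> B1 * nrm E1 x) \<longrightarrow>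
     (\<forall>x\<in>car X. nrm E1 (L x) \<le> c * (B0 powr (1 - \<theta>) * B1 powr \<theta>) * nrm X x))"

text \<open>
  The functor applied to the couples \<open>(E0, E0)\<close> and \<open>(E0, E1)\<close>; the interpolation space of the
  constant couple contains \<open>E0\<close> continuously.
\<close>

lemma functor_smoothing_from_E0:
  assumes F: "interpolation_functor J \<theta> F"
  shows "\<exists>c. interp_from_E0 (F E0 E1) \<theta> c"
proof -
  obtain c where c: "c \<ge> 0" "\<And>L B0 B1. lin_on J (car (sum_space E0 E0)) L \<Longrightarrow> op_bound E0 E0 L B0 \<Longrightarrow>
      op_bound E0 E1 L B1 \<Longrightarrow> op_bound (F E0 E0) (F E0 E1) L (c * B0 powr (1 - \<theta>) * B1 powr \<theta>)"
    using F couples unfolding interpolation_functor_def by meson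
  have "cont_embedded (inter_space E0 E0) (F E0 E0)"
    using F couples(1) by (auto simp: interpolation_functor_def)
  then obtain d where d: "0 < d" "\<And>x. x \<in> car (F E0 E0) \<and> nrm (F E0 E0) x \<le> d * norm x"
    using cont_embedded_const[of "inter_space E0 E0" "F E0 E0"] by (auto simp: inter_space_def)
  have "L x \<in> car (F E0 E1) \<and> nrm (F E0 E1) (L x) \<le> (c * d) * (B0 powr (1 - \<theta>) * B1 powr \<theta>) * norm x"
    if L: "lin_on J UNIV L" "0 < B0" "0 \<le> B1" "\<And>x. norm (L x) \<le> B0 * norm x"
      "\<And>x. L x \<in> car E1 \<and> nrm E1 (L x) \<le> B1 * norm x" for L B0 B1 x
  proof -
    have "op_bound (F E0 E0) (F E0 E1) L (c * B0 powr (1 - \<theta>) * B1 powr \<theta>)"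
      by (rule c(2)) (use L lin_on_subset in \<open>auto simp: op_bound_def\<close>)
    then have 1: "L x \<in> car (F E0 E1)" "nrm (F E0 E1) (L x) \<le> (c * B0 powr (1 - \<theta>) * B1 powr \<theta>) * nrm (F E0 E0) x"
      using d(2)[of x] by (auto simp: op_bound_def)
    note 1(2)
    also have "(c * B0 powr (1 - \<theta>) * B1 powr \<theta>) * nrm (F E0 E0) x \<le> (c * B0 powr (1 - \<theta>) * B1 powr \<theta>) * (d * norm x)"
      using d(2)[of x] c(1) by (intro mult_left_mono) auto
    finally show ?thesis using 1(1) by (simp add: mult_ac)
  qed
  moreover have "0 \<le> c * d" using c d by simp
  ultimately have "interp_from_E0 (F E0 E1) \<theta> (c * d)" unfolding interp_from_E0_def by blast
  then show ?thesis ..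
qed

text \<open>
  The functor applied to the couples \<open>(E0, E1)\<close> and \<open>(E1, E1)\<close>; the interpolation space of the
  constant couple embeds continuously into \<open>E1\<close>.
\<close>

lemma functor_smoothing_to_E1:
  assumes F: "interpolation_functor J \<theta> F"
  shows "\<exists>c. interp_to_E1 (F E0 E1) \<theta> c"
proof -
  note N1 = banach_on_normed_on[OF E1(1)]
  obtain c where c: "c \<ge> 0" "\<And>L B0 B1. lin_on J (car (sum_space E0 E1)) L \<Longrightarrow> op_bound E0 E1 L B0 \<Longrightarrow>
      op_bound E1 E1 L B1 \<Longrightarrow> op_bound (F E0 E1) (F E1 E1) L (c * B0 powr (1 - \<theta>) * B1 powr \<theta>)"
    using F couples unfolding interpolation_functor_def by meson
  have emb: "banach_on J (F E1 E1)" "cont_embedded (F E1 E1) (sum_space E1 E1)"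
    using F couples(3) by (auto simp: interpolation_functor_def)
  obtain d where d: "0 < d" "\<And>x. x \<in> car (F E1 E1) \<Longrightarrow> x \<in> car (sum_space E1 E1) \<and> nrm (sum_space E1 E1) x \<le> d * nrm (F E1 E1) x"
    using cont_embedded_const[OF emb(2) nrm_nonneg[OF banach_on_normed_on[OF emb(1)]]] by blast
  have "nrm E1 (L x) \<le> (d * c) * (B0 powr (1 - \<theta>) * B1 powr \<theta>) * nrm (F E0 E1) x"
    if L: "lin_on J UNIV L" "0 < B0" "0 \<le> B1" "\<And>x. L x \<in> car E1 \<and> nrm E1 (L x) \<le> B0 * norm x"
      "\<And>x. x \<in> car E1 \<Longrightarrow> nrm E1 (L x) \<le> B1 * nrm E1 x" and x: "x \<in> car (F E0 E1)" for L B0 B1 x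
  proof -
    have "op_bound (F E0 E1) (F E1 E1) L (c * B0 powr (1 - \<theta>) * B1 powr \<theta>)"
      by (rule c(2)) (use L lin_on_subset in \<open>auto simp: op_bound_def\<close>)
    then have 1: "L x \<in> car (F E1 E1)" "nrm (F E1 E1) (L x) \<le> (c * B0 powr (1 - \<theta>) * B1 powr \<theta>) * nrm (F E0 E1) x"
      using x by (auto simp: op_bound_def)
    have "nrm E1 (L x) \<le> 1 * nrm (sum_space E1 E1) (L x)"
      by (rule sum_space_lower_bound) (use d(2)[OF 1(1)] nrm_triangle[OF N1] in auto)
    also have "\<dots> \<le> d * nrm (F E1 E1) (L x)" using d(2)[OF 1(1)] by simp
    also have "\<dots> \<le> d * ((c * B0 powr (1 - \<theta>) * B1 powr \<theta>) * nrm (F E0 E1) x)"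
      using 1(2) d(1) by (intro mult_left_mono) auto
    finally show ?thesis by (simp add: mult_ac)
  qed
  moreover have "0 \<le> d * c" using c d by simp
  ultimately have "interp_to_E1 (F E0 E1) \<theta> (d * c)" unfolding interp_to_E1_def by blast
  then show ?thesis ..
qed

lemma interp_space_facts:
  assumes F: "\<forall>\<eta>. 0 < \<eta> \<longrightarrow> \<eta> < 1 \<longrightarrow> interpolation_functor J \<eta> (F \<eta>)" and \<theta>: "0 < \<theta>" "\<theta> \<le> 1"
  defines "X \<equiv> interp_space F E0 E1 \<theta>"
  shows "banach_on J X"
    and "\<exists>c\<ge>0. \<forall>x\<in>car X. norm x \<le> c * nrm X x"
    and "\<exists>c. interp_from_E0 X \<theta> c"
    and "\<exists>c. interp_to_E1 X \<theta> c"
proof -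
  have X: "X = (if \<theta> = 1 then E1 else F \<theta> E0 E1)" using \<theta> by (simp add: X_def interp_space_def)
  have G: "interpolation_functor J \<theta> (F \<theta>)" if "\<theta> \<noteq> 1" using F \<theta> that by simp
  show "banach_on J X" using E1(1) functor_embeddings(1)[OF G] by (simp add: X)
  show "\<exists>c\<ge>0. \<forall>x\<in>car X. norm x \<le> c * nrm X x"
  proof (cases "\<theta> = 1")
    case True
    obtain c where "0 < c" "\<And>x. x \<in> car E1 \<Longrightarrow> norm x \<le> c * nrm E1 x" using E1_norm by blast
    with True show ?thesis by (auto simp: X intro!: exI[of _ c])
  qed (simp add: X functor_embeddings(2)[OF G])
  show "\<exists>c. interp_from_E0 X \<theta> c"
  proof (cases "\<theta> = 1")
    case True then show ?thesis by (auto simp: X interp_from_E0_def intro!: exI[of _ 1])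
  qed (simp add: X functor_smoothing_from_E0[OF G])
  show "\<exists>c. interp_to_E1 X \<theta> c"
  proof (cases "\<theta> = 1")
    case True then show ?thesis by (auto simp: X interp_to_E1_def intro!: exI[of _ 1])
  qed (simp add: X functor_smoothing_to_E1[OF G])
qed

end

section \<open>Weighted spaces of continuous functions\<close>

lemma eventually_at_withinI:
  assumes "\<And>s. s \<in> I \<Longrightarrow> P s"
  shows "\<forall>\<^sub>F s in at t within I. P s"
  unfolding eventually_at_filter by (rule always_eventually) (use assms in blast)

lemma Cmu_car: "u \<in> Cmu \<mu> T X \<Longrightarrow> 0 < t \<Longrightarrow> t \<le> T \<Longrightarrow> u t \<in> car X"
  by (simp add: Cmu_def cont_into_def)

lemma cont_into_norm_continuous:
  assumes N: "normed_on J X" and u: "cont_into I X u"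
  shows "continuous_on I (\<lambda>t. nrm X (u t))"
  unfolding continuous_on_def
proof
  fix t assume t: "t \<in> I"
  have car: "u s \<in> car X" if "s \<in> I" for s using u that by (simp add: cont_into_def)
  have "((\<lambda>s. nrm X (u s) - nrm X (u t)) \<longlongrightarrow> 0) (at t within I)"
  proof (rule Lim_null_comparison)
    have "norm (nrm X (u s) - nrm X (u t)) \<le> nrm X (u s - u t)" if "s \<in> I" for s
    proof -
      note c = car[OF that] car[OF t]
      have "nrm X (u s) \<le> nrm X (u s - u t) + nrm X (u t)"
        using nrm_triangle[OF N normed_on_diff[OF N c] c(2)] by simp
      moreover have "nrm X (u t) \<le> nrm X (u t - u s) + nrm X (u s)"
        using nrm_triangle[OF N normed_on_diff[OF N c(2,1)] c(1)] by simp
      ultimately show ?thesis using nrm_minus_commute[OF N c] by simp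
    qed
    then show "\<forall>\<^sub>F s in at t within I. norm (nrm X (u s) - nrm X (u t)) \<le> nrm X (u s - u t)"
      by (rule eventually_at_withinI)
    show "((\<lambda>s. nrm X (u s - u t)) \<longlongrightarrow> 0) (at t within I)" using u t by (simp add: cont_into_def)
  qed
  then show "((\<lambda>t. nrm X (u t)) \<longlongrightarrow> nrm X (u t)) (at t within I)" by (simp add: LIM_zero_iff)
qed

text \<open>
  Makes the supremum in the weighted norm a genuine one: the weighted norm function is
  continuous on \<open>(0, T]\<close> and vanishes at \<open>0\<close>.
\<close>

lemma Cmu_bdd_above:
  assumes N: "normed_on J X" and T: "0 < T" and u: "u \<in> Cmu \<mu> T X"
  shows "bdd_above ((\<lambda>t. t powr \<mu> * nrm X (u t)) ` {0<..T})"
proof -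
  define \<phi> where "\<phi> t = t powr \<mu> * nrm X (u t)" for t
  have c: "continuous_on {0<..T} \<phi>"
    unfolding \<phi>_def[abs_def] using u
    by (intro continuous_on_mult cont_into_norm_continuous[OF N] continuous_on_powr continuous_on_id continuous_on_const) (auto simp: Cmu_def)
  have "(\<phi> \<longlongrightarrow> 0) (at 0 within {0<..T})" using u by (simp add: Cmu_def \<phi>_def[abs_def])
  from order_tendstoD(2)[OF this zero_less_one]
  obtain d where d: "0 < d" "\<And>t. t \<in> {0<..T} \<Longrightarrow> t < d \<Longrightarrow> \<phi> t < 1"
    by (auto simp: eventually_at dist_real_def)
  have "continuous_on {min d T..T} \<phi>" by (rule continuous_on_subset[OF c]) (use d T in auto)
  then have "bounded (\<phi> ` {min d T..T})" by (intro compact_imp_bounded compact_continuous_image) auto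
  then obtain B where "\<forall>t\<in>{min d T..T}. \<bar>\<phi> t\<bar> \<le> B" by (auto simp: bounded_iff)
  then have B: "\<And>t. t \<in> {min d T..T} \<Longrightarrow> \<bar>\<phi> t\<bar> \<le> B" by blast
  have "\<phi> t \<le> max B 1" if "t \<in> {0<..T}" for t
    using d(2)[OF that] B[of t] that by (cases "t < d") auto
  then show ?thesis unfolding \<phi>_def[abs_def] bdd_above_def by (auto intro!: exI[of _ "max B 1"] simp: \<phi>_def)
qed

lemma Cmu_norm_upper:
  assumes "normed_on J X" "0 < T" "u \<in> Cmu \<mu> T X" "0 < t" "t \<le> T"
  shows "t powr \<mu> * nrm X (u t) \<le> Cmu_norm \<mu> T X u"
  unfolding Cmu_norm_def by (rule cSUP_upper[OF _ Cmu_bdd_above[OF assms(1-3)]]) (use assms in auto)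

lemma Cmu_norm_least:
  assumes "0 < T" "\<And>t. 0 < t \<Longrightarrow> t \<le> T \<Longrightarrow> t powr \<mu> * nrm X (u t) \<le> B"
  shows "Cmu_norm \<mu> T X u \<le> B"
  unfolding Cmu_norm_def by (rule cSUP_least) (use assms in auto)

lemma Cmu_norm_cong:
  assumes "\<And>t. 0 < t \<Longrightarrow> t \<le> T \<Longrightarrow> u t = v t"
  shows "Cmu_norm \<mu> T X u = Cmu_norm \<mu> T X v"
  unfolding Cmu_norm_def by (rule SUP_cong) (use assms in auto)

lemma Cmu_norm_nonneg:
  assumes "normed_on J X" "0 < T" "u \<in> Cmu \<mu> T X"
  shows "0 \<le> Cmu_norm \<mu> T X u"
  using Cmu_norm_upper[OF assms assms(2)] nrm_nonneg[OF assms(1) Cmu_car[OF assms(3,2)]]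
  by (meson mult_nonneg_nonneg order_refl order_trans powr_ge_zero)

lemma Cmu_zero:
  assumes "normed_on J X" shows "(\<lambda>_. 0) \<in> Cmu \<mu> T X"
  using normed_on_zero[OF assms] nrm_zero[OF assms] by (simp add: Cmu_def cont_into_def)

lemma Cmu_diff:
  assumes N: "normed_on J X" and u: "u \<in> Cmu \<mu> T X" and v: "v \<in> Cmu \<mu> T X"
  shows "(\<lambda>t. u t - v t) \<in> Cmu \<mu> T X"
proof -
  have c: "u t \<in> car X" "v t \<in> car X" if "t \<in> {0<..T}" for t using Cmu_car u v that by auto
  have "cont_into {0<..T} X (\<lambda>t. u t - v t)"
    unfolding cont_into_def
  proof (intro ballI conjI)
    fix t assume t: "t \<in> {0<..T}"
    show "u t - v t \<in> car X" by (rule normed_on_diff[OF N c[OF t]])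
    show "((\<lambda>s. nrm X (u s - v s - (u t - v t))) \<longlongrightarrow> 0) (at t within {0<..T})"
    proof (rule tendsto_sandwich[OF _ _ tendsto_const])
      have eq: "u s - v s - (u t - v t) = (u s - u t) - (v s - v t)" for s by simp
      have bnd: "0 \<le> nrm X (u s - v s - (u t - v t)) \<and> nrm X (u s - v s - (u t - v t)) \<le> nrm X (u s - u t) + nrm X (v s - v t)"
        if s: "s \<in> {0<..T}" for s
      proof -
        note d = normed_on_diff[OF N c(1)[OF s] c(1)[OF t]] normed_on_diff[OF N c(2)[OF s] c(2)[OF t]]
        show ?thesis unfolding eq using nrm_nonneg[OF N normed_on_diff[OF N d]] nrm_triangle_diff[OF N d] by blast
      qed
      show "\<forall>\<^sub>F s in at t within {0<..T}. 0 \<le> nrm X (u s - v s - (u t - v t))"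
        "\<forall>\<^sub>F s in at t within {0<..T}. nrm X (u s - v s - (u t - v t)) \<le> nrm X (u s - u t) + nrm X (v s - v t)"
        by (rule eventually_at_withinI, use bnd in blast)+
      show "((\<lambda>s. nrm X (u s - u t) + nrm X (v s - v t)) \<longlongrightarrow> 0) (at t within {0<..T})"
        using u v t by (intro tendsto_add_zero) (auto simp: Cmu_def cont_into_def)
    qed
  qed
  moreover have "((\<lambda>t. t powr \<mu> * nrm X (u t - v t)) \<longlongrightarrow> 0) (at 0 within {0<..T})"
  proof (rule tendsto_sandwich[OF _ _ tendsto_const])
    have bnd: "0 \<le> s powr \<mu> * nrm X (u s - v s) \<and> s powr \<mu> * nrm X (u s - v s) \<le> s powr \<mu> * nrm X (u s) + s powr \<mu> * nrm X (v s)"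
      if s: "s \<in> {0<..T}" for s
    proof -
      have "nrm X (u s - v s) \<le> nrm X (u s) + nrm X (v s)" by (rule nrm_triangle_diff[OF N c[OF s]])
      from mult_left_mono[OF this, of "s powr \<mu>"] nrm_nonneg[OF N normed_on_diff[OF N c[OF s]]]
      show ?thesis by (simp add: distrib_left)
    qed
    show "\<forall>\<^sub>F s in at 0 within {0<..T}. 0 \<le> s powr \<mu> * nrm X (u s - v s)"
      "\<forall>\<^sub>F s in at 0 within {0<..T}. s powr \<mu> * nrm X (u s - v s) \<le> s powr \<mu> * nrm X (u s) + s powr \<mu> * nrm X (v s)"
      by (rule eventually_at_withinI, use bnd in blast)+
    show "((\<lambda>s. s powr \<mu> * nrm X (u s) + s powr \<mu> * nrm X (v s)) \<longlongrightarrow> 0) (at 0 within {0<..T})"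
      using u v by (intro tendsto_add_zero) (auto simp: Cmu_def)
  qed
  ultimately show ?thesis by (simp add: Cmu_def)
qed

lemma Cmu_norm_triangle:
  assumes N: "normed_on J X" and T: "0 < T" and u: "u \<in> Cmu \<mu> T X" and v: "v \<in> Cmu \<mu> T X"
  shows "Cmu_norm \<mu> T X u \<le> Cmu_norm \<mu> T X (\<lambda>t. u t - v t) + Cmu_norm \<mu> T X v"
proof (rule Cmu_norm_least[OF T])
  fix t assume t: "0 < t" "t \<le> T"
  have "nrm X (u t) \<le> nrm X (u t - v t) + nrm X (v t)"
    using nrm_triangle[OF N normed_on_diff[OF N], of "u t" "v t" "v t"] Cmu_car[OF u t] Cmu_car[OF v t] by simp
  then have "t powr \<mu> * nrm X (u t) \<le> t powr \<mu> * nrm X (u t - v t) + t powr \<mu> * nrm X (v t)"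
    unfolding distrib_left[symmetric] by (rule mult_left_mono) simp
  with Cmu_norm_upper[OF N T Cmu_diff[OF N u v] t] Cmu_norm_upper[OF N T v t]
  show "t powr \<mu> * nrm X (u t) \<le> Cmu_norm \<mu> T X (\<lambda>t. u t - v t) + Cmu_norm \<mu> T X v" by linarith
qed

lemma Cmu_norm_zero_imp_eq:
  assumes N: "normed_on J X" and T: "0 < T" and u: "u \<in> Cmu \<mu> T X" and v: "v \<in> Cmu \<mu> T X"
    and z: "Cmu_norm \<mu> T X (\<lambda>t. u t - v t) \<le> 0" and t: "0 < t" "t \<le> T"
  shows "u t = v t"
proof -
  have c: "u t - v t \<in> car X" using Cmu_car[OF Cmu_diff[OF N u v] t] .
  have "t powr \<mu> * nrm X (u t - v t) \<le> 0" using Cmu_norm_upper[OF N T Cmu_diff[OF N u v] t] z by linarith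
  then have "nrm X (u t - v t) \<le> 0" using t by (simp add: mult_le_0_iff)
  then show ?thesis using nrm_nonneg[OF N c] nrm_eq_0[OF N c] by simp
qed

text \<open>
  Convergence is pointwise with the rate \<open>t\<^bsup>- \<mu>\<^esup> c / 2\<^bsup>n\<^esup>\<close>, hence uniform near each \<open>t > 0\<close> and uniform in
  the weighted sense at \<open>0\<close>; so continuity and the vanishing at \<open>0\<close> pass to the limit.
\<close>

lemma Cmu_geometric_limit:
  assumes X: "banach_on J X" and T: "0 < T" and u: "\<And>n. u n \<in> Cmu \<mu> T X"
    and step: "\<And>n. Cmu_norm \<mu> T X (\<lambda>t. u (Suc n) t - u n t) \<le> c / 2 ^ n"
  shows "\<exists>v\<in>Cmu \<mu> T X. \<forall>n. Cmu_norm \<mu> T X (\<lambda>t. u n t - v t) \<le> 2 * c / 2 ^ n"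
proof -
  note N = banach_on_normed_on[OF X]
  have "\<exists>x\<in>car X. \<forall>n. nrm X (u n t - x) \<le> 2 * (c * t powr (- \<mu>)) / 2 ^ n" if t: "t \<in> {0<..T}" for t
  proof (rule banach_on_geometric_limit[OF X])
    show "u n t \<in> car X" for n using Cmu_car[OF u] t by simp
    fix n
    have "t powr \<mu> * nrm X (u (Suc n) t - u n t) \<le> c / 2 ^ n"
      using Cmu_norm_upper[OF N T Cmu_diff[OF N u u], of t "Suc n" n] step[of n] t by auto
    then show "nrm X (u (Suc n) t - u n t) \<le> c * t powr (- \<mu>) / 2 ^ n"
      using t by (simp add: powr_minus field_simps)
  qed
  then obtain v where v: "\<And>t. t \<in> {0<..T} \<Longrightarrow> v t \<in> car X"
    "\<And>t n. t \<in> {0<..T} \<Longrightarrow> nrm X (u n t - v t) \<le> 2 * (c * t powr (- \<mu>)) / 2 ^ n"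
    by metis
  have uc: "u n t \<in> car X" if "t \<in> {0<..T}" for n t using Cmu_car[OF u] that by simp
  have close: "t powr \<mu> * nrm X (u n t - v t) \<le> 2 * c / 2 ^ n" if t: "t \<in> {0<..T}" for t n
  proof -
    have "t powr \<mu> * nrm X (u n t - v t) \<le> t powr \<mu> * (2 * (c * t powr (- \<mu>)) / 2 ^ n)"
      by (intro mult_left_mono v(2) t) simp
    also have "\<dots> = 2 * c / 2 ^ n" using t by (simp add: powr_minus field_simps)
    finally show ?thesis .
  qed
  have c0: "0 \<le> c"
    using step[of 0] Cmu_norm_nonneg[OF N T Cmu_diff[OF N u u], of "Suc 0" 0] by simp
  have small: "\<exists>n. K * (2 * c / 2 ^ n) < e" if "0 < e" for K e :: real
  proof -
    have "(\<lambda>n. K * (2 * c) * (1 / 2) ^ n) \<longlonglongrightarrow> K * (2 * c) * 0"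
      by (intro tendsto_mult tendsto_const LIMSEQ_realpow_zero) auto
    then have "\<forall>\<^sub>F n in sequentially. K * (2 * c) * (1 / 2) ^ n < e" using that by (intro order_tendstoD) auto
    then show ?thesis unfolding eventually_sequentially by (auto simp: power_divide)
  qed
  have cont: "((\<lambda>s. nrm X (v s - v t)) \<longlongrightarrow> 0) (at t within {0<..T})" if t: "t \<in> {0<..T}" for t
  proof (rule tendstoI)
    fix e :: real assume e: "0 < e"
    define K where "K = (t/2) powr (- \<mu>) + (2*t) powr (- \<mu>)"
    have K: "s powr (- \<mu>) \<le> K" if "t/2 < s" "s < 2*t" for s
    proof (cases "0 \<le> - \<mu>")
      case True
      then have "s powr (- \<mu>) \<le> (2*t) powr (- \<mu>)" using that t by (intro powr_mono2) auto
      then show ?thesis by (simp add: K_def add_increasing)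
    next
      case False
      then have "s powr (- \<mu>) \<le> (t/2) powr (- \<mu>)" using that t by (intro powr_mono2') auto
      then show ?thesis by (simp add: K_def add_increasing2)
    qed
    obtain n where n: "K * (2 * c / 2 ^ n) < e / 3" using small[of "e / 3" K] e by auto
    have nv: "nrm X (u n s - v s) < e / 3" if "s \<in> {0<..T}" "t/2 < s" "s < 2*t" for s
    proof -
      have "nrm X (u n s - v s) \<le> s powr (- \<mu>) * (2 * c / 2 ^ n)" using v(2)[OF that(1), of n] by (simp add: mult_ac)
      also have "\<dots> \<le> K * (2 * c / 2 ^ n)" using K[OF that(2,3)] c0 by (intro mult_right_mono) auto
      finally show ?thesis using n by linarith
    qed
    have "((\<lambda>s. nrm X (u n s - u n t)) \<longlongrightarrow> 0) (at t within {0<..T})"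
      using u[of n] t by (simp add: Cmu_def cont_into_def)
    from order_tendstoD(2)[OF this, of "e / 3"] e
    have 1: "\<forall>\<^sub>F s in at t within {0<..T}. nrm X (u n s - u n t) < e / 3" by simp
    have 2: "\<forall>\<^sub>F s in at t within {0<..T}. s \<in> {0<..T}" by (simp add: eventually_at_filter)
    have id: "((\<lambda>s. s) \<longlongrightarrow> t) (at t within {0<..T})" by (rule tendsto_ident_at)
    have 3: "\<forall>\<^sub>F s in at t within {0<..T}. t/2 < s" "\<forall>\<^sub>F s in at t within {0<..T}. s < 2*t"
      using order_tendstoD(1)[OF id, of "t/2"] order_tendstoD(2)[OF id, of "2*t"] t by auto
    from 1 2 3 show "\<forall>\<^sub>F s in at t within {0<..T}. dist (nrm X (v s - v t)) 0 < e"
    proof eventually_elim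
      case (elim s)
      have "nrm X (v s - v t) \<le> nrm X (v s - u n s) + nrm X (u n s - v t)"
        by (rule nrm_triangle_dist[OF N v(1)[OF elim(2)] uc[OF elim(2)] v(1)[OF t]])
      also have "nrm X (u n s - v t) \<le> nrm X (u n s - u n t) + nrm X (u n t - v t)"
        by (rule nrm_triangle_dist[OF N uc[OF elim(2)] uc[OF t] v(1)[OF t]])
      finally have "nrm X (v s - v t) < e"
        using nv[OF elim(2-4)] nv[of t] t elim(1) nrm_minus_commute[OF N v(1)[OF elim(2)] uc[OF elim(2)], of n] by simp
      then show ?case using nrm_nonneg[OF N normed_on_diff[OF N v(1)[OF elim(2)] v(1)[OF t]]] by simp
    qed
  qed
  have van: "((\<lambda>t. t powr \<mu> * nrm X (v t)) \<longlongrightarrow> 0) (at 0 within {0<..T})"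
  proof (rule tendstoI)
    fix e :: real assume e: "0 < e"
    obtain n where n: "1 * (2 * c / 2 ^ n) < e / 2" using small[of "e / 2" 1] e by auto
    have "((\<lambda>t. t powr \<mu> * nrm X (u n t)) \<longlongrightarrow> 0) (at 0 within {0<..T})"
      using u[of n] by (simp add: Cmu_def)
    from order_tendstoD(2)[OF this, of "e / 2"] e
    have 1: "\<forall>\<^sub>F t in at 0 within {0<..T}. t powr \<mu> * nrm X (u n t) < e / 2" by simp
    have 2: "\<forall>\<^sub>F s in at 0 within {0<..T}. s \<in> {0<..T}" by (simp add: eventually_at_filter)
    from 1 2 show "\<forall>\<^sub>F t in at 0 within {0<..T}. dist (t powr \<mu> * nrm X (v t)) 0 < e"
    proof eventually_elim
      case (elim t)
      have "nrm X (v t) \<le> nrm X (u n t) + nrm X (u n t - v t)"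
        using nrm_triangle_diff[OF N uc[OF elim(2)] normed_on_diff[OF N uc[OF elim(2)] v(1)[OF elim(2)]], of n n] by simp
      then have "t powr \<mu> * nrm X (v t) \<le> t powr \<mu> * nrm X (u n t) + t powr \<mu> * nrm X (u n t - v t)"
        unfolding distrib_left[symmetric] by (rule mult_left_mono) simp
      then have "t powr \<mu> * nrm X (v t) < e" using close[OF elim(2), of n] elim(1) n by simp
      then show ?case using nrm_nonneg[OF N v(1)[OF elim(2)]] by simp
    qed
  qed
  have "v \<in> Cmu \<mu> T X" using v(1) cont van by (simp add: Cmu_def cont_into_def)
  moreover have "Cmu_norm \<mu> T X (\<lambda>t. u n t - v t) \<le> 2 * c / 2 ^ n" for n
    by (rule Cmu_norm_least[OF T]) (use close in auto)
  ultimately show ?thesis by blast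
qed

section \<open>The semilinear problem as a fixed point equation\<close>

text \<open>
  \<open>X\<close> and \<open>Y\<close> stand for \<open>E\<^sub>\<theta>\<close> and \<open>E\<^sub>\<gamma>\<close>. The assumption on \<open>X\<close> with the free parameter \<open>t\<close> is the
  additive form of the interpolation inequality; for the weighted estimates it is applied with \<open>t\<close>
  the current time.
\<close>

locale semilinear_average = average_problem S D R lam T C \<gamma> \<nu> a b b'
  for S D :: "real \<Rightarrow> 'a::banach \<Rightarrow> 'a" and R :: "'a \<Rightarrow> 'a" and lam T C \<gamma> \<nu> a :: real
    and b b' :: "real \<Rightarrow> real" +
  fixes J :: "('a \<Rightarrow> 'a) option" and X Y :: "'a nspace" and \<theta> cX \<kappa> l cT :: real
    and f :: "(real \<Rightarrow> 'a) \<Rightarrow> (real \<Rightarrow> 'a)"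
  assumes X: "banach_on J X" and cX: "0 \<le> cX" and \<theta>: "0 < \<theta>"
    and X_le: "\<And>x. x \<in> car X \<Longrightarrow> norm x \<le> cX * nrm X x"
    and X_R: "\<And>t y. 0 < t \<Longrightarrow> t \<le> T \<Longrightarrow>
       R y \<in> car X \<and> nrm X (R y) \<le> cX * (t powr (- \<theta>) * norm (R y) + t powr (1 - \<theta>) * norm y)"
    and R_dense: "\<And>x e. 0 < e \<Longrightarrow> \<exists>y. norm (R y - x) < e"
    and Y: "banach_on J Y" and \<kappa>: "0 \<le> \<kappa>"
    and Y_forcing: "\<And>g. g \<in> Cmu \<nu> T Y \<Longrightarrow> forcing (\<kappa> * Cmu_norm \<nu> T Y g) g"
    and l: "0 < l" and cT: "0 < cT"
    and f_maps: "\<And>v. v \<in> Cmu \<theta> T X \<Longrightarrow> f v \<in> Cmu \<nu> T Y"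
    and f_zero: "\<And>t. t \<in> {0<..T} \<Longrightarrow> f (\<lambda>_. 0) t = 0"
    and f_local: "\<And>L v w. 0 < L \<Longrightarrow> L < 1 \<Longrightarrow> v \<in> Cmu \<theta> T X \<Longrightarrow> w \<in> Cmu \<theta> T X \<Longrightarrow>
       Cmu_norm \<theta> T X v + Cmu_norm \<theta> T X w \<le> L \<Longrightarrow>
       (\<forall>t\<in>{0<..T}. norm (v t) + norm (w t) \<le> L) \<Longrightarrow>
       Cmu_norm \<nu> T Y (\<lambda>t. f v t - f w t) \<le> cT * L powr l * Cmu_norm \<theta> T X (\<lambda>t. v t - w t)"
begin

lemma NX: "normed_on J X" and NY: "normed_on J Y"
  by (rule banach_on_normed_on[OF X], rule banach_on_normed_on[OF Y])

lemma weighted_X_R: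
  assumes t: "0 < t" "t \<le> T"
  shows "t powr \<theta> * nrm X (R y) \<le> cX * (norm (R y) + t * norm y)"
proof -
  have "t powr \<theta> * nrm X (R y) \<le> t powr \<theta> * (cX * (t powr (- \<theta>) * norm (R y) + t powr (1 - \<theta>) * norm y))"
    using X_R[OF t, of y] by (intro mult_left_mono) auto
  also have "\<dots> = cX * ((t powr \<theta> * t powr (- \<theta>)) * norm (R y) + (t powr \<theta> * t powr (1 - \<theta>)) * norm y)"
    by (simp add: algebra_simps)
  also have "t powr \<theta> * t powr (- \<theta>) = 1" using t by (simp flip: powr_add)
  also have "t powr \<theta> * t powr (1 - \<theta>) = t" using t by (simp flip: powr_add)
  finally show ?thesis by simp
qed

lemma X_R_lift: obtains c where "0 \<le> c" "\<And>y. R y \<in> car X" "\<And>y. nrm X (R y) \<le> c * norm y"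
proof
  define c where "c = cX * (T powr (- \<theta>) * onorm R + T powr (1 - \<theta>))"
  show "0 \<le> c" unfolding c_def using cX onorm_pos_le[OF R_linear] by simp
  show "R y \<in> car X" for y using X_R[OF T_pos order_refl] by blast
  show "nrm X (R y) \<le> c * norm y" for y
  proof -
    have "nrm X (R y) \<le> cX * (T powr (- \<theta>) * norm (R y) + T powr (1 - \<theta>) * norm y)"
      using X_R[OF T_pos order_refl] by blast
    also have "\<dots> \<le> cX * (T powr (- \<theta>) * (onorm R * norm y) + T powr (1 - \<theta>) * norm y)"
      using onorm[OF R_linear, of y] cX by (intro mult_left_mono add_right_mono) auto
    also have "\<dots> = c * norm y" by (simp add: c_def algebra_simps)
    finally show ?thesis .
  qed
qed

lemma cont_into_X_R:
  assumes y: "continuous_on I y" and u: "\<And>t. t \<in> I \<Longrightarrow> u t = R (y t)"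
  shows "cont_into I X u"
  unfolding cont_into_def
proof (intro ballI conjI)
  obtain c where c: "0 \<le> c" "\<And>y. R y \<in> car X" "\<And>y. nrm X (R y) \<le> c * norm y" using X_R_lift by blast
  fix t assume t: "t \<in> I"
  show "u t \<in> car X" using c(2) u[OF t] by simp
  show "((\<lambda>s. nrm X (u s - u t)) \<longlongrightarrow> 0) (at t within I)"
  proof (rule tendsto_sandwich[OF _ _ tendsto_const])
    have bnd: "0 \<le> nrm X (u s - u t) \<and> nrm X (u s - u t) \<le> c * norm (y s - y t)" if "s \<in> I" for s
      using c(3)[of "y s - y t"] nrm_nonneg[OF NX c(2)[of "y s - y t"]] u[OF t] u[OF that]
      by (simp add: linear_simps(2)[OF R_linear])
    show "\<forall>\<^sub>F s in at t within I. 0 \<le> nrm X (u s - u t)"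
      "\<forall>\<^sub>F s in at t within I. nrm X (u s - u t) \<le> c * norm (y s - y t)"
      by (rule eventually_at_withinI, use bnd in blast)+
    have "((\<lambda>s. y s - y t) \<longlongrightarrow> 0) (at t within I)" using y t by (simp add: continuous_on_def LIM_zero)
    from tendsto_mult_right_zero[OF tendsto_norm_zero[OF this]]
    show "((\<lambda>s. c * norm (y s - y t)) \<longlongrightarrow> 0) (at t within I)" .
  qed
qed

lemma powr_tendsto_0: "0 < p \<Longrightarrow> ((\<lambda>t. t powr p) \<longlongrightarrow> 0) (at 0 within {0<..T})"
  by (rule tendsto_zero_powrI[OF tendsto_ident_at tendsto_const]) (auto simp: eventually_at_filter)

text \<open>
  The weighted norms are bounded uniformly in \<open>t\<close> by \<open>\<parallel>x\<parallel>\<close> and vanish at \<open>0\<close> for \<open>x\<close> in \<open>E1\<close>, which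
  is dense.
\<close>

lemma semigroup_weighted_vanishes:
  "((\<lambda>t. t powr \<theta> * nrm X (S t x)) \<longlongrightarrow> 0) (at 0 within {0<..T})"
proof (rule tendstoI)
  obtain c where c: "0 \<le> c" "\<And>y. R y \<in> car X" "\<And>y. nrm X (R y) \<le> c * norm y" using X_R_lift by blast
  fix e :: real assume e: "0 < e"
  define K where "K = 2 * cX * C"
  have K: "0 \<le> K" using cX C_nonneg by (simp add: K_def)
  have "0 < e / (2 * (K + 1))" using e K by simp
  then obtain y where y: "norm (R y - x) < e / (2 * (K + 1))" using R_dense by blast
  \<comment> \<open>\<open>R y\<close> is the approximation of \<open>x\<close> in \<open>E1\<close> and \<open>z\<close> the small error\<close>
  define z where "z = x - R y"
  have "K * norm z \<le> (K + 1) * (e / (2 * (K + 1)))"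
    using y K by (intro mult_mono) (auto simp: z_def norm_minus_commute)
  also have "\<dots> = e / 2" using K by (simp add: field_simps)
  finally have z: "K * norm z \<le> e / 2" .
  have est: "t powr \<theta> * nrm X (S t x) \<le> K * norm z + (c * (C * norm y)) * t powr \<theta>" if t: "t \<in> {0<..T}" for t
  proof -
    have t': "0 < t" "t \<le> T" "0 \<le> t" using t by auto
    have Sx: "S t x = R (D t z) + R (S t y)"
      using linear_simps(1)[OF S_linear[OF t'(3)], of z "R y"] t' by (simp add: z_def S_R S_eq_R_D[of t])
    have "nrm X (S t x) \<le> nrm X (R (D t z)) + nrm X (R (S t y))" unfolding Sx by (rule nrm_triangle[OF NX c(2) c(2)])
    then have "t powr \<theta> * nrm X (S t x) \<le> t powr \<theta> * nrm X (R (D t z)) + t powr \<theta> * nrm X (R (S t y))"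
      unfolding distrib_left[symmetric] by (rule mult_left_mono) simp
    moreover have "t powr \<theta> * nrm X (R (D t z)) \<le> K * norm z"
    proof -
      have "t * norm (D t z) \<le> C * norm z" using D_bound[OF t'(1,2), of z] t' by (simp add: field_simps)
      moreover have "norm (R (D t z)) \<le> C * norm z" using S_bound[OF t'(3,2), of z] t' by (simp add: S_eq_R_D)
      ultimately have "cX * (norm (R (D t z)) + t * norm (D t z)) \<le> cX * (C * norm z + C * norm z)"
        using cX by (intro mult_left_mono add_mono) auto
      with weighted_X_R[OF t'(1,2), of "D t z"] show ?thesis by (simp add: K_def)
    qed
    moreover have "t powr \<theta> * nrm X (R (S t y)) \<le> t powr \<theta> * (c * (C * norm y))"
      using c(1) S_bound[OF t'(3,2), of y] by (intro mult_left_mono order_trans[OF c(3)]) auto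
    ultimately show ?thesis by (simp add: mult.commute)
  qed
  have "((\<lambda>t. (c * (C * norm y)) * t powr \<theta>) \<longlongrightarrow> 0) (at 0 within {0<..T})"
    by (rule tendsto_mult_right_zero[OF powr_tendsto_0[OF \<theta>]])
  from order_tendstoD(2)[OF this, of "e / 2"] e
  have 1: "\<forall>\<^sub>F t in at 0 within {0<..T}. (c * (C * norm y)) * t powr \<theta> < e / 2" by simp
  have 2: "\<forall>\<^sub>F t in at 0 within {0<..T}. t \<in> {0<..T}" by (rule eventually_at_withinI)
  from 1 2 show "\<forall>\<^sub>F t in at 0 within {0<..T}. dist (t powr \<theta> * nrm X (S t x)) 0 < e"
  proof eventually_elim
    case (elim t)
    have "0 \<le> nrm X (S t x)" using nrm_nonneg[OF NX c(2)[of "D t x"]] elim by (simp add: S_eq_R_D)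
    then show ?case using est[OF elim(2)] elim(1) z by simp
  qed
qed

lemma sol_in_Cmu:
  assumes g: "forcing q g"
  shows "sol m g \<in> Cmu \<theta> T X"
proof -
  note q = forcingD(1)[OF g]
  obtain c where c: "\<And>y. R y \<in> car X" using X_R_lift by blast
  have "cont_into {0<..T} X (sol m g)"
    by (rule cont_into_X_R[OF sol_lift_continuous[OF g]]) (use sol_eq_R[OF g] in auto)
  moreover have "((\<lambda>t. t powr \<theta> * nrm X (sol m g t)) \<longlongrightarrow> 0) (at 0 within {0<..T})"
  proof (rule tendsto_sandwich[OF _ _ tendsto_const])
    define h where "h t = cX * (C * q * k1 * t powr (1 - \<nu>) + q * k2 * t powr (1 + \<gamma> - \<nu>))" for t
    have bnd: "0 \<le> t powr \<theta> * nrm X (sol m g t) \<and>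
        t powr \<theta> * nrm X (sol m g t) \<le> t powr \<theta> * nrm X (S t (initial m g)) + h t" if t: "t \<in> {0<..T}" for t
    proof -
      have t': "0 < t" "t \<le> T" using t by auto
      have Sx: "S t (initial m g) \<in> car X" using c S_eq_R_D[OF t'(1)] by simp
      have dx: "duhamel g t \<in> car X" using c duhamel_eq_R[OF g t'] by simp
      have "nrm X (sol m g t) \<le> nrm X (S t (initial m g)) + nrm X (duhamel g t)"
        unfolding sol_def by (rule nrm_triangle[OF NX Sx dx])
      then have "t powr \<theta> * nrm X (sol m g t) \<le> t powr \<theta> * nrm X (S t (initial m g)) + t powr \<theta> * nrm X (duhamel g t)"
        unfolding distrib_left[symmetric] by (rule mult_left_mono) simp
      moreover have "t powr \<theta> * nrm X (duhamel g t) \<le> h t"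
      proof -
        have "t * norm (smoothed_duhamel g t) \<le> t * (q * (k2 * t powr (\<gamma> - \<nu>)))"
          using smoothed_bound[OF g t'] t' by (intro mult_left_mono) auto
        also have "\<dots> = q * k2 * t powr (1 + \<gamma> - \<nu>)"
          using t' powr_add[of t 1 "\<gamma> - \<nu>"] by (simp add: add_diff_eq)
        finally have "cX * (norm (duhamel g t) + t * norm (smoothed_duhamel g t)) \<le> h t"
          unfolding h_def using duhamel_bound[OF g t'] cX by (intro mult_left_mono add_mono) (auto simp: mult_ac)
        then show ?thesis using weighted_X_R[OF t', of "smoothed_duhamel g t"] duhamel_eq_R[OF g t'] by simp
      qed
      moreover have "0 \<le> nrm X (sol m g t)" using nrm_nonneg[OF NX normed_on_add[OF NX Sx dx]] by (simp add: sol_def)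
      ultimately show ?thesis by simp
    qed
    show "\<forall>\<^sub>F t in at 0 within {0<..T}. 0 \<le> t powr \<theta> * nrm X (sol m g t)"
      "\<forall>\<^sub>F t in at 0 within {0<..T}. t powr \<theta> * nrm X (sol m g t) \<le> t powr \<theta> * nrm X (S t (initial m g)) + h t"
      by (rule eventually_at_withinI, use bnd in blast)+
    have p: "0 < 1 - \<nu>" "0 < 1 + \<gamma> - \<nu>" using params by auto
    have "(h \<longlongrightarrow> 0) (at 0 within {0<..T})"
      unfolding h_def by (intro tendsto_mult_right_zero tendsto_add_zero powr_tendsto_0 p)
    then show "((\<lambda>t. t powr \<theta> * nrm X (S t (initial m g)) + h t) \<longlongrightarrow> 0) (at 0 within {0<..T})"
      by (intro tendsto_add_zero semigroup_weighted_vanishes)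
  qed
  ultimately show ?thesis by (simp add: Cmu_def)
qed

lemma sol_estimates:
  obtains K where "0 \<le> K"
    "\<And>m g q t. forcing q g \<Longrightarrow> t \<in> {0..T} \<Longrightarrow> norm (sol m g t) \<le> K * (norm m + q)"
    "\<And>m g q. forcing q g \<Longrightarrow> Cmu_norm \<theta> T X (sol m g) \<le> K * (norm m + q)"
proof -
  obtain K where K: "0 \<le> K"
    "\<And>m g q t. forcing q g \<Longrightarrow> t \<in> {0..T} \<Longrightarrow> norm (sol m g t) \<le> K * (norm m + q)"
    "\<And>m g q t. forcing q g \<Longrightarrow> t \<in> {0<..T} \<Longrightarrow> t * norm (sol_lift m g t) \<le> K * (norm m + q)"
    using sol_bound by blast
  define L where "L = K + 2 * cX * K"
  show thesis
  proof (rule that[of L])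
    show "0 \<le> L" using K(1) cX by (simp add: L_def)
    fix m :: 'a and g q assume g: "forcing q g"
    note q = forcingD(1)[OF g]
    have L: "K * (norm m + q) \<le> L * (norm m + q)" "2 * cX * K * (norm m + q) \<le> L * (norm m + q)"
      using q K(1) cX by (auto intro!: mult_right_mono simp: L_def)
    show "norm (sol m g t) \<le> L * (norm m + q)" if "t \<in> {0..T}" for t
      using K(2)[OF g that, of m] L by linarith
    show "Cmu_norm \<theta> T X (sol m g) \<le> L * (norm m + q)"
    proof (rule Cmu_norm_least[OF T_pos])
      fix t assume t: "0 < t" "t \<le> T"
      have "t powr \<theta> * nrm X (sol m g t) \<le> cX * (norm (sol m g t) + t * norm (sol_lift m g t))"
        using weighted_X_R[OF t, of "sol_lift m g t"] sol_eq_R[OF g t] by simp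
      also have "\<dots> \<le> cX * (K * (norm m + q) + K * (norm m + q))"
        using K(2)[OF g, of t m] K(3)[OF g, of t m] t cX by (intro mult_left_mono add_mono) auto
      also have "\<dots> \<le> L * (norm m + q)" using L(2) by simp
      finally show "t powr \<theta> * nrm X (sol m g t) \<le> L * (norm m + q)" .
    qed
  qed
qed

definition sol_ball :: "real \<Rightarrow> (real \<Rightarrow> 'a) set" where
  "sol_ball r = {u \<in> Cmu \<theta> T X. Cmu_norm \<theta> T X u \<le> r \<and> (\<forall>t\<in>{0<..T}. norm (u t) \<le> r)}"

lemma f_difference:
  assumes r: "0 < r" "2 * r < 1" and v: "v \<in> sol_ball r" and w: "w \<in> sol_ball r"
  shows "Cmu_norm \<nu> T Y (\<lambda>t. f v t - f w t) \<le> cT * (2 * r) powr l * Cmu_norm \<theta> T X (\<lambda>t. v t - w t)"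
proof (rule f_local)
  show "\<forall>t\<in>{0<..T}. norm (v t) + norm (w t) \<le> 2 * r"
    using v w unfolding sol_ball_def by (auto intro: order_trans[OF add_mono])
qed (use r v w in \<open>auto simp: sol_ball_def\<close>)

lemma f_forcing: "v \<in> Cmu \<theta> T X \<Longrightarrow> forcing (\<kappa> * Cmu_norm \<nu> T Y (f v)) (f v)"
  by (rule Y_forcing[OF f_maps])

lemma f_diff_forcing:
  assumes "v \<in> Cmu \<theta> T X" "w \<in> Cmu \<theta> T X"
  shows "forcing (\<kappa> * Cmu_norm \<nu> T Y (\<lambda>t. f v t - f w t)) (\<lambda>t. f v t - f w t)"
  by (rule Y_forcing[OF Cmu_diff[OF NY f_maps[OF assms(1)] f_maps[OF assms(2)]]])

lemma zero_in_sol_ball: "0 < r \<Longrightarrow> (\<lambda>_. 0) \<in> sol_ball r"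
  unfolding sol_ball_def using Cmu_zero[OF NX] Cmu_norm_least[OF T_pos, of \<theta> X "\<lambda>_. 0" r] nrm_zero[OF NX] by simp

lemma f_bound:
  assumes r: "0 < r" "2 * r < 1" and v: "v \<in> sol_ball r"
  shows "Cmu_norm \<nu> T Y (f v) \<le> cT * (2 * r) powr l * r"
proof -
  have "Cmu_norm \<nu> T Y (f v) = Cmu_norm \<nu> T Y (\<lambda>t. f v t - f (\<lambda>_. 0) t)"
    by (rule Cmu_norm_cong) (simp add: f_zero)
  also have "\<dots> \<le> cT * (2 * r) powr l * Cmu_norm \<theta> T X (\<lambda>t. v t - 0)"
    by (rule f_difference[OF r v zero_in_sol_ball[OF r(1)]])
  also have "\<dots> \<le> cT * (2 * r) powr l * r"
    using v cT by (intro mult_left_mono) (auto simp: sol_ball_def)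
  finally show ?thesis .
qed

text \<open>
  The last clause is needed since \<open>f\<close> acts on functions on the whole real line: on the ball, the
  values of \<open>f v\<close> on \<open>(0, T]\<close> depend only on the values of \<open>v\<close> there.
\<close>

definition contracting :: "real \<Rightarrow> real \<Rightarrow> bool" where
  "contracting r \<mu> \<longleftrightarrow>
     (\<forall>m v. norm m \<le> \<mu> \<longrightarrow> v \<in> sol_ball r \<longrightarrow> sol m (f v) \<in> sol_ball r \<and> norm (sol m (f v) 0) \<le> r) \<and>
     (\<forall>m. \<forall>v\<in>sol_ball r. \<forall>w\<in>sol_ball r.
        Cmu_norm \<theta> T X (\<lambda>t. sol m (f v) t - sol m (f w) t) \<le> 1 / 2 * Cmu_norm \<theta> T X (\<lambda>t. v t - w t)) \<and>
     (\<forall>v\<in>sol_ball r. \<forall>w\<in>sol_ball r. (\<forall>t\<in>{0<..T}. v t = w t) \<longrightarrow> (\<forall>t\<in>{0<..T}. f v t = f w t))"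

lemma contractingD:
  assumes "contracting r \<mu>"
  shows "norm m \<le> \<mu> \<Longrightarrow> v \<in> sol_ball r \<Longrightarrow> sol m (f v) \<in> sol_ball r"
    "norm m \<le> \<mu> \<Longrightarrow> v \<in> sol_ball r \<Longrightarrow> norm (sol m (f v) 0) \<le> r"
    "v \<in> sol_ball r \<Longrightarrow> w \<in> sol_ball r \<Longrightarrow>
       Cmu_norm \<theta> T X (\<lambda>t. sol m (f v) t - sol m (f w) t) \<le> 1 / 2 * Cmu_norm \<theta> T X (\<lambda>t. v t - w t)"
    "v \<in> sol_ball r \<Longrightarrow> w \<in> sol_ball r \<Longrightarrow> \<forall>t\<in>{0<..T}. v t = w t \<Longrightarrow> t \<in> {0<..T} \<Longrightarrow> f v t = f w t"
  using assms unfolding contracting_def by blast+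

text \<open>
  On the ball of radius \<open>r\<close> the local Lipschitz estimate holds with \<open>L = 2 r\<close>, so the solution map
  has Lipschitz constant \<open>Q (2 r)\<^bsup>l\<^esup>\<close> for a fixed \<open>Q\<close>; this is at most \<open>1 / 2\<close> for small \<open>r\<close>.
\<close>

lemma solution_map_contraction: "\<exists>r>0. \<exists>\<mu>>0. contracting r \<mu>"
proof -
  obtain K where K: "0 \<le> K"
    "\<And>m g q t. forcing q g \<Longrightarrow> t \<in> {0..T} \<Longrightarrow> norm (sol m g t) \<le> K * (norm m + q)"
    "\<And>m g q. forcing q g \<Longrightarrow> Cmu_norm \<theta> T X (sol m g) \<le> K * (norm m + q)"
    using sol_estimates by metis
  define Q where "Q = K * \<kappa> * cT"
  have Q: "0 \<le> Q" using K \<kappa> cT by (simp add: Q_def)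
  \<comment> \<open>\<open>s\<close> is the diameter \<open>2 r\<close>; its \<open>l\<close>-th power is at most \<open>1 / (2 * (Q + 1))\<close>\<close>
  define s where "s = min (1 / 2) ((1 / (2 * (Q + 1))) powr (1 / l))"
  have s: "0 < s" "s \<le> 1 / 2" using Q by (auto simp: s_def)
  have "s powr l \<le> ((1 / (2 * (Q + 1))) powr (1 / l)) powr l"
    using s l by (intro powr_mono2) (auto simp: s_def)
  also have "\<dots> = 1 / (2 * (Q + 1))" using Q l by (simp add: powr_powr)
  finally have "Q * s powr l \<le> Q * (1 / (2 * (Q + 1)))" using Q by (rule mult_left_mono)
  also have "\<dots> \<le> 1 / 2" using Q by (simp add: field_simps)
  finally have half: "Q * s powr l \<le> 1 / 2" .
  define r where "r = s / 2"
  have r: "0 < r" "2 * r < 1" "2 * r = s" using s by (auto simp: r_def)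
  define \<mu> where "\<mu> = r / (2 * (K + 1))"
  have \<mu>: "0 < \<mu>" using r K by (simp add: \<mu>_def)
  have Km: "K * (norm m + \<kappa> * Cmu_norm \<nu> T Y (f v)) \<le> r" if m: "norm m \<le> \<mu>" and v: "v \<in> sol_ball r" for m v
  proof -
    have "K * norm m \<le> (K + 1) * \<mu>" using m K by (intro mult_mono) auto
    also have "\<dots> = r / 2" using K by (simp add: \<mu>_def field_simps)
    finally have 1: "K * norm m \<le> r / 2" .
    have "K * (\<kappa> * Cmu_norm \<nu> T Y (f v)) \<le> K * (\<kappa> * (cT * s powr l * r))"
      using f_bound[OF r(1,2) v] K \<kappa> r(3) by (intro mult_left_mono) auto
    also have "\<dots> = (Q * s powr l) * r" by (simp add: Q_def mult_ac)
    also have "\<dots> \<le> 1 / 2 * r" using half r by (intro mult_right_mono) auto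
    finally show ?thesis using 1 by (simp add: distrib_left)
  qed
  show ?thesis
  proof (rule exI[of _ r], rule conjI[OF r(1)], rule exI[of _ \<mu>], rule conjI[OF \<mu>], unfold contracting_def, intro conjI allI ballI impI)
    fix m :: 'a and v assume m: "norm m \<le> \<mu>" and v: "v \<in> sol_ball r"
    then have vC: "v \<in> Cmu \<theta> T X" by (simp add: sol_ball_def)
    have bd: "norm (sol m (f v) t) \<le> r" if "t \<in> {0..T}" for t
      by (rule order_trans[OF K(2)[OF f_forcing[OF vC] that] Km[OF m v]])
    show "norm (sol m (f v) 0) \<le> r" using bd T_pos by simp
    show "sol m (f v) \<in> sol_ball r"
      unfolding sol_ball_def
      using sol_in_Cmu[OF f_forcing[OF vC]] order_trans[OF K(3)[OF f_forcing[OF vC]] Km[OF m v]] bd by auto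
  next
    fix m :: 'a and v w assume v: "v \<in> sol_ball r" and w: "w \<in> sol_ball r"
    then have C: "v \<in> Cmu \<theta> T X" "w \<in> Cmu \<theta> T X" by (auto simp: sol_ball_def)
    have "Cmu_norm \<theta> T X (\<lambda>t. sol m (f v) t - sol m (f w) t) = Cmu_norm \<theta> T X (sol (m - m) (\<lambda>t. f v t - f w t))"
      by (rule Cmu_norm_cong) (rule sol_diff(1)[OF f_forcing[OF C(1)] f_forcing[OF C(2)]], simp)
    also have "\<dots> \<le> K * (norm (m - m) + \<kappa> * Cmu_norm \<nu> T Y (\<lambda>t. f v t - f w t))"
      by (rule K(3)[OF f_diff_forcing[OF C]])
    also have "\<dots> \<le> K * (\<kappa> * (cT * s powr l * Cmu_norm \<theta> T X (\<lambda>t. v t - w t)))"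
      using f_difference[OF r(1,2) v w] K \<kappa> r(3) by (simp add: mult_left_mono)
    also have "\<dots> = (Q * s powr l) * Cmu_norm \<theta> T X (\<lambda>t. v t - w t)" by (simp add: Q_def mult_ac)
    also have "\<dots> \<le> 1 / 2 * Cmu_norm \<theta> T X (\<lambda>t. v t - w t)"
      using half Cmu_norm_nonneg[OF NX T_pos Cmu_diff[OF NX C]] by (rule mult_right_mono)
    finally show "Cmu_norm \<theta> T X (\<lambda>t. sol m (f v) t - sol m (f w) t) \<le> 1 / 2 * Cmu_norm \<theta> T X (\<lambda>t. v t - w t)" .
  next
    fix v w t assume v: "v \<in> sol_ball r" and w: "w \<in> sol_ball r" and eq: "\<forall>t\<in>{0<..T}. v t = w t" and t: "t \<in> {0<..T}"
    then have C: "v \<in> Cmu \<theta> T X" "w \<in> Cmu \<theta> T X" by (auto simp: sol_ball_def)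
    have "Cmu_norm \<theta> T X (\<lambda>t. v t - w t) \<le> 0"
      by (rule Cmu_norm_least[OF T_pos]) (simp add: eq nrm_zero[OF NX])
    then have "cT * (2 * r) powr l * Cmu_norm \<theta> T X (\<lambda>t. v t - w t) \<le> 0"
      using cT by (simp add: mult_nonneg_nonpos)
    then have "Cmu_norm \<nu> T Y (\<lambda>t. f v t - f w t) \<le> 0"
      using f_difference[OF r(1,2) v w] by linarith
    from Cmu_norm_zero_imp_eq[OF NY T_pos f_maps[OF C(1)] f_maps[OF C(2)] this] t
    show "f v t = f w t" by simp
  qed
qed

text \<open>
  Picard iteration from \<open>0\<close>. The fixed point equation holds on \<open>(0, T]\<close> only, where the weighted norm
  sees the functions.
\<close>

lemma fixed_point_in_sol_ball:
  assumes r: "0 < r" and maps: "\<And>v. v \<in> sol_ball r \<Longrightarrow> \<Lambda> v \<in> sol_ball r"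
    and contr: "\<And>v w. v \<in> sol_ball r \<Longrightarrow> w \<in> sol_ball r \<Longrightarrow>
       Cmu_norm \<theta> T X (\<lambda>t. \<Lambda> v t - \<Lambda> w t) \<le> 1 / 2 * Cmu_norm \<theta> T X (\<lambda>t. v t - w t)"
  shows "\<exists>v\<in>sol_ball r. \<forall>t\<in>{0<..T}. \<Lambda> v t = v t"
proof -
  define u where "u n = (\<Lambda> ^^ n) (\<lambda>_. 0)" for n
  have uSuc: "u (Suc n) = \<Lambda> (u n)" for n by (simp add: u_def)
  have ub: "u n \<in> sol_ball r" for n by (induction n) (simp_all add: uSuc maps, simp add: u_def zero_in_sol_ball[OF r])
  have uC: "u n \<in> Cmu \<theta> T X" for n using ub by (simp add: sol_ball_def)
  have step: "Cmu_norm \<theta> T X (\<lambda>t. u (Suc n) t - u n t) \<le> r / 2 ^ n" for n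
  proof (induction n)
    case 0
    have "u 0 = (\<lambda>_. 0)" by (simp add: u_def)
    then show ?case using ub[of "Suc 0"] by (simp add: sol_ball_def)
  next
    case (Suc n)
    have "Cmu_norm \<theta> T X (\<lambda>t. u (Suc (Suc n)) t - u (Suc n) t) \<le> 1 / 2 * Cmu_norm \<theta> T X (\<lambda>t. u (Suc n) t - u n t)"
      using contr[OF ub[of "Suc n"] ub[of n]] by (simp only: uSuc)
    also have "\<dots> \<le> 1 / 2 * (r / 2 ^ n)" by (intro mult_left_mono Suc) simp
    finally show ?case by simp
  qed
  obtain v where v: "v \<in> Cmu \<theta> T X" "\<And>n. Cmu_norm \<theta> T X (\<lambda>t. u n t - v t) \<le> 2 * r / 2 ^ n"
    using Cmu_geometric_limit[OF X T_pos uC step] by blast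
  have lim0: "(\<lambda>n. K * (2 * r / 2 ^ n)) \<longlonglongrightarrow> 0" for K
    using tendsto_mult[OF tendsto_const LIMSEQ_realpow_zero[of "1/2::real"], of "K * (2 * r)"] by (simp add: power_divide)
  have vn: "Cmu_norm \<theta> T X (\<lambda>t. v t - u n t) \<le> 2 * r / 2 ^ n" for n
  proof -
    have "Cmu_norm \<theta> T X (\<lambda>t. v t - u n t) = Cmu_norm \<theta> T X (\<lambda>t. u n t - v t)"
      unfolding Cmu_norm_def
      by (rule SUP_cong) (use nrm_minus_commute[OF NX] Cmu_car[OF v(1)] Cmu_car[OF uC] in auto)
    with v(2) show ?thesis by simp
  qed
  have "v \<in> sol_ball r"
    unfolding sol_ball_def
  proof (intro CollectI conjI ballI v(1))
    show "Cmu_norm \<theta> T X v \<le> r"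
    proof (rule LIMSEQ_le_const)
      show "(\<lambda>n. 1 * (2 * r / 2 ^ n) + r) \<longlonglongrightarrow> r"
        using tendsto_add[OF lim0[of 1] tendsto_const[of r]] by simp
      have "Cmu_norm \<theta> T X v \<le> 1 * (2 * r / 2 ^ n) + r" for n
        using Cmu_norm_triangle[OF NX T_pos v(1) uC[of n]] vn[of n] ub[of n] by (simp add: sol_ball_def)
      then show "\<exists>N. \<forall>n\<ge>N. Cmu_norm \<theta> T X v \<le> 1 * (2 * r / 2 ^ n) + r" by blast
    qed
    fix t assume t: "t \<in> {0<..T}"
    show "norm (v t) \<le> r"
    proof (rule LIMSEQ_le_const)
      show "(\<lambda>n. (cX * t powr (- \<theta>)) * (2 * r / 2 ^ n) + r) \<longlonglongrightarrow> r"
        using tendsto_add[OF lim0[of "cX * t powr (- \<theta>)"] tendsto_const[of r]] by simp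
      have "norm (v t) \<le> (cX * t powr (- \<theta>)) * (2 * r / 2 ^ n) + r" for n
      proof -
        have c: "v t - u n t \<in> car X" using Cmu_car[OF Cmu_diff[OF NX v(1) uC]] t by simp
        have "t powr \<theta> * nrm X (v t - u n t) \<le> 2 * r / 2 ^ n"
          using Cmu_norm_upper[OF NX T_pos Cmu_diff[OF NX v(1) uC], of t n] vn[of n] t by auto
        then have "nrm X (v t - u n t) \<le> t powr (- \<theta>) * (2 * r / 2 ^ n)"
          using t by (simp add: powr_minus field_simps)
        then have "cX * nrm X (v t - u n t) \<le> cX * (t powr (- \<theta>) * (2 * r / 2 ^ n))" using cX by (rule mult_left_mono)
        with X_le[OF c] have "norm (v t - u n t) \<le> (cX * t powr (- \<theta>)) * (2 * r / 2 ^ n)" by (simp add: mult.assoc)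
        moreover have "norm (u n t) \<le> r" using ub[of n] t by (simp add: sol_ball_def)
        ultimately show ?thesis using norm_triangle_ineq[of "v t - u n t" "u n t"] by simp
      qed
      then show "\<exists>N. \<forall>n\<ge>N. norm (v t) \<le> (cX * t powr (- \<theta>)) * (2 * r / 2 ^ n) + r" by blast
    qed
  qed
  note vb = this
  have \<Lambda>C: "\<Lambda> v \<in> Cmu \<theta> T X" using maps[OF vb] by (simp add: sol_ball_def)
  have "Cmu_norm \<theta> T X (\<lambda>t. \<Lambda> v t - v t) \<le> 0"
  proof (rule LIMSEQ_le_const[OF lim0[of "1"]], intro exI allI impI)
    fix n
    have "Cmu_norm \<theta> T X (\<lambda>t. \<Lambda> v t - v t) \<le> 1 / 2 * (2 * r / 2 ^ n) + 2 * r / 2 ^ Suc n"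
    proof (rule Cmu_norm_least[OF T_pos])
      fix t assume t: "0 < t" "t \<le> T"
      have c: "\<Lambda> v t \<in> car X" "u (Suc n) t \<in> car X" "v t \<in> car X"
        using Cmu_car[OF \<Lambda>C t] Cmu_car[OF uC t] Cmu_car[OF v(1) t] by auto
      have "nrm X (\<Lambda> v t - v t) \<le> nrm X (\<Lambda> v t - u (Suc n) t) + nrm X (u (Suc n) t - v t)"
        by (rule nrm_triangle_dist[OF NX c])
      then have "t powr \<theta> * nrm X (\<Lambda> v t - v t) \<le> t powr \<theta> * nrm X (\<Lambda> v t - u (Suc n) t) + t powr \<theta> * nrm X (u (Suc n) t - v t)"
        unfolding distrib_left[symmetric] by (rule mult_left_mono) simp
      moreover have "t powr \<theta> * nrm X (\<Lambda> v t - u (Suc n) t) \<le> 1 / 2 * (2 * r / 2 ^ n)"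
        using Cmu_norm_upper[OF NX T_pos Cmu_diff[OF NX \<Lambda>C uC[of "Suc n"]] t] contr[OF vb ub[of n]] vn[of n]
        unfolding uSuc by linarith
      moreover have "t powr \<theta> * nrm X (u (Suc n) t - v t) \<le> 2 * r / 2 ^ Suc n"
        using Cmu_norm_upper[OF NX T_pos Cmu_diff[OF NX uC[of "Suc n"] v(1)] t] v(2)[of "Suc n"] by linarith
      ultimately show "t powr \<theta> * nrm X (\<Lambda> v t - v t) \<le> 1 / 2 * (2 * r / 2 ^ n) + 2 * r / 2 ^ Suc n" by linarith
    qed
    then show "Cmu_norm \<theta> T X (\<lambda>t. \<Lambda> v t - v t) \<le> 1 * (2 * r / 2 ^ n)" by simp
  qed
  from Cmu_norm_zero_imp_eq[OF NX T_pos \<Lambda>C v(1) this] show ?thesis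
    by (intro bexI[OF _ vb] ballI) simp
qed

text \<open>
  The strong formulation in terms of preimages under \<open>R\<close>: \<open>u = R \<omega>\<close> lies in the domain of \<open>A\<close>, and
  \<open>A u = \<lambda> u - \<omega>\<close>.
\<close>

definition solves :: "'a \<Rightarrow> (real \<Rightarrow> 'a) \<Rightarrow> (real \<Rightarrow> 'a) \<Rightarrow> bool" where
  "solves m u \<omega> \<longleftrightarrow> continuous_on {0..T} u \<and>
     (\<forall>t\<in>{0<..T}. u t = R (\<omega> t) \<and>
        (u has_vector_derivative (lam *\<^sub>R u t - \<omega> t + f u t)) (at t within {0<..T})) \<and>
     a *\<^sub>R u T + integral {0..T} (\<lambda>t. b t *\<^sub>R u t) = R m"

lemma small_solutions:
  "\<exists>\<mu>>0. \<exists>r>0. \<forall>m. norm m \<le> \<mu> \<longrightarrow>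
     (\<exists>u \<omega>. solves m u \<omega> \<and> continuous_on {0<..T} \<omega> \<and> continuous_on {0<..T} (f u) \<and>
        u \<in> Cmu \<theta> T X \<and> u \<in> small_ball \<theta> T X r \<and>
        (\<forall>w \<omega>. solves m w \<omega> \<longrightarrow> w \<in> Cmu \<theta> T X \<longrightarrow> w \<in> small_ball \<theta> T X r \<longrightarrow> (\<forall>t\<in>{0..T}. w t = u t)))"
proof -
  obtain r \<mu> where r: "0 < r" and \<mu>: "0 < \<mu>" and c: "contracting r \<mu>"
    using solution_map_contraction by blast
  note maps = contractingD(1)[OF c] and maps0 = contractingD(2)[OF c]
    and contr = contractingD(3)[OF c] and cong = contractingD(4)[OF c]
  have small: "u \<in> sol_ball r" if "u \<in> Cmu \<theta> T X" "u \<in> small_ball \<theta> T X r" for u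
    using that by (auto simp: sol_ball_def small_ball_def)
  show ?thesis
  proof (rule exI[of _ \<mu>], rule conjI[OF \<mu>], rule exI[of _ r], rule conjI[OF r], intro allI impI)
    fix m :: 'a assume m: "norm m \<le> \<mu>"
    obtain v where v: "v \<in> sol_ball r" "\<And>t. t \<in> {0<..T} \<Longrightarrow> sol m (f v) t = v t"
      using fixed_point_in_sol_ball[OF r maps[OF m] contr] by blast
    then have vC: "v \<in> Cmu \<theta> T X" by (simp add: sol_ball_def)
    note g = f_forcing[OF vC]
    define u where "u = sol m (f v)"
    have ub: "u \<in> sol_ball r" unfolding u_def by (rule maps[OF m v(1)])
    then have uC: "u \<in> Cmu \<theta> T X" by (simp add: sol_ball_def)
    have uv: "u t = v t" if "t \<in> {0<..T}" for t using v(2)[OF that] by (simp add: u_def)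
    have fu: "f u t = f v t" if "t \<in> {0<..T}" for t using cong[OF ub v(1) _ that] uv by blast
    have usm: "u \<in> small_ball \<theta> T X r"
    proof -
      have "norm (u t) \<le> r" if "t \<in> {0..T}" for t
        using that maps0[OF m v(1)] ub by (cases "t = 0") (auto simp: sol_ball_def u_def)
      then show ?thesis using ub by (auto simp: sol_ball_def small_ball_def)
    qed
    have uniq: "w t = u t"
      if wsol: "solves m w \<omega>" and wC: "w \<in> Cmu \<theta> T X" and wr: "w \<in> small_ball \<theta> T X r"
        and t: "t \<in> {0..T}" for w \<omega> t
    proof -
      have w: "continuous_on {0..T} w" "\<forall>t\<in>{0<..T}. w t = R (\<omega> t) \<and>
             (w has_vector_derivative (lam *\<^sub>R w t - \<omega> t + f w t)) (at t within {0<..T})"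
          "a *\<^sub>R w T + integral {0..T} (\<lambda>t. b t *\<^sub>R w t) = R m"
        using wsol unfolding solves_def by blast+
      have wb: "w \<in> sol_ball r" by (rule small[OF wC wr])
      have ws: "w t = sol m (f w) t" if "t \<in> {0..T}" for t
        by (rule sol_unique[OF f_forcing[OF wC] w(1) _ _ w(3) that, where \<omega> = \<omega>]) (use w(2) in blast)+
      have "Cmu_norm \<theta> T X (\<lambda>t. w t - u t) = Cmu_norm \<theta> T X (\<lambda>t. sol m (f w) t - sol m (f v) t)"
        by (rule Cmu_norm_cong) (use ws in \<open>simp add: u_def\<close>)
      also have "\<dots> \<le> 1 / 2 * Cmu_norm \<theta> T X (\<lambda>t. w t - v t)" by (rule contr[OF wb v(1)])
      also have "Cmu_norm \<theta> T X (\<lambda>t. w t - v t) = Cmu_norm \<theta> T X (\<lambda>t. w t - u t)"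
        by (rule Cmu_norm_cong) (simp add: uv)
      finally have "Cmu_norm \<theta> T X (\<lambda>t. w t - u t) \<le> 0" by simp
      note eq = Cmu_norm_zero_imp_eq[OF NX T_pos wC uC this]
      have "w t - u t = 0"
      proof (rule continuous_constant_on_closure[of "{0<..T}" "\<lambda>t. w t - u t"])
        have "closure {0<..T} = {0..T}" using T_pos by simp
        then show "continuous_on (closure {0<..T}) (\<lambda>t. w t - u t)"
          unfolding u_def by (simp only: continuous_on_diff[OF w(1) sol_continuous[OF g]])
      qed (use eq t T_pos in auto)
      then show ?thesis by simp
    qed
    have fuc: "continuous_on {0<..T} (f u)"
    proof -
      have "continuous_on {0<..T} (f u) \<longleftrightarrow> continuous_on {0<..T} (f v)"
        by (rule continuous_on_cong[OF refl fu])
      then show ?thesis using forcingD(2)[OF g] by simp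
    qed
    have der: "(u has_vector_derivative (lam *\<^sub>R u t - sol_lift m (f v) t + f u t)) (at t within {0<..T})"
      if "t \<in> {0<..T}" for t
      using sol_derivative[OF g that, of m] fu[OF that] by (simp add: u_def)
    have eqR: "u t = R (sol_lift m (f v) t)" if "t \<in> {0<..T}" for t
      using sol_eq_R[OF g] that by (simp add: u_def)
    have uc: "continuous_on {0..T} u" and lc: "continuous_on {0<..T} (sol_lift m (f v))"
      and avg: "a *\<^sub>R u T + integral {0..T} (\<lambda>t. b t *\<^sub>R u t) = R m"
      using sol_continuous[OF g] sol_lift_continuous[OF g] sol_average[OF g] by (simp_all add: u_def)
    have "solves m u (sol_lift m (f v))" unfolding solves_def using uc der eqR avg by blast
    then show "\<exists>u \<omega>. solves m u \<omega> \<and> continuous_on {0<..T} \<omega> \<and> continuous_on {0<..T} (f u) \<and>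
        u \<in> Cmu \<theta> T X \<and> u \<in> small_ball \<theta> T X r \<and>
        (\<forall>w \<omega>. solves m w \<omega> \<longrightarrow> w \<in> Cmu \<theta> T X \<longrightarrow> w \<in> small_ball \<theta> T X r \<longrightarrow> (\<forall>t\<in>{0..T}. w t = u t))"
      using lc fuc uC usm uniq by blast
  qed
qed

end

section \<open>Interpolation estimates for the semigroup\<close>

locale smoothing_couple = smoothing_semigroup S D R lam T C + embedded_couple J E0 E1
  for S D :: "real \<Rightarrow> 'a::banach \<Rightarrow> 'a" and R :: "'a \<Rightarrow> 'a" and lam T C :: real
    and J :: "('a \<Rightarrow> 'a) option" and E0 E1 :: "'a nspace" +
  fixes c1 c2 :: real
  assumes E1_range: "car E1 = range R"
    and c1: "0 < c1" "\<And>y. nrm E1 (R y) \<le> c1 * norm y"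
    and c2: "0 < c2" "\<And>y. norm y \<le> c2 * nrm E1 (R y)"
    and S_scalars: "\<And>t. 0 \<le> t \<Longrightarrow> lin_on J UNIV (S t)"
    and J_bounded: "\<And>i. J = Some i \<Longrightarrow> bounded_linear i"
begin

text \<open>
  The integrated semigroup; it maps \<open>E0\<close> into \<open>E1\<close> with a bound that is uniform in \<open>t\<close>, while
  its norm on \<open>E0\<close> is of order \<open>t\<close>.
\<close>

definition integrated :: "real \<Rightarrow> 'a \<Rightarrow> 'a" where
  "integrated t x = integral {0..t} (\<lambda>s. S s x)"

lemma S_integrable: "(\<lambda>s. S s x) integrable_on {0..t}"
  by (intro integrable_continuous_interval continuous_on_subset[OF S_cont]) auto

lemma integrated_linear:
  shows "integrated t (x + y) = integrated t x + integrated t y"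
    and "integrated t (c *\<^sub>R x) = c *\<^sub>R integrated t x"
    and "integrated t (R x) = R (integrated t x)"
proof -
  have "integral {0..t} (\<lambda>s. S s (x + y)) = integral {0..t} (\<lambda>s. S s x + S s y)"
    by (rule Henstock_Kurzweil_Integration.integral_cong) (simp add: linear_simps(1)[OF S_linear])
  then show "integrated t (x + y) = integrated t x + integrated t y"
    by (simp add: integrated_def Henstock_Kurzweil_Integration.integral_add[OF S_integrable S_integrable])
  have "integral {0..t} (\<lambda>s. S s (c *\<^sub>R x)) = integral {0..t} (\<lambda>s. c *\<^sub>R S s x)"
    by (rule Henstock_Kurzweil_Integration.integral_cong) (simp add: linear_simps(5)[OF S_linear])
  then show "integrated t (c *\<^sub>R x) = c *\<^sub>R integrated t x" by (simp add: integrated_def)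
  have "integral {0..t} (\<lambda>s. S s (R x)) = integral {0..t} (\<lambda>s. R (S s x))"
    by (rule Henstock_Kurzweil_Integration.integral_cong) (simp add: S_R)
  then show "integrated t (R x) = R (integrated t x)"
    using integral_linear[OF S_integrable R_linear] by (simp add: integrated_def o_def)
qed

lemma integrated_scalars: "lin_on J UNIV (integrated t)"
proof -
  have "integrated t (i x) = i (integrated t x)" if J: "J = Some i" for i x
  proof -
    have "integral {0..t} (\<lambda>s. S s (i x)) = integral {0..t} (\<lambda>s. i (S s x))"
      by (rule Henstock_Kurzweil_Integration.integral_cong) (use S_scalars J in \<open>auto simp: lin_on_def\<close>)
    then show ?thesis
      using integral_linear[OF S_integrable J_bounded[OF J]] by (simp add: integrated_def o_def)
  qed
  then show ?thesis by (auto simp: lin_on_def integrated_linear split: option.splits)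
qed

lemma integrated_eq_R:
  assumes t: "0 \<le> t"
  shows "integrated t y = R (lam *\<^sub>R integrated t y - S t y + y)"
proof -
  have "lam *\<^sub>R R y - y = lam *\<^sub>R R y + (- 1) *\<^sub>R y" by simp
  then have "integrated t (lam *\<^sub>R R y - y) = lam *\<^sub>R R (integrated t y) - integrated t y"
    by (simp only: integrated_linear) simp
  moreover have "integrated t (lam *\<^sub>R R y - y) = S t (R y) - R y"
    unfolding integrated_def by (rule integral_unique[OF S_R_integral[OF t]])
  ultimately have e: "lam *\<^sub>R R (integrated t y) - integrated t y = S t (R y) - R y" by simp
  have "integrated t y = lam *\<^sub>R R (integrated t y) - (lam *\<^sub>R R (integrated t y) - integrated t y)" by simp
  also have "\<dots> = lam *\<^sub>R R (integrated t y) - S t (R y) + R y" unfolding e by simp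
  finally have "integrated t y = lam *\<^sub>R R (integrated t y) - S t (R y) + R y" .
  also have "lam *\<^sub>R R (integrated t y) - S t (R y) + R y = R (lam *\<^sub>R integrated t y - S t y + y)"
    using t by (simp add: linear_simps(1,2,5)[OF R_linear] S_R)
  finally show ?thesis .
qed

lemma integrated_bound:
  assumes t: "0 \<le> t" "t \<le> T" shows "norm (integrated t x) \<le> C * t * norm x"
proof -
  have "norm (integral {0..t} (\<lambda>s. S s x)) \<le> (C * norm x) * (t - 0)"
  proof (rule integral_bound[OF t(1)])
    show "continuous_on {0..t} (\<lambda>s. S s x)" by (rule continuous_on_subset[OF S_cont]) auto
  qed (use S_bound t in auto)
  then show ?thesis by (simp add: integrated_def mult_ac)
qed

lemma E1_R_norm_nonneg: "0 \<le> nrm E1 (R y)"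
  using nrm_nonneg[OF banach_on_normed_on[OF E1(1)]] E1_range by blast

text \<open>
  For \<open>x = R y\<close> one has \<open>x = S t x - \<integral> S s (A x) ds\<close>. The operator \<open>S t\<close> has norms \<open>O(1)\<close> and
  \<open>O(1 / t)\<close> from \<open>E0\<close> to \<open>E0\<close> and \<open>E1\<close>, hence \<open>O(t\<^bsup>- \<theta>\<^esup>)\<close> to \<open>X\<close>; the integrated semigroup has norms
  \<open>O(t)\<close> and \<open>O(1)\<close>, hence \<open>O(t\<^bsup>1 - \<theta>\<^esup>)\<close> to \<open>X\<close>.
\<close>

lemma interpolation_inequality:
  assumes int: "interp_from_E0 X \<theta> c" and X: "normed_on J X"
  shows "\<exists>K\<ge>0. \<forall>t y. 0 < t \<longrightarrow> t \<le> T \<longrightarrow>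
     R y \<in> car X \<and> nrm X (R y) \<le> K * (t powr (- \<theta>) * norm (R y) + t powr (1 - \<theta>) * norm y)"
proof -
  have c: "0 \<le> c" using int by (simp add: interp_from_E0_def)
  have smooth: "L x \<in> car X \<and> nrm X (L x) \<le> c * (B0 powr (1 - \<theta>) * B1 powr \<theta>) * norm x"
    if "lin_on J UNIV L" "0 < B0" "0 \<le> B1" "\<And>x. norm (L x) \<le> B0 * norm x"
      "\<And>x. L x \<in> car E1 \<and> nrm E1 (L x) \<le> B1 * norm x" for L B0 B1 x
    using int that unfolding interp_from_E0_def by blast
  define B where "B = c1 * (\<bar>lam\<bar> * (C * T) + C + 1)"
  define k where "k = c * ((C + 1) powr (1 - \<theta>) * (c1 * C) powr \<theta>)"
  define k' where "k' = c * ((C + 1) powr (1 - \<theta>) * B powr \<theta>)"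
  have pos: "0 \<le> B" "0 \<le> k" "0 \<le> k'" using c c1(1) C_nonneg T_pos by (auto simp: B_def k_def k'_def)
  define K where "K = k + k' * T * \<bar>lam\<bar> + k'"
  have K: "0 \<le> K" using pos T_pos by (simp add: K_def)
  have "R y \<in> car X \<and> nrm X (R y) \<le> K * (t powr (- \<theta>) * norm (R y) + t powr (1 - \<theta>) * norm y)"
    if t: "0 < t" "t \<le> T" for t y
  proof -
    define z where "z = lam *\<^sub>R R y - y"
    have S1: "S t x \<in> car X \<and> nrm X (S t x) \<le> c * ((C + 1) powr (1 - \<theta>) * (c1 * (C / t)) powr \<theta>) * norm x" for x
    proof (rule smooth)
      show "lin_on J UNIV (S t)" using S_scalars t by simp
      show "norm (S t x) \<le> (C + 1) * norm x" for x
        using S_bound[of t x] t by (simp add: distrib_right add_increasing2)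
      show "S t x \<in> car E1 \<and> nrm E1 (S t x) \<le> c1 * (C / t) * norm x" for x
      proof -
        have "nrm E1 (R (D t x)) \<le> c1 * norm (D t x)" by (rule c1(2))
        also have "\<dots> \<le> c1 * (C / t * norm x)" using D_bound[OF t, of x] c1(1) by (intro mult_left_mono) auto
        finally show ?thesis using E1_range t by (simp add: S_eq_R_D)
      qed
    qed (use C_nonneg c1(1) t in auto)
    have S2: "integrated t x \<in> car X \<and> nrm X (integrated t x) \<le> c * (((C + 1) * t) powr (1 - \<theta>) * B powr \<theta>) * norm x" for x
    proof (rule smooth[OF integrated_scalars])
      show "norm (integrated t x) \<le> (C + 1) * t * norm x" for x
        using integrated_bound[of t x] t by (simp add: distrib_right add_increasing2)
      show "integrated t x \<in> car E1 \<and> nrm E1 (integrated t x) \<le> B * norm x" for x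
      proof -
        define v where "v = lam *\<^sub>R integrated t x - S t x + x"
        have eq: "integrated t x = R v" unfolding v_def by (rule integrated_eq_R) (use t in simp)
        have "norm (lam *\<^sub>R integrated t x) \<le> \<bar>lam\<bar> * (C * T * norm x)"
        proof -
          have "norm (integrated t x) \<le> C * t * norm x" using integrated_bound t by simp
          also have "\<dots> \<le> C * T * norm x" using t C_nonneg by (intro mult_right_mono mult_left_mono) auto
          finally show ?thesis by (simp add: mult_left_mono)
        qed
        moreover have "norm (S t x) \<le> C * norm x" using S_bound t by simp
        moreover have "norm v \<le> norm (lam *\<^sub>R integrated t x) + norm (S t x) + norm x"
          unfolding v_def
          using norm_triangle_ineq[of "lam *\<^sub>R integrated t x - S t x" x] norm_triangle_ineq4[of "lam *\<^sub>R integrated t x" "S t x"]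
          by linarith
        ultimately have "norm v \<le> \<bar>lam\<bar> * (C * T * norm x) + C * norm x + norm x" by linarith
        also have "\<dots> = (\<bar>lam\<bar> * (C * T) + C + 1) * norm x" by (simp add: algebra_simps)
        finally have "c1 * norm v \<le> c1 * ((\<bar>lam\<bar> * (C * T) + C + 1) * norm x)" using c1(1) by (intro mult_left_mono) auto
        with c1(2)[of v] have "nrm E1 (R v) \<le> B * norm x" unfolding B_def by (simp only: mult.assoc)
        then show ?thesis using E1_range by (simp add: eq)
      qed
    qed (use C_nonneg pos t in auto)
    have "integrated t z = S t (R y) - R y"
      unfolding integrated_def z_def by (rule integral_unique[OF S_R_integral]) (use t in simp)
    then have eq: "R y = S t (R y) - integrated t z" by simp
    have in_X: "R y \<in> car X" by (subst eq) (use normed_on_diff[OF X] S1 S2 in blast)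
    have t1: "(c1 * (C / t)) powr \<theta> = (c1 * C) powr \<theta> * t powr (- \<theta>)"
      using t c1(1) C_nonneg powr_divide[of "c1 * C" t \<theta>] by (simp add: powr_minus field_simps)
    have "nrm X (S t (R y)) \<le> k * t powr (- \<theta>) * norm (R y)"
      using S1[of "R y"] unfolding t1 by (simp add: k_def mult_ac)
    moreover have "nrm X (integrated t z) \<le> k' * t powr (1 - \<theta>) * norm z"
      using S2[of z] t C_nonneg powr_mult[of "C + 1" t "1 - \<theta>"] by (simp add: k'_def mult_ac)
    moreover have "k' * t powr (1 - \<theta>) * norm z \<le> k' * T * \<bar>lam\<bar> * t powr (- \<theta>) * norm (R y) + k' * t powr (1 - \<theta>) * norm y"
    proof -
      have tt: "t powr (1 - \<theta>) = t * t powr (- \<theta>)" using t powr_add[of t 1 "- \<theta>"] by simp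
      have "norm z \<le> \<bar>lam\<bar> * norm (R y) + norm y" unfolding z_def using norm_triangle_ineq4[of "lam *\<^sub>R R y" y] by simp
      then have "k' * t powr (1 - \<theta>) * norm z \<le> k' * t powr (1 - \<theta>) * (\<bar>lam\<bar> * norm (R y) + norm y)"
        using pos by (intro mult_left_mono) auto
      also have "\<dots> = t * (k' * \<bar>lam\<bar> * t powr (- \<theta>) * norm (R y)) + k' * t powr (1 - \<theta>) * norm y"
        unfolding tt by (simp add: algebra_simps)
      also have "\<dots> \<le> T * (k' * \<bar>lam\<bar> * t powr (- \<theta>) * norm (R y)) + k' * t powr (1 - \<theta>) * norm y"
        using t pos by (intro add_right_mono mult_right_mono) auto
      finally show ?thesis by (simp add: mult_ac)
    qed
    moreover have "nrm X (R y) \<le> nrm X (S t (R y)) + nrm X (integrated t z)"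
      by (subst eq) (use nrm_triangle_diff[OF X] S1 S2 in blast)
    ultimately have "nrm X (R y) \<le> (k + k' * T * \<bar>lam\<bar>) * (t powr (- \<theta>) * norm (R y)) + k' * (t powr (1 - \<theta>) * norm y)"
      by (simp add: algebra_simps)
    also have "\<dots> \<le> K * (t powr (- \<theta>) * norm (R y)) + K * (t powr (1 - \<theta>) * norm y)"
      using pos T_pos by (intro add_mono mult_right_mono) (auto simp: K_def)
    finally show ?thesis using in_X by (simp add: distrib_left)
  qed
  with K show ?thesis by blast
qed

text \<open>
  \<open>S t\<close> has norm \<open>O(1 / t)\<close> from \<open>E0\<close> to \<open>E1\<close> and \<open>O(1)\<close> on \<open>E1\<close>. The \<open>1\<close> added to the first constant
  keeps the bound positive, as the interpolation estimate requires.
\<close>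

lemma interpolation_smoothing:
  assumes int: "interp_to_E1 Y \<gamma> c"
  shows "\<exists>K\<ge>0. \<forall>t x. 0 < t \<longrightarrow> t \<le> T \<longrightarrow> x \<in> car Y \<longrightarrow> norm (D t x) \<le> K * t powr (\<gamma> - 1) * nrm Y x"
proof -
  have c: "0 \<le> c" using int by (simp add: interp_to_E1_def)
  have smooth: "nrm E1 (L x) \<le> c * (B0 powr (1 - \<gamma>) * B1 powr \<gamma>) * nrm Y x"
    if "lin_on J UNIV L" "0 < B0" "0 \<le> B1" "\<And>x. L x \<in> car E1 \<and> nrm E1 (L x) \<le> B0 * norm x"
      "\<And>x. x \<in> car E1 \<Longrightarrow> nrm E1 (L x) \<le> B1 * nrm E1 x" "x \<in> car Y" for L B0 B1 x
    using int that unfolding interp_to_E1_def by blast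
  define B where "B = c1 * (C * c2)"
  have B: "0 \<le> B" using c1(1) c2(1) C_nonneg by (simp add: B_def)
  define K where "K = c2 * (c * ((c1 * C + 1) powr (1 - \<gamma>) * B powr \<gamma>))"
  have K: "0 \<le> K" using c c2(1) by (simp add: K_def)
  have "norm (D t x) \<le> K * t powr (\<gamma> - 1) * nrm Y x" if t: "0 < t" "t \<le> T" and x: "x \<in> car Y" for t x
  proof -
    have "nrm E1 (S t x) \<le> c * (((c1 * C + 1) / t) powr (1 - \<gamma>) * B powr \<gamma>) * nrm Y x"
    proof (rule smooth[OF _ _ B _ _ x])
      show "lin_on J UNIV (S t)" using S_scalars t by simp
      show "0 < (c1 * C + 1) / t" using c1(1) C_nonneg t by (simp add: add_nonneg_pos)
      show "S t x \<in> car E1 \<and> nrm E1 (S t x) \<le> (c1 * C + 1) / t * norm x" for x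
      proof -
        have "nrm E1 (R (D t x)) \<le> c1 * norm (D t x)" by (rule c1(2))
        also have "\<dots> \<le> c1 * (C / t * norm x)" using D_bound[OF t, of x] c1(1) by (intro mult_left_mono) auto
        also have "\<dots> = (c1 * C) / t * norm x" by simp
        also have "\<dots> \<le> (c1 * C + 1) / t * norm x" using t by (intro mult_right_mono divide_right_mono) auto
        finally show ?thesis using E1_range t by (simp add: S_eq_R_D)
      qed
      show "nrm E1 (S t x) \<le> B * nrm E1 x" if "x \<in> car E1" for x
      proof -
        obtain y where y: "x = R y" using \<open>x \<in> car E1\<close> E1_range by blast
        have "nrm E1 (R (S t y)) \<le> c1 * norm (S t y)" by (rule c1(2))
        also have "\<dots> \<le> c1 * (C * (c2 * nrm E1 (R y)))"
          using S_bound[of t y] t c1(1) C_nonneg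
          by (intro mult_left_mono order_trans[OF S_bound mult_left_mono[OF c2(2)]]) auto
        finally show ?thesis using t by (simp add: y S_R B_def mult_ac)
      qed
    qed
    moreover have "norm (D t x) \<le> c2 * nrm E1 (S t x)" using c2(2)[of "D t x"] t by (simp add: S_eq_R_D)
    ultimately have "norm (D t x) \<le> c2 * (c * (((c1 * C + 1) / t) powr (1 - \<gamma>) * B powr \<gamma>) * nrm Y x)"
      using mult_left_mono[of _ _ c2] c2(1) by (meson less_imp_le order_trans)
    also have "((c1 * C + 1) / t) powr (1 - \<gamma>) = (c1 * C + 1) powr (1 - \<gamma>) * t powr (\<gamma> - 1)"
      using powr_divide[of "c1 * C + 1" t "1 - \<gamma>"] powr_minus[of t "1 - \<gamma>"] t c1(1) C_nonneg
      by (simp add: divide_inverse)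
    finally show ?thesis by (simp add: K_def mult_ac)
  qed
  with K show ?thesis by blast
qed

end

section \<open>Small strong solutions\<close>

theorem theorem2p4:
  fixes J :: "('a::banach \<Rightarrow> 'a) option"
    and E0 E1 :: "'a nspace"
    and F :: "real \<Rightarrow> 'a nspace \<Rightarrow> 'a nspace \<Rightarrow> 'a nspace"
    and A :: "'a \<Rightarrow> 'a" and S :: "real \<Rightarrow> 'a \<Rightarrow> 'a"
    and T a :: real and b :: "real \<Rightarrow> real"
    and \<gamma> \<theta> \<nu> l cT :: real
    and f :: "(real \<Rightarrow> 'a) \<Rightarrow> (real \<Rightarrow> 'a)"
  assumes scalars: "scalar_structure J"
    and E0: "E0 = NSpace UNIV norm" "banach_on J E0"
    and E1: "banach_on J E1" "cont_embedded E1 E0" "dense_in E1 E0"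
    and F: "\<And>\<eta>. 0 < \<eta> \<Longrightarrow> \<eta> < 1 \<Longrightarrow> admissible_functor J \<eta> (F \<eta>)"
    and T: "0 < T"
    and b: "C1_on {0..T} b" "b 0 \<noteq> 0"
    and A: "analytic_generator J E1 A S"
    and compact: "compactly_embedded E1"
    and params: "0 < \<gamma>" "\<gamma> \<le> 1" "0 < \<theta>" "\<theta> \<le> 1" "0 \<le> \<nu>" "\<nu> < 1" "0 < l" "0 < cT"
    and f_maps: "\<And>v. v \<in> Cmu \<theta> T (interp_space F E0 E1 \<theta>) \<Longrightarrow>
                       f v \<in> Cmu \<nu> T (interp_space F E0 E1 \<gamma>)"
    and f_Lipschitz: "\<exists>K. \<forall>v \<in> Cmu \<theta> T (interp_space F E0 E1 \<theta>).
                         \<forall>w \<in> Cmu \<theta> T (interp_space F E0 E1 \<theta>).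
             Cmu_norm \<nu> T (interp_space F E0 E1 \<gamma>) (\<lambda>t. f v t - f w t)
               \<le> K * Cmu_norm \<theta> T (interp_space F E0 E1 \<theta>) (\<lambda>t. v t - w t)"
    and f_zero: "\<And>t. t \<in> {0<..T} \<Longrightarrow> f (\<lambda>_. 0) t = 0"
    and f_local: "\<And>L v w. 0 < L \<Longrightarrow> L < 1 \<Longrightarrow>
             v \<in> Cmu \<theta> T (interp_space F E0 E1 \<theta>) \<Longrightarrow>
             w \<in> Cmu \<theta> T (interp_space F E0 E1 \<theta>) \<Longrightarrow>
             Cmu_norm \<theta> T (interp_space F E0 E1 \<theta>) v
               + Cmu_norm \<theta> T (interp_space F E0 E1 \<theta>) w \<le> L \<Longrightarrow>
             (\<forall>t\<in>{0<..T}. norm (v t) + norm (w t) \<le> L) \<Longrightarrow>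
             Cmu_norm \<nu> T (interp_space F E0 E1 \<gamma>) (\<lambda>t. f v t - f w t)
               \<le> cT * L powr l * Cmu_norm \<theta> T (interp_space F E0 E1 \<theta>) (\<lambda>t. v t - w t)"
    and ker: "\<And>x. a *\<^sub>R S T x + integral {0..T} (\<lambda>t. b t *\<^sub>R S t x) = 0 \<Longrightarrow> x = 0"
  shows "\<exists>m>0. \<exists>r>0. \<forall>M\<in>car E1. nrm E1 M \<le> m \<longrightarrow>
           (\<exists>u. strong_solution T a b E1 A f M u \<and>
                u \<in> Cmu \<theta> T (interp_space F E0 E1 \<theta>) \<and>
                u \<in> small_ball \<theta> T (interp_space F E0 E1 \<theta>) r \<and>
                (\<forall>w. strong_solution T a b E1 A f M w \<and>
                     w \<in> Cmu \<theta> T (interp_space F E0 E1 \<theta>) \<and>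
                     w \<in> small_ball \<theta> T (interp_space F E0 E1 \<theta>) r \<longrightarrow>
                     (\<forall>t\<in>{0..T}. w t = u t)))"
proof -
  define X where "X = interp_space F E0 E1 \<theta>"
  define Y where "Y = interp_space F E0 E1 \<gamma>"
  note N1 = banach_on_normed_on[OF E1(1)]
  interpret EC: embedded_couple J E0 E1 by unfold_locales (fact E0 E1)+
  have E0': "banach_on J (NSpace UNIV norm)" using E0 by simp
  have as: "analytic_semigroup J S" and gen: "generates (car E1) A S"
    using A by (auto simp: analytic_generator_def)
  have c0: "c0_semigroup J S" using as by (simp add: analytic_semigroup_def)

  obtain Cb where Cb: "0 \<le> Cb" "\<And>t x. 0 \<le> t \<Longrightarrow> t \<le> T \<Longrightarrow> norm (S t x) \<le> Cb * norm x"
    using c0_semigroup_bounded[OF c0, of T] by auto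
  obtain Cd where Cd: "0 \<le> Cd" "\<And>t x. 0 < t \<Longrightarrow> \<exists>d. ((\<lambda>t. S t x) has_vector_derivative d) (at t) \<and>
       (t \<le> T \<longrightarrow> norm d \<le> Cd / t * norm x)"
    using analytic_semigroup_derivative[OF scalars E0' as T] by blast
  obtain lam D R C where SS: "smoothing_semigroup S D R lam T C" and E1_range: "car E1 = range R"
    and AR: "\<And>x. A (R x) = lam *\<^sub>R R x - x"
    using generator_smoothing_semigroup[OF c0 gen T Cb Cd] by blast
  interpret SS: smoothing_semigroup S D R lam T C by (rule SS)
  obtain e where e: "0 < e" "\<And>x. x \<in> car E1 \<Longrightarrow> norm x \<le> e * nrm E1 x" using EC.E1_norm by blast
  have to_norm: "s \<longlonglongrightarrow> x"
    if "\<And>k. s k \<in> car E1" "x \<in> car E1" "(\<lambda>k. nrm E1 (s k - x)) \<longlonglongrightarrow> 0" for s x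
  proof -
    have "(\<lambda>k. norm (s k - x)) \<longlonglongrightarrow> 0"
      by (rule tendsto_0_bound[OF _ _ tendsto_mult_right_zero[OF that(3), of e]])
        (use e(2)[OF normed_on_diff[OF N1 that(1,2)]] in auto)
    then show ?thesis by (simp add: tendsto_norm_zero_iff LIM_zero_iff)
  qed

  \<comment> \<open>both directions of the equivalence between the \<open>E1\<close>-norm of \<open>R y\<close> and the \<open>E0\<close>-norm of \<open>y\<close>\<close>
  have "\<exists>c\<ge>0. \<forall>x\<in>car E0. nrm E1 (R x) \<le> c * nrm E0 x"
  proof (rule closed_graph[OF E0(2) E1(1)])
    fix s x y assume lim: "y \<in> car E1" "(\<lambda>k. nrm E0 (s k - x)) \<longlonglongrightarrow> 0" "(\<lambda>k. nrm E1 (R (s k) - y)) \<longlonglongrightarrow> 0"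
    have "s \<longlonglongrightarrow> x" using lim(2) by (simp add: tendsto_norm_zero_iff LIM_zero_iff)
    from bounded_linear.tendsto[OF SS.R_linear this] have "(\<lambda>k. R (s k)) \<longlonglongrightarrow> R x" .
    moreover have "(\<lambda>k. R (s k)) \<longlonglongrightarrow> y" by (rule to_norm[OF _ lim(1,3)]) (simp add: E1_range)
    ultimately show "y = R x" using LIMSEQ_unique by blast
  qed (auto simp: E1_range linear_simps[OF SS.R_linear])
  then obtain c1' where c1': "0 \<le> c1'" "\<And>x. nrm E1 (R x) \<le> c1' * norm x" by auto
  have "\<exists>c\<ge>0. \<forall>x\<in>car E1. nrm E0 (inv R x) \<le> c * nrm E1 x"
  proof (rule closed_graph[OF E1(1) E0(2)])
    have injR: "inj R" using SS.R_inject by (auto intro: injI)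
    have iR: "inv R (R y) = y" for y by (rule inv_f_f[OF injR])
    show "inv R (x + y) = inv R x + inv R y" if "x \<in> car E1" "y \<in> car E1" for x y
      using that unfolding E1_range by (auto simp: iR simp flip: linear_simps(1)[OF SS.R_linear])
    show "inv R (c *\<^sub>R x) = c *\<^sub>R inv R x" if "x \<in> car E1" for c x
      using that unfolding E1_range by (auto simp: iR simp flip: linear_simps(5)[OF SS.R_linear])
    fix s x y assume lim: "\<And>k. s k \<in> car E1" "x \<in> car E1" "(\<lambda>k. nrm E1 (s k - x)) \<longlonglongrightarrow> 0" "(\<lambda>k. nrm E0 (inv R (s k) - y)) \<longlonglongrightarrow> 0"
    have "(\<lambda>k. inv R (s k)) \<longlonglongrightarrow> y" using lim(4) by (simp add: tendsto_norm_zero_iff LIM_zero_iff)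
    from bounded_linear.tendsto[OF SS.R_linear this] have "(\<lambda>k. R (inv R (s k))) \<longlonglongrightarrow> R y" .
    moreover have "R (inv R (s k)) = s k" for k using lim(1)[of k] f_inv_into_f[of "s k" R UNIV] by (simp add: E1_range)
    ultimately have "s \<longlonglongrightarrow> R y" by simp
    with to_norm[OF lim(1-3)] have "x = R y" using LIMSEQ_unique by blast
    then show "y = inv R x" by (simp add: iR)
  qed auto
  then obtain c2' where c2': "0 \<le> c2'" "\<And>x. x \<in> car E1 \<Longrightarrow> norm (inv R x) \<le> c2' * nrm E1 x" by auto
  have iR: "inv R (R y) = y" for y using SS.R_inject by (intro inv_f_f) (auto intro: injI)
  define c1 where "c1 = c1' + 1"
  define c2 where "c2 = c2' + 1"
  have c1: "0 < c1" "nrm E1 (R y) \<le> c1 * norm y" for y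
    using c1'(1) c1'(2)[of y] by (auto simp: c1_def distrib_right add_increasing2)
  have c2: "0 < c2" "norm y \<le> c2 * nrm E1 (R y)" for y
    using c2'(1) c2'(2)[of "R y"] nrm_nonneg[OF N1, of "R y"] by (auto simp: c2_def distrib_right add_increasing2 iR E1_range)

  interpret SC: smoothing_couple S D R lam T C J E0 E1 c1 c2
  proof (rule smoothing_couple.intro[OF SS EC.embedded_couple_axioms], rule smoothing_couple_axioms.intro)
    show "lin_on J UNIV (S t)" if "0 \<le> t" for t using c0 that by (simp add: c0_semigroup_def)
    show "bounded_linear i" if "J = Some i" for i by (rule scalar_structure_bounded[OF scalars E0' that])
  qed (fact E1_range c1 c2)+

  obtain b' where b': "continuous_on {0..T} b'" "\<And>t. t \<in> {0..T} \<Longrightarrow> (b has_vector_derivative b' t) (at t within {0..T})"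
    using b(1) by (auto simp: C1_on_def)
  have R_compact: "compact (closure (R ` cball 0 1))"
  proof -
    have comp: "compact (closure {x \<in> car E1. nrm E1 x \<le> 1})" using compact by (simp add: compactly_embedded_def)
    have "R ` cball 0 1 \<subseteq> (\<lambda>x. c1 *\<^sub>R x) ` {x \<in> car E1. nrm E1 x \<le> 1}"
    proof (rule image_subsetI)
      fix y :: 'a assume y: "y \<in> cball 0 1"
      define x where "x = R ((1 / c1) *\<^sub>R y)"
      have "R y = c1 *\<^sub>R x" using c1(1) by (simp add: x_def linear_simps(5)[OF SS.R_linear])
      moreover have "nrm E1 x \<le> 1"
      proof -
        have "nrm E1 x \<le> c1 * norm ((1 / c1) *\<^sub>R y)" unfolding x_def by (rule c1(2))
        also have "\<dots> \<le> 1" using y c1(1) by simp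
        finally show ?thesis .
      qed
      moreover have "x \<in> car E1" by (simp add: x_def E1_range)
      ultimately show "R y \<in> (\<lambda>x. c1 *\<^sub>R x) ` {x \<in> car E1. nrm E1 x \<le> 1}" by blast
    qed
    from order_trans[OF this closure_subset] show ?thesis
      by (rule compact_closure_subset[OF compact_closure_scaleR[OF comp]])
  qed

  interpret AP: average_problem S D R lam T C \<gamma> \<nu> a b b'
  proof (rule average_problem.intro)
    show "smoothing_duhamel S D R lam T C \<gamma> \<nu>"
      by (rule smoothing_duhamel.intro[OF SS], rule smoothing_duhamel_axioms.intro) (fact params)+
    show "average_problem_axioms S R T a b b'"
      by (rule average_problem_axioms.intro) (fact b' b(2) R_compact ker)+
  qed

  have F': "\<forall>\<eta>. 0 < \<eta> \<longrightarrow> \<eta> < 1 \<longrightarrow> interpolation_functor J \<eta> (F \<eta>)"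
    using F by (simp add: admissible_functor_def)
  note X_facts = EC.interp_space_facts[OF F' params(3,4), folded X_def]
  note Y_facts = EC.interp_space_facts[OF F' params(1,2), folded Y_def]

  obtain cX1 where cX1: "0 \<le> cX1" "\<And>x. x \<in> car X \<Longrightarrow> norm x \<le> cX1 * nrm X x" using X_facts(2) by blast
  obtain c where c: "EC.interp_from_E0 X \<theta> c" using X_facts(3) by blast
  obtain cX2 where cX2: "0 \<le> cX2" "\<And>t y. 0 < t \<Longrightarrow> t \<le> T \<Longrightarrow>
     R y \<in> car X \<and> nrm X (R y) \<le> cX2 * (t powr (- \<theta>) * norm (R y) + t powr (1 - \<theta>) * norm y)"
    using SC.interpolation_inequality[OF c banach_on_normed_on[OF X_facts(1)]] by blast
  obtain d where d: "EC.interp_to_E1 Y \<gamma> d" using Y_facts(4) by blast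
  obtain \<kappa>1 where \<kappa>1: "0 \<le> \<kappa>1" "\<And>t x. 0 < t \<Longrightarrow> t \<le> T \<Longrightarrow> x \<in> car Y \<Longrightarrow> norm (D t x) \<le> \<kappa>1 * t powr (\<gamma> - 1) * nrm Y x"
    using SC.interpolation_smoothing[OF d] by blast
  obtain \<kappa>2 where \<kappa>2: "0 \<le> \<kappa>2" "\<And>x. x \<in> car Y \<Longrightarrow> norm x \<le> \<kappa>2 * nrm Y x" using Y_facts(2) by blast
  define cX where "cX = max cX1 cX2"
  define \<kappa> where "\<kappa> = max \<kappa>1 \<kappa>2"
  note NX = banach_on_normed_on[OF X_facts(1)] and NY = banach_on_normed_on[OF Y_facts(1)]

  have forcing: "AP.forcing (\<kappa> * Cmu_norm \<nu> T Y g) g" if g: "g \<in> Cmu \<nu> T Y" for g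
  proof -
    have car: "g s \<in> car Y" if "0 < s" "s \<le> T" for s using Cmu_car[OF g that] .
    have small: "nrm Y (g s) \<le> Cmu_norm \<nu> T Y g * s powr (- \<nu>)" if s: "0 < s" "s \<le> T" for s
      using Cmu_norm_upper[OF NY T g s] s by (simp add: powr_minus field_simps)
    have cont: "continuous_on {0<..T} g"
      unfolding continuous_on_def
    proof
      fix t assume t: "t \<in> {0<..T}"
      have lim: "((\<lambda>s. \<kappa>2 * nrm Y (g s - g t)) \<longlongrightarrow> 0) (at t within {0<..T})"
        using g t by (intro tendsto_mult_right_zero) (auto simp: Cmu_def cont_into_def)
      have "norm (g s - g t) \<le> \<kappa>2 * nrm Y (g s - g t)" if "s \<in> {0<..T}" for s
        by (rule \<kappa>2(2)[OF normed_on_diff[OF NY car car]]) (use that t in auto)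
      from Lim_null_comparison[OF eventually_at_withinI[OF this] lim]
      show "(g \<longlongrightarrow> g t) (at t within {0<..T})" by (simp add: LIM_zero_iff)
    qed
    have kk: "k * nrm Y (g s) \<le> \<kappa> * Cmu_norm \<nu> T Y g * s powr (- \<nu>)"
      if s: "0 < s" "s \<le> T" and k: "0 \<le> k" "k \<le> \<kappa>" for k s
    proof -
      have "k * nrm Y (g s) \<le> \<kappa> * (Cmu_norm \<nu> T Y g * s powr (- \<nu>))"
        using k small[OF s] nrm_nonneg[OF NY car[OF s]] by (intro mult_mono) auto
      then show ?thesis by (simp add: mult.assoc)
    qed
    have "norm (g s) \<le> \<kappa> * Cmu_norm \<nu> T Y g * s powr (- \<nu>)" if s: "0 < s" "s \<le> T" for s
      using order_trans[OF \<kappa>2(2)[OF car[OF s]] kk[OF s \<kappa>2(1)]] by (simp add: \<kappa>_def)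
    moreover have "norm (D t (g s)) \<le> \<kappa> * Cmu_norm \<nu> T Y g * (t powr (\<gamma> - 1) * s powr (- \<nu>))"
      if s: "0 < s" "s \<le> T" and t: "0 < t" "t \<le> T" for s t
    proof -
      have "norm (D t (g s)) \<le> t powr (\<gamma> - 1) * (\<kappa>1 * nrm Y (g s))"
        using \<kappa>1(2)[OF t car[OF s]] by (simp add: mult_ac)
      also have "\<dots> \<le> t powr (\<gamma> - 1) * (\<kappa> * Cmu_norm \<nu> T Y g * s powr (- \<nu>))"
        by (intro mult_left_mono kk[OF s \<kappa>1(1)]) (auto simp: \<kappa>_def)
      finally show ?thesis by (simp add: mult_ac)
    qed
    moreover have "0 \<le> \<kappa> * Cmu_norm \<nu> T Y g"
      using Cmu_norm_nonneg[OF NY T g] \<kappa>1(1) by (simp add: \<kappa>_def)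
    ultimately show ?thesis using cont unfolding AP.forcing_def by auto
  qed

  interpret SA: semilinear_average S D R lam T C \<gamma> \<nu> a b b' J X Y \<theta> cX \<kappa> l cT f
  proof (rule semilinear_average.intro[OF AP.average_problem_axioms], rule semilinear_average_axioms.intro)
    show "norm x \<le> cX * nrm X x" if "x \<in> car X" for x
    proof -
      have "cX1 * nrm X x \<le> cX * nrm X x" using nrm_nonneg[OF NX that] by (intro mult_right_mono) (auto simp: cX_def)
      with cX1(2)[OF that] show ?thesis by linarith
    qed
    show "R y \<in> car X \<and> nrm X (R y) \<le> cX * (t powr (- \<theta>) * norm (R y) + t powr (1 - \<theta>) * norm y)"
      if t: "0 < t" "t \<le> T" for t y
    proof -
      have "cX2 * (t powr (- \<theta>) * norm (R y) + t powr (1 - \<theta>) * norm y)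
          \<le> cX * (t powr (- \<theta>) * norm (R y) + t powr (1 - \<theta>) * norm y)"
        by (intro mult_right_mono) (auto simp: cX_def)
      with cX2(2)[OF t, of y] show ?thesis by linarith
    qed
    show "\<exists>y. norm (R y - x) < \<epsilon>" if "0 < \<epsilon>" for x \<epsilon>
      using E1(3) that unfolding dense_in_def E1_range by simp
    show "AP.forcing (\<kappa> * Cmu_norm \<nu> T Y g) g" if "g \<in> Cmu \<nu> T Y" for g by (rule forcing[OF that])
    show "f v \<in> Cmu \<nu> T Y" if "v \<in> Cmu \<theta> T X" for v using f_maps that by (simp add: X_def Y_def)
    show "Cmu_norm \<nu> T Y (\<lambda>t. f v t - f w t) \<le> cT * L powr l * Cmu_norm \<theta> T X (\<lambda>t. v t - w t)"
      if "0 < L" "L < 1" "v \<in> Cmu \<theta> T X" "w \<in> Cmu \<theta> T X" "Cmu_norm \<theta> T X v + Cmu_norm \<theta> T X w \<le> L"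
        "\<forall>t\<in>{0<..T}. norm (v t) + norm (w t) \<le> L" for L v w
      using f_local[of L v w] that unfolding X_def Y_def by blast
    show "0 \<le> cX" "0 \<le> \<kappa>" using cX1(1) \<kappa>1(1) by (auto simp: cX_def \<kappa>_def)
  qed (fact X_facts(1) Y_facts(1) params f_zero)+

  obtain \<mu> r where \<mu>: "0 < \<mu>" and r: "0 < r" and sol: "\<And>m. norm m \<le> \<mu> \<Longrightarrow>
     \<exists>u \<omega>. SA.solves m u \<omega> \<and> continuous_on {0<..T} \<omega> \<and> continuous_on {0<..T} (f u) \<and>
        u \<in> Cmu \<theta> T X \<and> u \<in> small_ball \<theta> T X r \<and>
        (\<forall>w \<omega>. SA.solves m w \<omega> \<longrightarrow> w \<in> Cmu \<theta> T X \<longrightarrow> w \<in> small_ball \<theta> T X r \<longrightarrow> (\<forall>t\<in>{0..T}. w t = u t))"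
    using SA.small_solutions by blast
  \<comment> \<open>smallness of \<open>M = R m\<close> in \<open>E1\<close> is smallness of \<open>m\<close> in \<open>E0\<close>\<close>
  show ?thesis
    unfolding X_def[symmetric]
  proof (rule exI[of _ "\<mu> / c2"], rule conjI, simp add: \<mu> c2(1), rule exI[of _ r], rule conjI[OF r], intro ballI impI)
    fix M assume M: "M \<in> car E1" "nrm E1 M \<le> \<mu> / c2"
    then obtain m where m: "M = R m" unfolding E1_range by blast
    have "norm m \<le> c2 * nrm E1 M" using c2(2)[of m] by (simp add: m)
    also have "\<dots> \<le> \<mu>" using M(2) c2(1) by (simp add: pos_le_divide_eq mult.commute)
    finally obtain u \<omega> where usol: "SA.solves m u \<omega>" and u\<omega>: "continuous_on {0<..T} \<omega>" "continuous_on {0<..T} (f u)"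
        and uC: "u \<in> Cmu \<theta> T X" "u \<in> small_ball \<theta> T X r"
        and uniq: "\<And>w \<omega>. SA.solves m w \<omega> \<Longrightarrow> w \<in> Cmu \<theta> T X \<Longrightarrow> w \<in> small_ball \<theta> T X r \<Longrightarrow> \<forall>t\<in>{0..T}. w t = u t"
      using sol[of m] by blast
    have uc: "continuous_on {0..T} u"
      and uR: "\<And>t. t \<in> {0<..T} \<Longrightarrow> u t = R (\<omega> t)"
      and du: "\<And>t. t \<in> {0<..T} \<Longrightarrow> (u has_vector_derivative (lam *\<^sub>R u t - \<omega> t + f u t)) (at t within {0<..T})"
      and avg: "a *\<^sub>R u T + integral {0..T} (\<lambda>t. b t *\<^sub>R u t) = R m"
      using usol unfolding SA.solves_def by blast+
    have "strong_solution T a b E1 A f M u"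
      unfolding strong_solution_def
    proof (intro conjI ballI)
      show "C1_on {0<..T} u"
        unfolding C1_on_def
      proof (intro exI[of _ "\<lambda>t. lam *\<^sub>R u t - \<omega> t + f u t"] conjI ballI)
        have "continuous_on {0<..T} u" by (rule continuous_on_subset[OF uc]) auto
        then show "continuous_on {0<..T} (\<lambda>t. lam *\<^sub>R u t - \<omega> t + f u t)" by (intro continuous_intros u\<omega>)
      qed (rule du)
      show "cont_into {0<..T} E1 u"
        unfolding cont_into_def
      proof (intro ballI conjI)
        fix t assume t: "t \<in> {0<..T}"
        show "u t \<in> car E1" using uR[OF t] E1_range by simp
        have "((\<lambda>s. \<omega> s - \<omega> t) \<longlongrightarrow> 0) (at t within {0<..T})" using u\<omega>(1) t by (simp add: continuous_on_def LIM_zero)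
        from tendsto_mult_right_zero[OF tendsto_norm_zero[OF this], of c1]
        show "((\<lambda>s. nrm E1 (u s - u t)) \<longlongrightarrow> 0) (at t within {0<..T})"
        proof (rule tendsto_sandwich[OF _ _ tendsto_const, rotated 2])
          have bnd: "0 \<le> nrm E1 (u s - u t) \<and> nrm E1 (u s - u t) \<le> c1 * norm (\<omega> s - \<omega> t)" if "s \<in> {0<..T}" for s
          proof -
            have "u s - u t = R (\<omega> s - \<omega> t)" using uR[OF t] uR[OF that] by (simp add: linear_simps(2)[OF SS.R_linear])
            then show ?thesis using c1(2)[of "\<omega> s - \<omega> t"] SC.E1_R_norm_nonneg[of "\<omega> s - \<omega> t"] by simp
          qed
          show "\<forall>\<^sub>F s in at t within {0<..T}. 0 \<le> nrm E1 (u s - u t)"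
            "\<forall>\<^sub>F s in at t within {0<..T}. nrm E1 (u s - u t) \<le> c1 * norm (\<omega> s - \<omega> t)"
            by (rule eventually_at_withinI, use bnd in blast)+
        qed
      qed
      show "(u has_vector_derivative (A (u t) + f u t)) (at t within {0<..T})" if "t \<in> {0<..T}" for t
        using du[OF that] uR[OF that] by (simp add: AR)
    qed (use uc avg m in simp_all)
    moreover have "\<forall>t\<in>{0..T}. w t = u t"
      if w: "strong_solution T a b E1 A f M w" "w \<in> Cmu \<theta> T X" "w \<in> small_ball \<theta> T X r" for w
    proof (rule uniq[of w "\<lambda>t. inv R (w t)"])
      have wR: "w t = R (inv R (w t))" if "t \<in> {0<..T}" for t
      proof -
        have "w t \<in> range R" using w(1) that by (auto simp: strong_solution_def cont_into_def E1_range)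
        then show ?thesis by (simp add: f_inv_into_f)
      qed
      have "A (w t) = lam *\<^sub>R w t - inv R (w t)" if "t \<in> {0<..T}" for t
        using AR[of "inv R (w t)"] wR[OF that, symmetric] by simp
      then show "SA.solves m w (\<lambda>t. inv R (w t))"
        using w(1) wR m unfolding SA.solves_def strong_solution_def by simp
    qed (fact w)+
    ultimately show "\<exists>u. strong_solution T a b E1 A f M u \<and> u \<in> Cmu \<theta> T X \<and> u \<in> small_ball \<theta> T X r \<and>
       (\<forall>w. strong_solution T a b E1 A f M w \<and> w \<in> Cmu \<theta> T X \<and> w \<in> small_ball \<theta> T X r \<longrightarrow> (\<forall>t\<in>{0..T}. w t = u t))"
      using uC by blast
  qed
qed

end
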